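(* Let $\Lambda$ be a row finite $k$-graph with no sources, let $\mathcal G$ be the associated path groupoid, let $\mathcal A = C^*(\Lambda) = C^*(\mathcal G)$ and $\mathcal D = C_0(\Lambda^\infty) \subseteq \mathcal A$. Let $\mathcal B \subseteq \mathcal A$ be a (norm-closed) bimodule over $\mathcal D$. Then the following are equivalent: (1) $\mathcal B = A(\sigma(\mathcal B))$. (2) $\mathcal B$ is generated (as a norm-closed $\mathcal D$-bimodule) by the Cuntz-Krieger partial isometries which it contains, i.e. by the elements $s_\lambda s_\mu^*$ ($\lambda,\mu\in\Lambda$, $s(\lambda)=s(\mu)$) that lie in $\mathcal B$. (3) $\mathcal B$ is invariant under the gauge automorphisms, i.e. $\gamma_t(\mathcal B)\subseteq \mathcal B$ for all $t \in \mathbb T^k$.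
   Context: **$k$-graphs.** A $k$-graph $(\Lambda,d)$ is a small category $\Lambda$ with a functor $d\colon\Lambda\to\mathbb N^k$ satisfying the factorization property: if $d(\lambda)=m+n$ with $m,n\in\mathbb N^k$, there exist unique $\mu,\nu\in\Lambda$ with $\lambda=\mu\nu$, $d(\mu)=m$, $d(\nu)=n$. Here $\mathbb N$ includes $0$, and $r,s$ denote range and source, so $\lambda$ is a morphism from $s(\lambda)$ to $r(\lambda)$, and $\lambda\mu$ is defined when $r(\mu)=s(\lambda)$. $\Lambda^n=d^{-1}(n)$, and $\Lambda^0$ is identified with the objects. For an object $v$ and $n\in\mathbb N^k$, $\Lambda^n(v)=\{\lambda\in\Lambda : d(\lambda)=n,\ r(\lambda)=v\}$. "Row finite with no sources" means every $\Lambda^n(v)$ is finite and non-empty. **Infinite paths.** $\Omega_k$ is the $k$-graph with objects $\mathbb N^k$, morphisms $\{(m,n)\in\mathbb N^k\times\mathbb N^k: m\le n\}$, $r(m,n)=m$, $s(m,n)=n$, $d(m,n)=n-m$. $\Lambda^\infty$ is the set of $k$-graph morphisms (degree-preserving functors) $x\colon\Omega_k\to\Lambda$; $x(0)$ denotes the object $x(0,0)$, and $\Lambda^\infty(v)=\{x\in\Lambda^\infty: x(0)=v\}$. For $p\in\mathbb N^k$, $\sigma^p(x)(m,n)=x(m+p,n+p)$. If $x(0)=s(\lambda)$, then $\lambda x$ is the unique $y\in\Lambda^\infty$ with $y(0,d(\lambda))=\lambda$ and $\sigma^{d(\lambda)}y=x$. $\Lambda^\infty$ has the topology generated by the (compact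 open) sets $Z(\lambda)=\{y\in\Lambda^\infty: y(0,d(\lambda))=\lambda\}$. **Path groupoid.** $\mathcal G=\{(x,n,y)\in\Lambda^\infty\times\mathbb Z^k\times\Lambda^\infty : \sigma^px=\sigma^qy \text{ and } n=p-q \text{ for some } p,q\in\mathbb N^k\}$, with $(x,n,y)(y,m,z)=(x,n+m,z)$ and $(x,n,y)^{-1}=(y,-n,x)$. A basis for its topology is given by the compact open sets $Z(\lambda,\mu)=\{(\lambda z,d(\lambda)-d(\mu),\mu z): z\in\Lambda^\infty(v)\}$ for $\lambda,\mu\in\Lambda$ with $s(\lambda)=s(\mu)=v$. $\mathcal G$ is a locally compact Hausdorff, $r$-discrete (étale), amenable groupoid. The unit space $\mathcal G^0=\{(x,0,x)\}$ is identified homeomorphically with $\Lambda^\infty$ via $x\mapsto(x,0,x)$. **The $C^*$-algebra.** $C^*(\Lambda)$ is the universal $C^*$-algebra generated by partial isometries $\{s_\lambda:\lambda\in\Lambda\}$ such that: $\{s_v: v\in\Lambda^0\}$ are mutually orthogonal projections; $s_{\lambda\mu}=s_\lambda s_\mu$ whenever $r(\mu)=s(\lambda)$; $s_\lambda^*s_\lambda=s_{s(\lambda)}$; and $s_v=\sum_{\lambda\in\Lambda^n(v)}s_\lambda s_\lambda^*$ for all $v\in\Lambda^0$, $n\in\mathbb N^k$. It is isomorphic to $C^*(\mathcal G)=C^*_{\mathrm{red}}(\mathcal G)$ (with counting measures as Haar system), with $s_\lambda$ corresponding to the characteristic function of $Z(\lambda,s(\lambda))$, so that $s_\lambda s_\mu^*$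 is the characteristic function of $Z(\lambda,\mu)$ when $s(\lambda)=s(\mu)$. Elements of $\mathcal A=C^*(\mathcal G)$ are viewed as functions in $C_0(\mathcal G)$ through the standard injective norm-decreasing linear map $C^*_{\mathrm{red}}(\mathcal G)\to C_0(\mathcal G)$ extending the identity on $C_c(\mathcal G)$; the product is convolution. $\mathcal D=C_0(\Lambda^\infty)$ is the abelian subalgebra of elements of $\mathcal A$ supported on $\mathcal G^0$. **Gauge automorphisms.** For $t\in\mathbb T^k$, $\gamma_t$ is the automorphism of $\mathcal A$ with $\gamma_t(s_\lambda)=t^{d(\lambda)}s_\lambda$ for all $\lambda$, where $t^n=t_1^{n_1}\cdots t_k^{n_k}$. **Bimodules and spectra.** A bimodule over $\mathcal D$ is a norm-closed linear subspace $\mathcal B\subseteq\mathcal A$ with $\mathcal D\mathcal B\subseteq\mathcal B$ and $\mathcal B\mathcal D\subseteq\mathcal B$. Its spectrum is the open set $\sigma(\mathcal B)=\{(x,n,y)\in\mathcal G: f(x,n,y)\ne0\text{ for some }f\in\mathcal B\}$. For an open set $P\subseteq\mathcal G$, $A(P)=\{f\in\mathcal A: f(x,n,y)=0\text{ for all }(x,n,y)\notin P\}$. *)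

theory Defs
  imports "HOL-Analysis.Analysis"
begin

section \<open>Higher rank graphs\<close>

text \<open>
  A small category is given by its set of morphisms alone: an object is identified with its
  identity morphism, so \<open>rng\<close> and \<open>src\<close> take values in morphisms.
  \<open>cmp \<Lambda> \<mu> \<nu>\<close> is the product \<open>\<mu>\<nu>\<close>, meaningful when \<open>src \<Lambda> \<mu> = rng \<Lambda> \<nu>\<close>.
  The rank is the cardinality of the finite index type \<open>'k\<close>.
\<close>

record ('m, 'k::finite) kgraph =
  mor :: "'m set"
  rng :: "'m \<Rightarrow> 'm"
  src :: "'m \<Rightarrow> 'm"
  cmp :: "'m \<Rightarrow> 'm \<Rightarrow> 'm"
  deg :: "'m \<Rightarrow> nat ^ 'k"

definition small_category :: "('m, 'k::finite) kgraph \<Rightarrow> bool" where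
  "small_category \<Lambda> \<longleftrightarrow>
     (\<forall>\<mu>\<in>mor \<Lambda>. rng \<Lambda> \<mu> \<in> mor \<Lambda> \<and> src \<Lambda> \<mu> \<in> mor \<Lambda>
        \<and> rng \<Lambda> (rng \<Lambda> \<mu>) = rng \<Lambda> \<mu> \<and> src \<Lambda> (rng \<Lambda> \<mu>) = rng \<Lambda> \<mu>
        \<and> rng \<Lambda> (src \<Lambda> \<mu>) = src \<Lambda> \<mu> \<and> src \<Lambda> (src \<Lambda> \<mu>) = src \<Lambda> \<mu>
        \<and> cmp \<Lambda> (rng \<Lambda> \<mu>) \<mu> = \<mu> \<and> cmp \<Lambda> \<mu> (src \<Lambda> \<mu>) = \<mu>)
   \<and> (\<forall>\<mu>\<in>mor \<Lambda>. \<forall>\<nu>\<in>mor \<Lambda>. src \<Lambda> \<mu> = rng \<Lambda> \<nu> \<longrightarrow>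
        cmp \<Lambda> \<mu> \<nu> \<in> mor \<Lambda> \<and> rng \<Lambda> (cmp \<Lambda> \<mu> \<nu>) = rng \<Lambda> \<mu> \<and> src \<Lambda> (cmp \<Lambda> \<mu> \<nu>) = src \<Lambda> \<nu>)
   \<and> (\<forall>\<mu>\<in>mor \<Lambda>. \<forall>\<nu>\<in>mor \<Lambda>. \<forall>\<kappa>\<in>mor \<Lambda>. src \<Lambda> \<mu> = rng \<Lambda> \<nu> \<and> src \<Lambda> \<nu> = rng \<Lambda> \<kappa> \<longrightarrow>
        cmp \<Lambda> (cmp \<Lambda> \<mu> \<nu>) \<kappa> = cmp \<Lambda> \<mu> (cmp \<Lambda> \<nu> \<kappa>))"

definition degree_functor :: "('m, 'k::finite) kgraph \<Rightarrow> bool" where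
  "degree_functor \<Lambda> \<longleftrightarrow>
     (\<forall>\<mu>\<in>mor \<Lambda>. deg \<Lambda> (rng \<Lambda> \<mu>) = 0 \<and> deg \<Lambda> (src \<Lambda> \<mu>) = 0)
   \<and> (\<forall>\<mu>\<in>mor \<Lambda>. \<forall>\<nu>\<in>mor \<Lambda>. src \<Lambda> \<mu> = rng \<Lambda> \<nu> \<longrightarrow>
        deg \<Lambda> (cmp \<Lambda> \<mu> \<nu>) = deg \<Lambda> \<mu> + deg \<Lambda> \<nu>)"

definition factorization_property :: "('m, 'k::finite) kgraph \<Rightarrow> bool" where
  "factorization_property \<Lambda> \<longleftrightarrow>
     (\<forall>\<kappa>\<in>mor \<Lambda>. \<forall>m n. deg \<Lambda> \<kappa> = m + n \<longrightarrow>
        (\<exists>!p. case p of (\<mu>, \<nu>) \<Rightarrow>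
           \<mu> \<in> mor \<Lambda> \<and> \<nu> \<in> mor \<Lambda> \<and> src \<Lambda> \<mu> = rng \<Lambda> \<nu>
           \<and> \<kappa> = cmp \<Lambda> \<mu> \<nu> \<and> deg \<Lambda> \<mu> = m \<and> deg \<Lambda> \<nu> = n))"

definition is_kgraph :: "('m, 'k::finite) kgraph \<Rightarrow> bool" where
  "is_kgraph \<Lambda> \<longleftrightarrow> small_category \<Lambda> \<and> degree_functor \<Lambda> \<and> factorization_property \<Lambda>"

text \<open>By the factorization property the morphisms of degree \<open>0\<close> are exactly the identities.\<close>

definition objects :: "('m, 'k::finite) kgraph \<Rightarrow> 'm set" where
  "objects \<Lambda> = {v \<in> mor \<Lambda>. deg \<Lambda> v = 0}"

definition paths_to :: "('m, 'k::finite) kgraph \<Rightarrow> nat ^ 'k \<Rightarrow> 'm \<Rightarrow> 'm set" where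
  "paths_to \<Lambda> n v = {\<mu> \<in> mor \<Lambda>. deg \<Lambda> \<mu> = n \<and> rng \<Lambda> \<mu> = v}"

definition row_finite_no_sources :: "('m, 'k::finite) kgraph \<Rightarrow> bool" where
  "row_finite_no_sources \<Lambda> \<longleftrightarrow>
     (\<forall>v\<in>objects \<Lambda>. \<forall>n. finite (paths_to \<Lambda> n v) \<and> paths_to \<Lambda> n v \<noteq> {})"

definition kgraph_morphism ::
  "('a, 'k::finite) kgraph \<Rightarrow> ('m, 'k) kgraph \<Rightarrow> ('a \<Rightarrow> 'm) \<Rightarrow> bool" where
  "kgraph_morphism \<Gamma> \<Lambda> \<phi> \<longleftrightarrow>
     (\<forall>a\<in>mor \<Gamma>. \<phi> a \<in> mor \<Lambda> \<and> rng \<Lambda> (\<phi> a) = \<phi> (rng \<Gamma> a) \<and> src \<Lambda> (\<phi> a) = \<phi> (src \<Gamma> a)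
        \<and> deg \<Lambda> (\<phi> a) = deg \<Gamma> a)
   \<and> (\<forall>a\<in>mor \<Gamma>. \<forall>b\<in>mor \<Gamma>. src \<Gamma> a = rng \<Gamma> b \<longrightarrow> \<phi> (cmp \<Gamma> a b) = cmp \<Lambda> (\<phi> a) (\<phi> b))"

section \<open>Infinite paths\<close>

definition Omega :: "((nat ^ 'k) \<times> (nat ^ 'k), 'k::finite) kgraph" where
  "Omega = \<lparr>mor = {(m, n). m \<le> n},
            rng = (\<lambda>(m, n). (m, m)),
            src = (\<lambda>(m, n). (n, n)),
            cmp = (\<lambda>(m, n) (n', p). (m, p)),
            deg = (\<lambda>(m, n). n - m)\<rparr>"

type_synonym ('m, 'k) ipath = "(nat ^ 'k) \<times> (nat ^ 'k) \<Rightarrow> 'm"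

text \<open>Functions are extensional so that equality of infinite paths is equality in HOL.\<close>

definition inf_paths :: "('m, 'k::finite) kgraph \<Rightarrow> ('m, 'k) ipath set" where
  "inf_paths \<Lambda> = {x \<in> extensional (mor Omega). kgraph_morphism Omega \<Lambda> x}"

definition shift :: "nat ^ 'k \<Rightarrow> ('m, 'k::finite) ipath \<Rightarrow> ('m, 'k) ipath" where
  "shift p x = (\<lambda>(m, n). x (m + p, n + p))"

definition prepend :: "('m, 'k::finite) kgraph \<Rightarrow> 'm \<Rightarrow> ('m, 'k) ipath \<Rightarrow> ('m, 'k) ipath" where
  "prepend \<Lambda> \<mu> x =
     (THE y. y \<in> inf_paths \<Lambda> \<and> y (0, deg \<Lambda> \<mu>) = \<mu> \<and> shift (deg \<Lambda> \<mu>) y = x)"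

section \<open>The path groupoid\<close>

type_synonym ('m, 'k) garrow = "('m, 'k) ipath \<times> (int ^ 'k) \<times> ('m, 'k) ipath"

definition deg_diff :: "nat ^ 'k \<Rightarrow> nat ^ 'k \<Rightarrow> int ^ 'k::finite" where
  "deg_diff p q = (\<chi> i. int (p $ i) - int (q $ i))"

definition groupoid :: "('m, 'k::finite) kgraph \<Rightarrow> ('m, 'k) garrow set" where
  "groupoid \<Lambda> = {(x, n, y). x \<in> inf_paths \<Lambda> \<and> y \<in> inf_paths \<Lambda>
                  \<and> (\<exists>p q. shift p x = shift q y \<and> n = deg_diff p q)}"

fun g_rng :: "('m, 'k::finite) garrow \<Rightarrow> ('m, 'k) ipath" where
  "g_rng (x, n, y) = x"

fun g_src :: "('m, 'k::finite) garrow \<Rightarrow> ('m, 'k) ipath" where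
  "g_src (x, n, y) = y"

fun g_mult :: "('m, 'k::finite) garrow \<Rightarrow> ('m, 'k) garrow \<Rightarrow> ('m, 'k) garrow" where
  "g_mult (x, n, y) (y', m, z) = (x, n + m, z)"

fun g_inv :: "('m, 'k::finite) garrow \<Rightarrow> ('m, 'k) garrow" where
  "g_inv (x, n, y) = (y, - n, x)"

definition units :: "('m, 'k::finite) kgraph \<Rightarrow> ('m, 'k) garrow set" where
  "units \<Lambda> = {(x, 0, x) | x. x \<in> inf_paths \<Lambda>}"

definition cylinder :: "('m, 'k::finite) kgraph \<Rightarrow> 'm \<Rightarrow> 'm \<Rightarrow> ('m, 'k) garrow set" where
  "cylinder \<Lambda> \<mu> \<nu> =
     {(prepend \<Lambda> \<mu> z, deg_diff (deg \<Lambda> \<mu>) (deg \<Lambda> \<nu>), prepend \<Lambda> \<nu> z) | z.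
        z \<in> inf_paths \<Lambda> \<and> z (0, 0) = src \<Lambda> \<mu>}"

definition groupoid_topology :: "('m, 'k::finite) kgraph \<Rightarrow> ('m, 'k) garrow topology" where
  "groupoid_topology \<Lambda> =
     topology_generated_by
       {cylinder \<Lambda> \<mu> \<nu> | \<mu> \<nu>. \<mu> \<in> mor \<Lambda> \<and> \<nu> \<in> mor \<Lambda> \<and> src \<Lambda> \<mu> = src \<Lambda> \<nu>}"

section \<open>The groupoid C*-algebra as an algebra of functions\<close>

text \<open>A function on the groupoid is represented by its extension by zero to the ambient type.\<close>

definition Cc :: "('m, 'k::finite) kgraph \<Rightarrow> (('m, 'k) garrow \<Rightarrow> complex) set" where
  "Cc \<Lambda> = {f. (\<forall>a. a \<notin> groupoid \<Lambda> \<longrightarrow> f a = 0)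
            \<and> continuous_map (groupoid_topology \<Lambda>) euclidean f
            \<and> compactin (groupoid_topology \<Lambda>)
                (groupoid_topology \<Lambda> closure_of {a \<in> groupoid \<Lambda>. f a \<noteq> 0})}"

definition conv ::
  "('m, 'k::finite) kgraph \<Rightarrow> (('m, 'k) garrow \<Rightarrow> complex) \<Rightarrow> (('m, 'k) garrow \<Rightarrow> complex)
     \<Rightarrow> ('m, 'k) garrow \<Rightarrow> complex" where
  "conv \<Lambda> f g = (\<lambda>a. if a \<in> groupoid \<Lambda>
     then \<Sum>\<^sub>\<infinity>(b, c) \<in> {(b, c). b \<in> groupoid \<Lambda> \<and> c \<in> groupoid \<Lambda> \<and> g_src b = g_rng c \<and> g_mult b c = a}.
            f b * g c
     else 0)"

definition star ::
  "('m, 'k::finite) kgraph \<Rightarrow> (('m, 'k) garrow \<Rightarrow> complex) \<Rightarrow> ('m, 'k) garrow \<Rightarrow> complex" where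
  "star \<Lambda> f = (\<lambda>a. if a \<in> groupoid \<Lambda> then cnj (f (g_inv a)) else 0)"

definition l2_norm ::
  "('m, 'k::finite) kgraph \<Rightarrow> (('m, 'k) garrow \<Rightarrow> complex) \<Rightarrow> ennreal" where
  "l2_norm \<Lambda> \<xi> = (SUP F \<in> {F. finite F \<and> F \<subseteq> groupoid \<Lambda>}. ennreal (L2_set (\<lambda>a. cmod (\<xi> a)) F))"

text \<open>
  For an infinite path \<open>x\<close> let \<open>G\<^sub>x\<close> be the set of groupoid elements with source \<open>x\<close>. The regular
  representation \<open>\<pi>\<^sub>x\<close> on \<open>\<ell>\<^sup>2(G\<^sub>x)\<close> is \<open>\<pi>\<^sub>x(f) \<xi> = f * \<xi>\<close>, and the reduced norm of \<open>f\<close> is the supremum of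
  the operator norms of all \<open>\<pi>\<^sub>x(f)\<close>. Operator norms are computed on the dense subspace of finitely
  supported vectors, for which the sum defining \<open>f * \<xi>\<close> is finite; hence the definition makes sense
  for every function \<open>f\<close>, with value \<open>\<infinity>\<close> when the operators are not uniformly bounded.
\<close>

definition unit_vectors ::
  "('m, 'k::finite) kgraph \<Rightarrow> ('m, 'k) ipath \<Rightarrow> (('m, 'k) garrow \<Rightarrow> complex) set" where
  "unit_vectors \<Lambda> x = {\<xi>. finite {a. \<xi> a \<noteq> 0} \<and> {a. \<xi> a \<noteq> 0} \<subseteq> {a \<in> groupoid \<Lambda>. g_src a = x}
                        \<and> l2_norm \<Lambda> \<xi> \<le> 1}"

definition red_norm ::
  "('m, 'k::finite) kgraph \<Rightarrow> (('m, 'k) garrow \<Rightarrow> complex) \<Rightarrow> ennreal" where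
  "red_norm \<Lambda> f = (SUP x \<in> inf_paths \<Lambda>. SUP \<xi> \<in> unit_vectors \<Lambda> x. l2_norm \<Lambda> (conv \<Lambda> f \<xi>))"

text \<open>
  The closure of a set of functions on the groupoid in the reduced norm.
  An element \<open>a\<close> of the completion of \<open>C\<^sub>c(G)\<close> is sent by the standard map into \<open>C\<^sub>0(G)\<close> to the function
  \<open>j(a)(g) = \<langle>\<pi>\<^sub>x(a) \<delta>\<^sub>x, \<delta>\<^sub>g\<rangle>\<close>, where \<open>x\<close> is the source of \<open>g\<close>, and \<open>\<pi>\<^sub>x(a)\<close> is convolution by \<open>j(a)\<close>.
  Since the functions of finite reduced norm form a Banach space, the image of the completion
  is the closure of \<open>C\<^sub>c(G)\<close> among them, and \<open>red_norm\<close> is the norm carried over from the completion.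
\<close>

definition norm_closure ::
  "('m, 'k::finite) kgraph \<Rightarrow> (('m, 'k) garrow \<Rightarrow> complex) set \<Rightarrow> (('m, 'k) garrow \<Rightarrow> complex) set"
  where
  "norm_closure \<Lambda> S =
     {f. (\<forall>a. a \<notin> groupoid \<Lambda> \<longrightarrow> f a = 0)
       \<and> (\<forall>\<epsilon>>0. \<exists>g\<in>S. red_norm \<Lambda> (\<lambda>a. f a - g a) < ennreal \<epsilon>)}"

definition Cstar :: "('m, 'k::finite) kgraph \<Rightarrow> (('m, 'k) garrow \<Rightarrow> complex) set" where
  "Cstar \<Lambda> = norm_closure \<Lambda> (Cc \<Lambda>)"

definition diagonal :: "('m, 'k::finite) kgraph \<Rightarrow> (('m, 'k) garrow \<Rightarrow> complex) set" where
  "diagonal \<Lambda> = {f \<in> Cstar \<Lambda>. \<forall>a. f a \<noteq> 0 \<longrightarrow> a \<in> units \<Lambda>}"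

definition gen :: "('m, 'k::finite) kgraph \<Rightarrow> 'm \<Rightarrow> ('m, 'k) garrow \<Rightarrow> complex" where
  "gen \<Lambda> \<mu> = indicator (cylinder \<Lambda> \<mu> (src \<Lambda> \<mu>))"

definition CK_partial_isometries ::
  "('m, 'k::finite) kgraph \<Rightarrow> (('m, 'k) garrow \<Rightarrow> complex) set" where
  "CK_partial_isometries \<Lambda> =
     {conv \<Lambda> (gen \<Lambda> \<mu>) (star \<Lambda> (gen \<Lambda> \<nu>)) | \<mu> \<nu>. \<mu> \<in> mor \<Lambda> \<and> \<nu> \<in> mor \<Lambda> \<and> src \<Lambda> \<mu> = src \<Lambda> \<nu>}"

section \<open>Gauge automorphisms\<close>

definition torus :: "(complex ^ 'k::finite) set" where
  "torus = {t. \<forall>i. cmod (t $ i) = 1}"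

definition tpow :: "complex ^ 'k \<Rightarrow> nat ^ 'k::finite \<Rightarrow> complex" where
  "tpow t n = (\<Prod>i\<in>UNIV. (t $ i) ^ (n $ i))"

definition automorphism ::
  "('m, 'k::finite) kgraph \<Rightarrow> ((('m, 'k) garrow \<Rightarrow> complex) \<Rightarrow> ('m, 'k) garrow \<Rightarrow> complex) \<Rightarrow> bool"
  where
  "automorphism \<Lambda> \<gamma> \<longleftrightarrow>
     bij_betw \<gamma> (Cstar \<Lambda>) (Cstar \<Lambda>)
   \<and> (\<forall>f\<in>Cstar \<Lambda>. \<forall>g\<in>Cstar \<Lambda>. \<gamma> (\<lambda>a. f a + g a) = (\<lambda>a. \<gamma> f a + \<gamma> g a))
   \<and> (\<forall>c. \<forall>f\<in>Cstar \<Lambda>. \<gamma> (\<lambda>a. c * f a) = (\<lambda>a. c * \<gamma> f a))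
   \<and> (\<forall>f\<in>Cstar \<Lambda>. \<forall>g\<in>Cstar \<Lambda>. \<gamma> (conv \<Lambda> f g) = conv \<Lambda> (\<gamma> f) (\<gamma> g))
   \<and> (\<forall>f\<in>Cstar \<Lambda>. \<gamma> (star \<Lambda> f) = star \<Lambda> (\<gamma> f))
   \<and> (\<forall>f\<in>Cstar \<Lambda>. red_norm \<Lambda> (\<gamma> f) = red_norm \<Lambda> f)"

text \<open>Extensionality makes the automorphism unique as a function on the ambient type.\<close>

definition gauge_aut ::
  "('m, 'k::finite) kgraph \<Rightarrow> complex ^ 'k
     \<Rightarrow> (('m, 'k) garrow \<Rightarrow> complex) \<Rightarrow> ('m, 'k) garrow \<Rightarrow> complex" where
  "gauge_aut \<Lambda> t =
     (THE \<gamma>. \<gamma> \<in> extensional (Cstar \<Lambda>) \<and> automorphism \<Lambda> \<gamma>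
        \<and> (\<forall>\<mu>\<in>mor \<Lambda>. \<gamma> (gen \<Lambda> \<mu>) = (\<lambda>a. tpow t (deg \<Lambda> \<mu>) * gen \<Lambda> \<mu> a)))"

section \<open>Bimodules and spectra\<close>

definition bimodule ::
  "('m, 'k::finite) kgraph \<Rightarrow> (('m, 'k) garrow \<Rightarrow> complex) set \<Rightarrow> bool" where
  "bimodule \<Lambda> B \<longleftrightarrow>
     B \<subseteq> Cstar \<Lambda>
   \<and> (\<lambda>a. 0) \<in> B
   \<and> (\<forall>f\<in>B. \<forall>g\<in>B. (\<lambda>a. f a + g a) \<in> B)
   \<and> (\<forall>c. \<forall>f\<in>B. (\<lambda>a. c * f a) \<in> B)
   \<and> norm_closure \<Lambda> B \<subseteq> B
   \<and> (\<forall>h\<in>diagonal \<Lambda>. \<forall>f\<in>B. conv \<Lambda> h f \<in> B \<and> conv \<Lambda> f h \<in> B)"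

definition generated_bimodule ::
  "('m, 'k::finite) kgraph \<Rightarrow> (('m, 'k) garrow \<Rightarrow> complex) set \<Rightarrow> (('m, 'k) garrow \<Rightarrow> complex) set"
  where
  "generated_bimodule \<Lambda> S = \<Inter>{B. bimodule \<Lambda> B \<and> S \<subseteq> B}"

definition spectrum ::
  "('m, 'k::finite) kgraph \<Rightarrow> (('m, 'k) garrow \<Rightarrow> complex) set \<Rightarrow> ('m, 'k) garrow set" where
  "spectrum \<Lambda> B = {a \<in> groupoid \<Lambda>. \<exists>f\<in>B. f a \<noteq> 0}"

definition supported_in ::
  "('m, 'k::finite) kgraph \<Rightarrow> ('m, 'k) garrow set \<Rightarrow> (('m, 'k) garrow \<Rightarrow> complex) set" where
  "supported_in \<Lambda> P = {f \<in> Cstar \<Lambda>. \<forall>a\<in>groupoid \<Lambda>. a \<notin> P \<longrightarrow> f a = 0}"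

end

theory Submission
  imports Defs
begin

text \<open>
  Everything is expressed through the matrices \<open>f (a b\<^sup>-\<^sup>1)\<close> of a function \<open>f\<close> in the regular
  representations. A kernel of the form \<open>k (a b\<^sup>-\<^sup>1) = (\<Sum>i. p i a * q i b)\<close>, with \<open>p\<close> and \<open>q\<close> in the unit
  ball of \<open>\<ell>\<^sup>2\<close> for each \<open>a\<close> and \<open>b\<close>, acts on \<open>f\<close> as a contractive Schur multiplier. Restriction to
  a fixed degree, to a cylinder, or to a finite block of cylinders, and multiplication by Fejer kernels
  are all of this kind. Since the functions
  \<open>s\<^sub>\<mu> s\<^sub>\<nu>\<^sup>*\<close>, which are the indicators of the cylinders \<open>Z(\<mu>, \<nu>)\<close>, span a dense subspace, an element \<open>f\<close>
  lies in a closed subspace as soon as all its restrictions to cylinders do.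

  If \<open>\<B>\<close> is a gauge invariant bimodule and \<open>f \<in> \<B>\<close>, then averaging over roots of unity and compressing by
  projections of \<open>\<D>\<close> shows \<open>f|Z(\<mu>, \<nu>) \<in> \<B>\<close>. Dividing by nearly constant values of \<open>f\<close> and using compactness,
  \<open>\<B>\<close> contains the indicator of each cylinder inside its spectrum. Every function supported in the
  spectrum is a limit of combinations of these, so (3) implies (1) and (2). That (1) or (2) implies (3)
  is immediate, because \<open>\<gamma>\<^sub>t\<close> multiplies \<open>f(x, n, y)\<close> by \<open>t\<^sup>n\<close>.
\<close>

section \<open>Infinite paths\<close>

text \<open>Gauge invariance is a genuine restriction: for the 1-graph with one vertex and one edge
  the diagonal is the scalars and the algebra is C(T), so every closed subspace is a bimodule, while
  a spectrum only records which Fourier coefficients occur. Compression by projections of the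
  diagonal prescribes the heads of range and source of an arrow but leaves its degree free, and even
  in a fixed degree the tails may merge arbitrarily late. So restriction to a cylinder is not a
  finite operation within a bimodule. What is available is restriction to a larger set, on which the
  degree is known modulo \<open>N\<close> and the tails agree for \<open>j\<close> more steps. For
  large \<open>N\<close> and \<open>j\<close> this set meets the support of a given element of
  \<open>cspan\<close> in the same arrows as the cylinder, and contractivity of both restrictions
  carries this over to the closure. The same scheme, two contractive restrictions that agree on an
  approximant, yields the homogeneous components. As with Fourier series, these need not sum to the
  function in norm, hence the Fejer means. Writing the reduced norm as a bound on finite bilinear
  sums reduces the estimates to Cauchy-Schwarz.\<close>

lemma nat_vec_le_add [simp]: "(m :: nat ^ 'k::finite) \<le> m + n" "m \<le> n + m"
  by (auto simp: less_eq_vec_def)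

lemma nat_vec_zero_le [simp]: "(0 :: nat ^ 'k::finite) \<le> n"
  by (auto simp: less_eq_vec_def)

lemma nat_vec_add_diff [simp]: "(m :: nat ^ 'k::finite) \<le> n \<Longrightarrow> m + (n - m) = n"
  by (auto simp: less_eq_vec_def vec_eq_iff)

lemma nat_vec_add_le_cancel [simp]:
  "(m :: nat ^ 'k::finite) + p \<le> n + p \<longleftrightarrow> m \<le> n" "p + m \<le> p + n \<longleftrightarrow> m \<le> n"
  by (auto simp: less_eq_vec_def)

lemma deg_diff_eq_iff: "deg_diff p q = deg_diff p' q' \<longleftrightarrow> p + q' = p' + q"
proof -
  have "int (p $ i) - int (q $ i) = int (p' $ i) - int (q' $ i)
      \<longleftrightarrow> p $ i + q' $ i = p' $ i + q $ i" for i
    by linarith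
  then show ?thesis
    by (simp add: deg_diff_def vec_eq_iff)
qed

lemma deg_diff_add: "deg_diff p q + deg_diff p' q' = deg_diff (p + p') (q + q')"
  by (auto simp: deg_diff_def vec_eq_iff)

lemma deg_diff_uminus: "- deg_diff p q = deg_diff q p"
  by (auto simp: deg_diff_def vec_eq_iff)

lemma deg_diff_self [simp]: "deg_diff p p = 0"
  by (auto simp: deg_diff_def vec_eq_iff)

lemma deg_diff_add_cancel [simp]: "deg_diff (p + j) (q + j) = deg_diff p q"
  by (auto simp: deg_diff_def vec_eq_iff)

lemma mor_Omega [simp]: "(m, n) \<in> mor Omega \<longleftrightarrow> m \<le> n"
  by (simp add: Omega_def)

lemma shift_apply [simp]: "shift p x (m, n) = x (m + p, n + p)"
  by (simp add: shift_def)

lemma shift_shift [simp]: "shift p (shift q x) = shift (p + q) x"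
  by (auto simp: shift_def fun_eq_iff add.assoc)

lemma shift_0 [simp]: "shift 0 x = x"
  by (auto simp: shift_def fun_eq_iff)

locale higher_rank_graph =
  fixes \<Lambda> :: "('m, 'k::finite) kgraph"
  assumes kgraph: "is_kgraph \<Lambda>"
    and row_finite: "row_finite_no_sources \<Lambda>"
begin

abbreviation compose (infixl "\<cdot>" 75) where "compose \<equiv> cmp \<Lambda>"

abbreviation IP where "IP \<equiv> inf_paths \<Lambda>"

section \<open>Algebra of morphisms in a k-graph\<close>

lemma rng_src [simp]:
  assumes "\<mu> \<in> mor \<Lambda>"
  shows "rng \<Lambda> \<mu> \<in> mor \<Lambda>" "src \<Lambda> \<mu> \<in> mor \<Lambda>"
    "rng \<Lambda> (rng \<Lambda> \<mu>) = rng \<Lambda> \<mu>" "src \<Lambda> (rng \<Lambda> \<mu>) = rng \<Lambda> \<mu>"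
    "rng \<Lambda> (src \<Lambda> \<mu>) = src \<Lambda> \<mu>" "src \<Lambda> (src \<Lambda> \<mu>) = src \<Lambda> \<mu>"
    "rng \<Lambda> \<mu> \<cdot> \<mu> = \<mu>" "\<mu> \<cdot> src \<Lambda> \<mu> = \<mu>"
    "deg \<Lambda> (rng \<Lambda> \<mu>) = 0" "deg \<Lambda> (src \<Lambda> \<mu>) = 0"
  using assms kgraph
  by (auto simp: is_kgraph_def small_category_def degree_functor_def)

lemma compose [simp]:
  assumes "\<mu> \<in> mor \<Lambda>" "\<nu> \<in> mor \<Lambda>" "src \<Lambda> \<mu> = rng \<Lambda> \<nu>"
  shows "\<mu> \<cdot> \<nu> \<in> mor \<Lambda>" "rng \<Lambda> (\<mu> \<cdot> \<nu>) = rng \<Lambda> \<mu>" "src \<Lambda> (\<mu> \<cdot> \<nu>) = src \<Lambda> \<nu>"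
    "deg \<Lambda> (\<mu> \<cdot> \<nu>) = deg \<Lambda> \<mu> + deg \<Lambda> \<nu>"
  using assms kgraph
  by (auto simp: is_kgraph_def small_category_def degree_functor_def)

lemma compose_assoc:
  assumes "\<mu> \<in> mor \<Lambda>" "\<nu> \<in> mor \<Lambda>" "\<kappa> \<in> mor \<Lambda>" "src \<Lambda> \<mu> = rng \<Lambda> \<nu>" "src \<Lambda> \<nu> = rng \<Lambda> \<kappa>"
  shows "\<mu> \<cdot> \<nu> \<cdot> \<kappa> = \<mu> \<cdot> (\<nu> \<cdot> \<kappa>)"
  using assms kgraph by (auto simp: is_kgraph_def small_category_def)

lemma factorE:
  assumes "\<kappa> \<in> mor \<Lambda>" "deg \<Lambda> \<kappa> = m + n"
  obtains \<mu> \<nu> where "\<mu> \<in> mor \<Lambda>" "\<nu> \<in> mor \<Lambda>" "src \<Lambda> \<mu> = rng \<Lambda> \<nu>" "\<kappa> = \<mu> \<cdot> \<nu>"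
    "deg \<Lambda> \<mu> = m" "deg \<Lambda> \<nu> = n"
  using assms kgraph unfolding is_kgraph_def factorization_property_def by blast

lemma factor_unique:
  assumes "\<mu> \<in> mor \<Lambda>" "\<nu> \<in> mor \<Lambda>" "src \<Lambda> \<mu> = rng \<Lambda> \<nu>"
    and "\<mu>' \<in> mor \<Lambda>" "\<nu>' \<in> mor \<Lambda>" "src \<Lambda> \<mu>' = rng \<Lambda> \<nu>'"
    and eq: "\<mu> \<cdot> \<nu> = \<mu>' \<cdot> \<nu>'" and deg: "deg \<Lambda> \<mu> = deg \<Lambda> \<mu>'"
  shows "\<mu> = \<mu>'" "\<nu> = \<nu>'"
proof -
  have "deg \<Lambda> (\<mu> \<cdot> \<nu>) = deg \<Lambda> (\<mu>' \<cdot> \<nu>')"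
    using eq by simp
  then have d: "deg \<Lambda> \<nu> = deg \<Lambda> \<nu>'"
    unfolding compose(4)[OF assms(1-3)] compose(4)[OF assms(4-6)] deg by simp
  have "\<exists>!p. case p of (\<alpha>, \<beta>) \<Rightarrow> \<alpha> \<in> mor \<Lambda> \<and> \<beta> \<in> mor \<Lambda> \<and> src \<Lambda> \<alpha> = rng \<Lambda> \<beta>
           \<and> \<mu> \<cdot> \<nu> = \<alpha> \<cdot> \<beta> \<and> deg \<Lambda> \<alpha> = deg \<Lambda> \<mu> \<and> deg \<Lambda> \<beta> = deg \<Lambda> \<nu>"
    using kgraph assms(1-3) unfolding is_kgraph_def factorization_property_def by simp
  then have "(\<mu>, \<nu>) = (\<mu>', \<nu>')"
    using assms d by (elim ex1E) (metis (mono_tags, lifting) case_prod_conv)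
  then show "\<mu> = \<mu>'" "\<nu> = \<nu>'" by auto
qed

lemma finite_paths_to: "v \<in> mor \<Lambda> \<Longrightarrow> finite (paths_to \<Lambda> n (rng \<Lambda> v))"
  using row_finite by (simp add: row_finite_no_sources_def objects_def)

lemma finite_paths_to_src: "v \<in> mor \<Lambda> \<Longrightarrow> finite (paths_to \<Lambda> n (src \<Lambda> v))"
  using row_finite by (simp add: row_finite_no_sources_def objects_def)

section \<open>Segments of infinite paths\<close>

lemma inf_path [simp]:
  assumes "x \<in> IP" "m \<le> n"
  shows "x (m, n) \<in> mor \<Lambda>" "rng \<Lambda> (x (m, n)) = x (m, m)" "src \<Lambda> (x (m, n)) = x (n, n)"
    "deg \<Lambda> (x (m, n)) = n - m"
proof -
  have "kgraph_morphism Omega \<Lambda> x" "(m, n) \<in> mor Omega"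
    using assms by (auto simp: inf_paths_def)
  then have "x (m, n) \<in> mor \<Lambda> \<and> rng \<Lambda> (x (m, n)) = x (rng Omega (m, n))
      \<and> src \<Lambda> (x (m, n)) = x (src Omega (m, n)) \<and> deg \<Lambda> (x (m, n)) = deg Omega (m, n)"
    unfolding kgraph_morphism_def by blast
  then show "x (m, n) \<in> mor \<Lambda>" "rng \<Lambda> (x (m, n)) = x (m, m)" "src \<Lambda> (x (m, n)) = x (n, n)"
    "deg \<Lambda> (x (m, n)) = n - m"
    by (auto simp: Omega_def)
qed

lemma inf_path_compose:
  assumes "x \<in> IP" "m \<le> n" "n \<le> p"
  shows "x (m, n) \<cdot> x (n, p) = x (m, p)"
proof -
  have "kgraph_morphism Omega \<Lambda> x" "(m, n) \<in> mor Omega" "(n, p) \<in> mor Omega"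
    "src Omega (m, n) = rng Omega (n, p)"
    using assms by (auto simp: inf_paths_def Omega_def)
  then have "x (cmp Omega (m, n) (n, p)) = x (m, n) \<cdot> x (n, p)"
    unfolding kgraph_morphism_def by blast
  then show ?thesis
    by (simp add: Omega_def)
qed

lemma inf_pathI:
  assumes "x \<in> extensional {(m, n). m \<le> n}"
    and "\<And>m n. m \<le> n \<Longrightarrow> x (m, n) \<in> mor \<Lambda> \<and> rng \<Lambda> (x (m, n)) = x (m, m)
           \<and> src \<Lambda> (x (m, n)) = x (n, n) \<and> deg \<Lambda> (x (m, n)) = n - m"
    and "\<And>m n p. m \<le> n \<Longrightarrow> n \<le> p \<Longrightarrow> x (m, n) \<cdot> x (n, p) = x (m, p)"
  shows "x \<in> IP"
proof -
  have "x a \<in> mor \<Lambda> \<and> rng \<Lambda> (x a) = x (rng Omega a) \<and> src \<Lambda> (x a) = x (src Omega a)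
      \<and> deg \<Lambda> (x a) = deg Omega a" if "a \<in> mor Omega" for a
    using assms(2)[of "fst a" "snd a"] that by (cases a) (simp add: Omega_def)
  moreover have "x (cmp Omega a b) = x a \<cdot> x b"
    if "a \<in> mor Omega" "b \<in> mor Omega" "src Omega a = rng Omega b" for a b
    using assms(3)[of "fst a" "snd a" "snd b"] that
    by (cases a; cases b) (simp add: Omega_def)
  moreover have "x \<in> extensional (mor Omega)"
    using assms(1) by (simp add: Omega_def)
  ultimately show ?thesis
    unfolding inf_paths_def kgraph_morphism_def by blast
qed

lemma inf_path_outside: "x \<in> IP \<Longrightarrow> \<not> m \<le> n \<Longrightarrow> x (m, n) = undefined"
  by (auto simp: inf_paths_def extensional_def)

lemma shift_inf_path [simp]:
  assumes "x \<in> IP"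
  shows "shift p x \<in> IP"
  by (rule inf_pathI)
    (use assms in \<open>auto simp: extensional_def inf_path_outside inf_path_compose\<close>)

text \<open>Unique factorization is applied twice: cancelling the tail from \<open>n\<close> to
  \<open>p\<close> equates the initial segments up to \<open>n\<close>, and cancelling the head up
  to \<open>m\<close> leaves the segments from \<open>m\<close> to \<open>n\<close>.\<close>

lemma inf_path_segment_eq:
  assumes "x \<in> IP" "y \<in> IP" "x (0, p) = y (0, p)" "m \<le> n" "n \<le> p"
  shows "x (m, n) = y (m, n)"
proof -
  have *: "x (0, n) = y (0, n)"
    by (rule factor_unique(1)[where \<nu> = "x (n, p)" and \<nu>' = "y (n, p)"])
      (use assms in \<open>auto simp: inf_path_compose\<close>)
  show ?thesis
    by (rule factor_unique(2)[where \<mu> = "x (0, m)" and \<mu>' = "y (0, m)"])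
      (use assms * in \<open>auto simp: inf_path_compose\<close>)
qed

lemma inf_path_eqI:
  assumes "x \<in> IP" "y \<in> IP" "\<And>n. x (0, n) = y (0, n)"
  shows "x = y"
proof
  fix a :: "(nat ^ 'k) \<times> (nat ^ 'k)"
  obtain m n where [simp]: "a = (m, n)" by (cases a)
  show "x a = y a"
    using inf_path_segment_eq[OF assms(1,2,3), of m n n] inf_path_outside[OF assms(1)]
      inf_path_outside[OF assms(2)]
    by (cases "m \<le> n") auto
qed

text \<open>A path is its head followed by its tail. This gives the uniqueness behind
  \<open>prepend\<close> and later the injectivity of range and source on a cylinder.\<close>

lemma inf_path_eq_shiftI:
  assumes "x \<in> IP" "y \<in> IP" "x (0, p) = y (0, p)" "shift p x = shift p y"
  shows "x = y"
proof (rule inf_path_eqI[OF assms(1,2)])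
  fix n
  have "x (p, n + p) = y (p, n + p)"
    using arg_cong[OF assms(4), of "\<lambda>z. z (0, n)"] by simp
  then have "x (0, n + p) = y (0, n + p)"
    using assms inf_path_compose[of _ 0 p "n + p"] by (metis nat_vec_le_add(2) nat_vec_zero_le)
  then show "x (0, n) = y (0, n)"
    using inf_path_segment_eq[OF assms(1,2), of "n + p" 0 n] by simp
qed

section \<open>Construction of infinite paths\<close>

lemma inf_path_from_initial_segments:
  assumes h: "\<And>n. h n \<in> mor \<Lambda>" "\<And>n. deg \<Lambda> (h n) = n"
    and ext: "\<And>m n. m \<le> n \<Longrightarrow> \<exists>\<beta>\<in>mor \<Lambda>. src \<Lambda> (h m) = rng \<Lambda> \<beta> \<and> h n = h m \<cdot> \<beta>"
  shows "\<exists>y\<in>IP. \<forall>n. y (0, n) = h n"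
proof -
  \<comment> \<open>The segment from \<open>m\<close> to \<open>n\<close> has to be the complement
    of \<open>h m\<close> in \<open>h n\<close>. Unique factorization makes the choice canonical
    (\<open>y_eq\<close>), and functoriality follows by composing complements.\<close>
  define y where "y = (\<lambda>(m, n). if m \<le> n
    then SOME \<beta>. \<beta> \<in> mor \<Lambda> \<and> src \<Lambda> (h m) = rng \<Lambda> \<beta> \<and> h n = h m \<cdot> \<beta> else undefined)"
  have y: "y (m, n) \<in> mor \<Lambda> \<and> src \<Lambda> (h m) = rng \<Lambda> (y (m, n)) \<and> h n = h m \<cdot> y (m, n)"
    if "m \<le> n" for m n
    using someI_ex[OF ext[OF that, unfolded Bex_def]] that by (simp add: y_def)
  have y_eq: "y (m, n) = \<beta>"
    if "m \<le> n" "\<beta> \<in> mor \<Lambda>" "src \<Lambda> (h m) = rng \<Lambda> \<beta>" "h n = h m \<cdot> \<beta>" for m n \<beta>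
    by (rule factor_unique(2)[where \<mu> = "h m" and \<mu>' = "h m"]) (use that y h in auto)
  have yy: "y (m, m) = src \<Lambda> (h m)" for m
    by (rule y_eq) (use h in auto)
  have src: "src \<Lambda> (y (m, n)) = src \<Lambda> (h n)" if "m \<le> n" for m n
    using y[OF that] h(1) by (metis compose(3))
  have deg: "deg \<Lambda> (y (m, n)) = n - m" if "m \<le> n" for m n
  proof -
    have "n = m + deg \<Lambda> (y (m, n))"
      using y[OF that] h compose(4) by metis
    then show ?thesis by (metis add_diff_cancel_left')
  qed
  have "y \<in> IP"
  proof (rule inf_pathI)
    show "y \<in> extensional {(m, n). m \<le> n}"
      by (auto simp: extensional_def y_def)
    show "y (m, n) \<in> mor \<Lambda> \<and> rng \<Lambda> (y (m, n)) = y (m, m)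
           \<and> src \<Lambda> (y (m, n)) = y (n, n) \<and> deg \<Lambda> (y (m, n)) = n - m" if "m \<le> n" for m n
      using y[OF that] src[OF that] deg[OF that] yy by simp
    show "y (m, n) \<cdot> y (n, p) = y (m, p)" if "m \<le> n" "n \<le> p" for m n p
    proof (rule y_eq[symmetric])
      show "h p = h m \<cdot> (y (m, n) \<cdot> y (n, p))"
        using y[OF that(1)] y[OF that(2)] src[OF that(1)] h
        by (metis compose_assoc)
    qed (use y[OF that(1)] y[OF that(2)] src[OF that(1)] that order_trans in auto)
  qed
  moreover have "y (0, n) = h n" for n
  proof (rule y_eq)
    obtain \<beta> where b: "\<beta> \<in> mor \<Lambda>" "src \<Lambda> (h 0) = rng \<Lambda> \<beta>" "h n = h 0 \<cdot> \<beta>"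
      using ext[of 0 n] by auto
    \<comment> \<open>A morphism of degree 0 is an identity: \<open>h 0\<close> followed by its
      source and its range followed by \<open>h 0\<close> are two factorizations with a left factor
      of degree 0.\<close>
    have "h 0 = rng \<Lambda> (h 0)"
      by (rule factor_unique(1)[where \<nu> = "src \<Lambda> (h 0)" and \<nu>' = "h 0"]) (use h in auto)
    moreover have "rng \<Lambda> (h n) = rng \<Lambda> (h 0)"
      using b h by simp
    ultimately show "src \<Lambda> (h 0) = rng \<Lambda> (h n)" "h n = h 0 \<cdot> h n"
      using h by (metis rng_src(4), metis rng_src(7))
  qed (use h in auto)
  ultimately show ?thesis by blast
qed

lemma prepend_exists:
  assumes \<mu>: "\<mu> \<in> mor \<Lambda>" and z: "z \<in> IP" "z (0, 0) = src \<Lambda> \<mu>"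
  shows "\<exists>y\<in>IP. y (0, deg \<Lambda> \<mu>) = \<mu> \<and> shift (deg \<Lambda> \<mu>) y = z"
proof -
  \<comment> \<open>\<open>g n\<close> has degree \<open>n + deg \<Lambda> \<mu>\<close>, so it has
    a prefix \<open>h n\<close> of degree \<open>n\<close>. The paths \<open>g n\<close> extend one
    another, hence the prefix of degree \<open>m\<close> of any \<open>g n\<close> with
    \<open>m \<le> n\<close> is \<open>h m\<close> (\<open>h_eq\<close>), and the \<open>h n\<close>
    are the initial segments of the path sought.\<close>
  define g where "g n = \<mu> \<cdot> z (0, n)" for n
  have g: "g n \<in> mor \<Lambda>" "deg \<Lambda> (g n) = n + deg \<Lambda> \<mu>" for n
    using assms by (auto simp: g_def add.commute)
  have gg: "g n = g m \<cdot> z (m, n)" "src \<Lambda> (g m) = z (m, m)" if "m \<le> n" for m n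
    using that assms inf_path_compose[of z 0 m n] compose_assoc[of \<mu> "z (0, m)" "z (m, n)"]
    by (auto simp: g_def)
  have "\<exists>\<alpha>. \<alpha> \<in> mor \<Lambda> \<and> deg \<Lambda> \<alpha> = n \<and> (\<exists>\<beta>\<in>mor \<Lambda>. src \<Lambda> \<alpha> = rng \<Lambda> \<beta> \<and> g n = \<alpha> \<cdot> \<beta>)" for n
    using g by (metis factorE)
  then obtain h where h: "\<And>n. h n \<in> mor \<Lambda>" "\<And>n. deg \<Lambda> (h n) = n"
    "\<And>n. \<exists>\<beta>\<in>mor \<Lambda>. src \<Lambda> (h n) = rng \<Lambda> \<beta> \<and> g n = h n \<cdot> \<beta>"
    by metis
  have h_eq: "h m = \<alpha>" if "\<alpha> \<in> mor \<Lambda>" "\<beta> \<in> mor \<Lambda>" "src \<Lambda> \<alpha> = rng \<Lambda> \<beta>"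
    "deg \<Lambda> \<alpha> = m" "g n = \<alpha> \<cdot> \<beta>" "m \<le> n" for m n \<alpha> \<beta>
  proof -
    obtain \<beta>' where b: "\<beta>' \<in> mor \<Lambda>" "src \<Lambda> (h m) = rng \<Lambda> \<beta>'" "g m = h m \<cdot> \<beta>'"
      using h(3) by blast
    have sb: "src \<Lambda> \<beta>' = z (m, m)"
      using b h gg(2)[of m m] compose(3)[of "h m" \<beta>'] by auto
    then have "g n = h m \<cdot> (\<beta>' \<cdot> z (m, n))"
      using gg[OF \<open>m \<le> n\<close>] b h z that by (simp add: compose_assoc)
    then show ?thesis
      by (intro factor_unique(1)[of "h m" "\<beta>' \<cdot> z (m, n)" \<alpha> \<beta>])
        (use b h z that sb in auto)
  qed
  have "\<exists>y\<in>IP. \<forall>n. y (0, n) = h n"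
  proof (rule inf_path_from_initial_segments)
    fix m n :: "nat ^ 'k" assume "m \<le> n"
    obtain \<alpha> \<gamma> where a: "\<alpha> \<in> mor \<Lambda>" "\<gamma> \<in> mor \<Lambda>" "src \<Lambda> \<alpha> = rng \<Lambda> \<gamma>" "h n = \<alpha> \<cdot> \<gamma>" "deg \<Lambda> \<alpha> = m"
      using h(1,2) \<open>m \<le> n\<close> by (metis factorE nat_vec_add_diff)
    obtain \<beta> where b: "\<beta> \<in> mor \<Lambda>" "src \<Lambda> (h n) = rng \<Lambda> \<beta>" "g n = h n \<cdot> \<beta>"
      using h(3) by blast
    have "src \<Lambda> \<gamma> = rng \<Lambda> \<beta>"
      using a b by simp
    then have "g n = \<alpha> \<cdot> (\<gamma> \<cdot> \<beta>)"
      using a b by (simp add: compose_assoc)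
    then have "h m = \<alpha>"
      using a b \<open>m \<le> n\<close> \<open>src \<Lambda> \<gamma> = rng \<Lambda> \<beta>\<close> by (intro h_eq[of \<alpha> "\<gamma> \<cdot> \<beta>"]) auto
    then show "\<exists>\<beta>\<in>mor \<Lambda>. src \<Lambda> (h m) = rng \<Lambda> \<beta> \<and> h n = h m \<cdot> \<beta>"
      using a by auto
  qed (use h in auto)
  then obtain y where y: "y \<in> IP" "\<And>n. y (0, n) = h n" by blast
  have hg: "h (n + deg \<Lambda> \<mu>) = g n" for n
  proof (rule h_eq)
    show "g (n + deg \<Lambda> \<mu>) = g n \<cdot> z (n, n + deg \<Lambda> \<mu>)"
      by (rule gg) simp
  qed (use g gg(2)[of n n] z in auto)
  have "y (0, deg \<Lambda> \<mu>) = \<mu>"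
    using y(2) hg[of 0] z \<mu> by (simp add: g_def)
  moreover have "shift (deg \<Lambda> \<mu>) y = z"
  proof (rule inf_path_eqI)
    fix n
    show "shift (deg \<Lambda> \<mu>) y (0, n) = z (0, n)"
    proof (rule factor_unique(2)[where \<mu> = "y (0, deg \<Lambda> \<mu>)" and \<mu>' = \<mu>])
      show "y (0, deg \<Lambda> \<mu>) \<cdot> shift (deg \<Lambda> \<mu>) y (0, n) = \<mu> \<cdot> z (0, n)"
        using inf_path_compose[OF y(1), of 0 "deg \<Lambda> \<mu>" "n + deg \<Lambda> \<mu>"] y(2)[of "n + deg \<Lambda> \<mu>"] hg[of n]
        by (simp add: g_def)
      show "src \<Lambda> (y (0, deg \<Lambda> \<mu>)) = rng \<Lambda> (shift (deg \<Lambda> \<mu>) y (0, n))"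
        using y(1) by simp
    qed (use y(1) \<mu> z \<open>y (0, deg \<Lambda> \<mu>) = \<mu>\<close> in auto)
  qed (use y z in auto)
  ultimately show ?thesis using y by blast
qed

lemma prepend:
  assumes "\<mu> \<in> mor \<Lambda>" "z \<in> IP" "z (0, 0) = src \<Lambda> \<mu>"
  shows "prepend \<Lambda> \<mu> z \<in> IP" "prepend \<Lambda> \<mu> z (0, deg \<Lambda> \<mu>) = \<mu>"
    "shift (deg \<Lambda> \<mu>) (prepend \<Lambda> \<mu> z) = z"
proof -
  have "\<exists>!y. y \<in> IP \<and> y (0, deg \<Lambda> \<mu>) = \<mu> \<and> shift (deg \<Lambda> \<mu>) y = z"
    using prepend_exists[OF assms] inf_path_eq_shiftI by (metis (no_types, lifting))
  from theI'[OF this] show "prepend \<Lambda> \<mu> z \<in> IP" "prepend \<Lambda> \<mu> z (0, deg \<Lambda> \<mu>) = \<mu>"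
    "shift (deg \<Lambda> \<mu>) (prepend \<Lambda> \<mu> z) = z"
    by (auto simp: prepend_def)
qed

lemma prepend_eqI:
  assumes "\<mu> \<in> mor \<Lambda>" "y \<in> IP" "y (0, deg \<Lambda> \<mu>) = \<mu>" "shift (deg \<Lambda> \<mu>) y = z"
  shows "prepend \<Lambda> \<mu> z = y" "z (0, 0) = src \<Lambda> \<mu>"
proof -
  have "src \<Lambda> (y (0, deg \<Lambda> \<mu>)) = y (deg \<Lambda> \<mu>, deg \<Lambda> \<mu>)"
    using assms by (intro inf_path) auto
  then show z: "z (0, 0) = src \<Lambda> \<mu>"
    using assms by (auto simp flip: assms(4))
  have "z \<in> IP"
    using assms by auto
  from prepend[OF assms(1) this z] show "prepend \<Lambda> \<mu> z = y"
    using assms(2-4) inf_path_eq_shiftI[of "prepend \<Lambda> \<mu> z" y "deg \<Lambda> \<mu>"] by metis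
qed

text \<open>With this characterisation the definite description in \<^const>\<open>prepend\<close> is not needed again.\<close>

lemma cylinder_iff:
  assumes "\<mu> \<in> mor \<Lambda>" "\<nu> \<in> mor \<Lambda>" "src \<Lambda> \<mu> = src \<Lambda> \<nu>"
  shows "(x, n, y) \<in> cylinder \<Lambda> \<mu> \<nu> \<longleftrightarrow> x \<in> IP \<and> y \<in> IP \<and> x (0, deg \<Lambda> \<mu>) = \<mu> \<and> y (0, deg \<Lambda> \<nu>) = \<nu>
    \<and> shift (deg \<Lambda> \<mu>) x = shift (deg \<Lambda> \<nu>) y \<and> n = deg_diff (deg \<Lambda> \<mu>) (deg \<Lambda> \<nu>)"
  (is "_ \<longleftrightarrow> ?R")
proof
  assume "(x, n, y) \<in> cylinder \<Lambda> \<mu> \<nu>"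
  then show ?R
    using assms prepend[of \<mu>] prepend[of \<nu>] by (auto simp: cylinder_def)
next
  assume R: ?R
  then have "prepend \<Lambda> \<mu> (shift (deg \<Lambda> \<mu>) x) = x" "shift (deg \<Lambda> \<mu>) x (0, 0) = src \<Lambda> \<mu>"
    "prepend \<Lambda> \<nu> (shift (deg \<Lambda> \<mu>) x) = y"
    using assms prepend_eqI(1)[of \<mu> x "shift (deg \<Lambda> \<mu>) x"] prepend_eqI(2)[of \<mu> x "shift (deg \<Lambda> \<mu>) x"]
      prepend_eqI(1)[of \<nu> y "shift (deg \<Lambda> \<mu>) x"]
    by metis+
  then show "(x, n, y) \<in> cylinder \<Lambda> \<mu> \<nu>"
    using R unfolding cylinder_def by (intro CollectI exI[of _ "shift (deg \<Lambda> \<mu>) x"]) auto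
qed

text \<open>Konig's lemma for the path space: row finiteness leaves finitely many segments of each
  degree, so the indices can be thinned to nested infinite sets on which the segments agree further
  and further. The constant vectors \<open>c K\<close> are cofinal among the degrees and reduce this
  to a sequence of thinnings.\<close>

lemma inf_path_cluster_point:
  fixes z :: "nat \<Rightarrow> ('m, 'k) ipath"
  assumes v: "v \<in> mor \<Lambda>" and z: "\<And>i. z i \<in> IP" "\<And>i. z i (0, 0) = src \<Lambda> v"
  obtains w where "w \<in> IP" "w (0, 0) = src \<Lambda> v" "\<And>n i0. \<exists>i\<ge>i0. z i (0, n) = w (0, n)"
proof -
  define c :: "nat \<Rightarrow> nat ^ 'k" where "c K = (\<chi> i. K)" for K
  have c_mono: "c K \<le> c L" if "K \<le> L" for K L
    using that by (simp add: c_def less_eq_vec_def)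
  have c_ex: "\<exists>K. n \<le> c K" for n
    by (rule exI[of _ "\<Sum>i\<in>UNIV. n $ i"]) (auto simp: c_def less_eq_vec_def intro: member_le_sum)
  define G where "G I K \<longleftrightarrow> infinite I \<and> (\<forall>i\<in>I. \<forall>j\<in>I. z i (0, c K) = z j (0, c K))" for I K
  have step: "\<exists>J. G J K \<and> J \<subseteq> I" if inf: "infinite I" for I K
  proof -
    have "(\<lambda>i. z i (0, c K)) ` I \<subseteq> paths_to \<Lambda> (c K) (src \<Lambda> v)"
      using z by (auto simp: paths_to_def)
    then have "finite ((\<lambda>i. z i (0, c K)) ` I)"
      using finite_paths_to_src[OF v] finite_subset by blast
    then obtain i where "i \<in> I" "infinite {j \<in> I. z j (0, c K) = z i (0, c K)}"
      using pigeonhole_infinite[OF inf] by blast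
    then show ?thesis
      by (intro exI[of _ "{j \<in> I. z j (0, c K) = z i (0, c K)}"]) (auto simp: G_def)
  qed
  obtain I where I: "\<And>K. G (I K) K" "\<And>K. I (Suc K) \<subseteq> I K"
  proof -
    have "\<exists>I. \<forall>K. G (I K) K \<and> I (Suc K) \<subseteq> I K"
      by (rule dependent_nat_choice) (use step[of UNIV] step in \<open>auto simp: G_def\<close>)
    then show ?thesis using that by blast
  qed
  have I_mono: "I L \<subseteq> I K" if "K \<le> L" for K L
    using that I(2) lift_Suc_antimono_le[of I] by blast
  have "\<forall>K. \<exists>i. i \<in> I K \<and> i \<ge> K"
    using I(1) unfolding G_def by (metis infinite_nat_iff_unbounded_le)
  then obtain t where t: "\<And>K. t K \<in> I K" "\<And>K. t K \<ge> K" by metis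
  \<comment> \<open>Minimality lets any \<open>i \<in> I K\<close> with \<open>n \<le> c K\<close>
    serve in place of \<open>t (k n)\<close>, because then \<open>k n \<le> K\<close> and the index
    sets are nested (\<open>w_eq\<close>).\<close>
  define k where "k n = (LEAST K. n \<le> c K)" for n
  have k: "n \<le> c (k n)" for n
    unfolding k_def by (rule LeastI_ex[OF c_ex])
  have agree: "z i (m, n) = z j (m, n)" if "i \<in> I K" "j \<in> I K" "m \<le> n" "n \<le> c K" for i j K m n
  proof -
    have "z i (0, c K) = z j (0, c K)"
      using I(1)[of K] that(1,2) unfolding G_def by blast
    then show ?thesis
      using inf_path_segment_eq[OF z(1) z(1) _ that(3,4)] by blast
  qed
  define w where "w = (\<lambda>(m, n). z (t (k n)) (m, n))"
  have w_eq: "w (m, n) = z i (m, n)" if "m \<le> n" "i \<in> I K" "n \<le> c K" for m n i K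
  proof -
    have "k n \<le> K"
      unfolding k_def using that by (intro Least_le)
    then have "i \<in> I (k n)"
      using I_mono that by blast
    then show ?thesis
      using agree[OF t(1) _ that(1) k] by (simp add: w_def)
  qed
  have "w \<in> IP"
  proof (rule inf_pathI)
    show "w \<in> extensional {(m, n). m \<le> n}"
      using inf_path_outside[OF z(1)] by (simp add: extensional_def w_def split: prod.split)
    show "w (m, n) \<in> mor \<Lambda> \<and> rng \<Lambda> (w (m, n)) = w (m, m)
           \<and> src \<Lambda> (w (m, n)) = w (n, n) \<and> deg \<Lambda> (w (m, n)) = n - m" if "m \<le> n" for m n
    proof -
      have "w (m, n) = z (t (k n)) (m, n)" "w (m, m) = z (t (k n)) (m, m)"
        "w (n, n) = z (t (k n)) (n, n)"
        using w_eq[OF _ t(1)] k[of n] that by auto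
      then show ?thesis
        using inf_path[OF z(1) that] by simp
    qed
    show "w (m, n) \<cdot> w (n, p) = w (m, p)" if "m \<le> n" "n \<le> p" for m n p
    proof -
      have "w (m, n) = z (t (k p)) (m, n)" "w (n, p) = z (t (k p)) (n, p)"
        "w (m, p) = z (t (k p)) (m, p)"
        using w_eq[OF _ t(1)] k[of p] that by (meson order_trans)+
      then show ?thesis
        using inf_path_compose[OF z(1) that] by simp
    qed
  qed
  moreover have "w (0, 0) = src \<Lambda> v"
    using z by (simp add: w_def)
  moreover have "\<exists>i\<ge>i0. z i (0, n) = w (0, n)" for n i0
  proof -
    \<comment> \<open>Raising the level to \<open>i0\<close> makes the index \<open>t ?K\<close>,
      which is at least \<open>?K\<close>, late enough.\<close>
    let ?K = "max (k n) i0"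
    have "t ?K \<ge> i0" using t(2)[of ?K] by linarith
    moreover have "n \<le> c ?K" using k[of n] c_mono[of "k n" ?K] by (meson max.cobounded1 order_trans)
    ultimately show ?thesis
      using w_eq[of 0 n "t ?K" ?K, OF _ t(1)] by (intro exI[of _ "t ?K"]) simp
  qed
  ultimately show ?thesis using that by blast
qed

end

section \<open>Cylinder sets\<close>

lemma constant_vec_le: "K \<le> L \<Longrightarrow> ((\<chi> i. K) :: nat ^ 'k::finite) \<le> (\<chi> i. L)"
  by (simp add: less_eq_vec_def)

lemma nat_vec_le_constant: "\<exists>K. (n :: nat ^ 'k::finite) \<le> (\<chi> i. K)"
  by (rule exI[of _ "\<Sum>i\<in>UNIV. n $ i"]) (auto simp: less_eq_vec_def intro: member_le_sum)

text \<open>The equation \<open>a + d = c + b\<close> says that \<open>(a, b)\<close> and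
  \<open>(c, d)\<close> have the same difference, as the degrees of two cylinders through one arrow
  do. Raising \<open>a\<close> and \<open>c\<close> to a common level then raises \<open>b\<close>
  and \<open>d\<close> to a common level.\<close>

lemma nat_vec_exchange:
  assumes "(a :: nat ^ 'k::finite) + j = c + i" "a + d = c + b"
  shows "b + j = d + i"
proof -
  have "b $ k + j $ k = d $ k + i $ k" for k
    using arg_cong[OF assms(1), of "\<lambda>v. v $ k"] arg_cong[OF assms(2), of "\<lambda>v. v $ k"] by simp
  then show ?thesis by (simp add: vec_eq_iff)
qed

lemma g_rng_src_mult_inv [simp]:
  "g_rng (g_inv a) = g_src a" "g_src (g_inv a) = g_rng a" "g_inv (g_inv a) = a"
  "g_rng (g_mult a b) = g_rng a" "g_src (g_mult a b) = g_src b"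
  by (cases a; cases b; simp)+

context higher_rank_graph
begin

abbreviation G where "G \<equiv> groupoid \<Lambda>"
abbreviation Z where "Z \<equiv> cylinder \<Lambda>"

definition same_src :: "'m \<Rightarrow> 'm \<Rightarrow> bool" where
  "same_src \<mu> \<nu> \<longleftrightarrow> \<mu> \<in> mor \<Lambda> \<and> \<nu> \<in> mor \<Lambda> \<and> src \<Lambda> \<mu> = src \<Lambda> \<nu>"

definition cylinders :: "('m, 'k) garrow set set" where
  "cylinders = {Z \<mu> \<nu> | \<mu> \<nu>. same_src \<mu> \<nu>}"

text \<open>Used with \<open>p\<close> and \<open>q\<close> for which the tails of range and source
  agree after \<open>p\<close> and \<open>q\<close> steps; raising both by the same \<open>j\<close>
  then shrinks the set around \<open>a\<close>.\<close>

definition cyl_at :: "('m, 'k) garrow \<Rightarrow> nat ^ 'k \<Rightarrow> nat ^ 'k \<Rightarrow> ('m, 'k) garrow set" where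
  "cyl_at a p q = Z (g_rng a (0, p)) (g_src a (0, q))"

lemma inf_path_split: "x \<in> IP \<Longrightarrow> x (0, p + j) = x (0, p) \<cdot> shift p x (0, j)"
  by (simp add: inf_path_compose add.commute)

lemma shift_eq_add: "shift p x = shift q y \<Longrightarrow> shift (p + j) x = shift (q + j) y"
  by (metis add.commute shift_shift)

lemma cylinder_iff':
  assumes "same_src \<mu> \<nu>"
  shows "(x, n, y) \<in> Z \<mu> \<nu> \<longleftrightarrow> x \<in> IP \<and> y \<in> IP \<and> x (0, deg \<Lambda> \<mu>) = \<mu> \<and> y (0, deg \<Lambda> \<nu>) = \<nu>
    \<and> shift (deg \<Lambda> \<mu>) x = shift (deg \<Lambda> \<nu>) y \<and> n = deg_diff (deg \<Lambda> \<mu>) (deg \<Lambda> \<nu>)"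
  using cylinder_iff assms by (auto simp: same_src_def)

lemma groupoid_iff: "(x, n, y) \<in> G \<longleftrightarrow> x \<in> IP \<and> y \<in> IP \<and> (\<exists>p q. shift p x = shift q y \<and> n = deg_diff p q)"
  by (simp add: groupoid_def)

lemma cylinder_subset_groupoid: "same_src \<mu> \<nu> \<Longrightarrow> Z \<mu> \<nu> \<subseteq> G"
  by (clarsimp simp: cylinder_iff' groupoid_iff) blast

lemma cylinders_subset_groupoid: "C \<in> cylinders \<Longrightarrow> C \<subseteq> G"
  using cylinder_subset_groupoid by (auto simp: cylinders_def)

lemma same_src_segments:
  assumes "x \<in> IP" "y \<in> IP" "shift p x = shift q y"
  shows "same_src (x (0, p)) (y (0, q))"
proof -
  have "shift p x (0, 0) = shift q y (0, 0)" using assms(3) by simp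
  then show ?thesis using assms(1,2) by (simp add: same_src_def)
qed

lemma in_cyl_at_iff:
  assumes "x \<in> IP" "y \<in> IP" "shift p x = shift q y"
  shows "(x', n, y') \<in> cyl_at (x, k, y) p q \<longleftrightarrow> x' \<in> IP \<and> y' \<in> IP \<and> x' (0, p) = x (0, p)
    \<and> y' (0, q) = y (0, q) \<and> shift p x' = shift q y' \<and> n = deg_diff p q"
  using cylinder_iff'[OF same_src_segments[OF assms]] assms by (simp add: cyl_at_def)

text \<open>The heads carry the tails along: since \<open>x\<close> and \<open>y\<close> have equal
  tails, their segments over the additional \<open>j\<close> steps coincide. So do those of any
  arrow with the same longer heads, and the equality of its tails extends back to \<open>p\<close>
  and \<open>q\<close>.\<close>

lemma cyl_at_mono:
  assumes "x \<in> IP" "y \<in> IP" "shift p x = shift q y"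
  shows "cyl_at (x, k, y) (p + j) (q + j) \<subseteq> cyl_at (x, k, y) p q"
proof
  fix b assume b: "b \<in> cyl_at (x, k, y) (p + j) (q + j)"
  obtain x' n y' where [simp]: "b = (x', n, y')" by (cases b)
  have s: "shift (p + j) x = shift (q + j) y"
    by (rule shift_eq_add) fact
  have b': "x' \<in> IP" "y' \<in> IP" "x' (0, p + j) = x (0, p + j)" "y' (0, q + j) = y (0, q + j)"
    "shift (p + j) x' = shift (q + j) y'" "n = deg_diff p q"
    using b in_cyl_at_iff[OF assms(1,2) s] by auto
  have seg: "x' (p, p + j) = x (p, p + j)" "x' (0, p) = x (0, p)"
    "y' (q, q + j) = y (q, q + j)" "y' (0, q) = y (0, q)"
    using inf_path_segment_eq[OF b'(1) assms(1) b'(3)] inf_path_segment_eq[OF b'(2) assms(2) b'(4)]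
    by auto
  have "x (p, p + j) = y (q, q + j)"
    using arg_cong[OF assms(3), of "\<lambda>z. z (0, j)"] by (simp add: add.commute)
  moreover have "shift j (shift p x') = shift j (shift q y')"
    using b'(5) by (simp add: add.commute)
  moreover have "shift p x' (0, j) = x' (p, p + j)" "shift q y' (0, j) = y' (q, q + j)"
    by (simp_all add: add.commute)
  ultimately have "shift p x' = shift q y'"
    using inf_path_eq_shiftI[of "shift p x'" "shift q y'" j] b'(1,2) seg(1,3) by (metis shift_inf_path)
  then show "b \<in> cyl_at (x, k, y) p q"
    using in_cyl_at_iff[OF assms] b' seg by simp
qed

lemma cyl_at_self:
  assumes "same_src \<mu> \<nu>" "a \<in> Z \<mu> \<nu>"
  shows "cyl_at a (deg \<Lambda> \<mu>) (deg \<Lambda> \<nu>) = Z \<mu> \<nu>"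
  using assms by (cases a) (simp add: cyl_at_def cylinder_iff')

lemma cyl_at_subset:
  assumes "same_src \<mu> \<nu>" "a \<in> Z \<mu> \<nu>"
  shows "cyl_at a (deg \<Lambda> \<mu> + j) (deg \<Lambda> \<nu> + j) \<subseteq> Z \<mu> \<nu>"
  using cyl_at_mono cyl_at_self[OF assms] assms by (cases a) (metis cylinder_iff')

text \<open>Within one cylinder the tails already agree, so only heads are left to compare. Lying in
  the same finer cylinder is therefore an equivalence relation, which gives
  \<open>cyl_at_eq\<close>.\<close>

lemma in_cyl_at_iff':
  assumes "same_src \<mu> \<nu>" "a \<in> Z \<mu> \<nu>"
  shows "b \<in> cyl_at a (deg \<Lambda> \<mu> + j) (deg \<Lambda> \<nu> + j) \<longleftrightarrow> b \<in> Z \<mu> \<nu>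
    \<and> g_rng b (0, deg \<Lambda> \<mu> + j) = g_rng a (0, deg \<Lambda> \<mu> + j)
    \<and> g_src b (0, deg \<Lambda> \<nu> + j) = g_src a (0, deg \<Lambda> \<nu> + j)"
proof -
  obtain x n y where [simp]: "a = (x, n, y)" by (cases a)
  obtain x' n' y' where [simp]: "b = (x', n', y')" by (cases b)
  have a: "x \<in> IP" "y \<in> IP" "shift (deg \<Lambda> \<mu>) x = shift (deg \<Lambda> \<nu>) y"
    using assms cylinder_iff' by auto
  have a': "shift (deg \<Lambda> \<mu> + j) x = shift (deg \<Lambda> \<nu> + j) y"
    by (rule shift_eq_add) fact
  have "b \<in> cyl_at a (deg \<Lambda> \<mu> + j) (deg \<Lambda> \<nu> + j) \<longleftrightarrow> x' \<in> IP \<and> y' \<in> IP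
      \<and> x' (0, deg \<Lambda> \<mu> + j) = x (0, deg \<Lambda> \<mu> + j) \<and> y' (0, deg \<Lambda> \<nu> + j) = y (0, deg \<Lambda> \<nu> + j)
      \<and> shift (deg \<Lambda> \<mu> + j) x' = shift (deg \<Lambda> \<nu> + j) y' \<and> n' = deg_diff (deg \<Lambda> \<mu>) (deg \<Lambda> \<nu>)"
    using in_cyl_at_iff[OF a(1,2) a', of x' n' y' n] by simp
  moreover have "b \<in> Z \<mu> \<nu> \<Longrightarrow> x' \<in> IP \<and> y' \<in> IP \<and> n' = deg_diff (deg \<Lambda> \<mu>) (deg \<Lambda> \<nu>)
      \<and> shift (deg \<Lambda> \<mu> + j) x' = shift (deg \<Lambda> \<nu> + j) y'"
    using cylinder_iff'[OF assms(1), of x' n' y'] shift_eq_add[of "deg \<Lambda> \<mu>" x' "deg \<Lambda> \<nu>" y' j] by simp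
  ultimately show ?thesis
    using cyl_at_subset[OF assms, of j] unfolding \<open>a = _\<close> \<open>b = _\<close> g_rng.simps g_src.simps by blast
qed

lemma in_own_cyl_at:
  assumes "same_src \<mu> \<nu>" "a \<in> Z \<mu> \<nu>"
  shows "a \<in> cyl_at a (deg \<Lambda> \<mu> + j) (deg \<Lambda> \<nu> + j)"
  using in_cyl_at_iff'[OF assms] assms by simp

lemma cyl_at_eq:
  assumes "same_src \<mu> \<nu>" "a \<in> Z \<mu> \<nu>" "b \<in> cyl_at a (deg \<Lambda> \<mu> + j) (deg \<Lambda> \<nu> + j)"
  shows "cyl_at b (deg \<Lambda> \<mu> + j) (deg \<Lambda> \<nu> + j) = cyl_at a (deg \<Lambda> \<mu> + j) (deg \<Lambda> \<nu> + j)"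
  using assms by (simp add: in_cyl_at_iff') (simp add: cyl_at_def)

lemma cyl_at_antimono:
  assumes "same_src \<mu> \<nu>" "a \<in> Z \<mu> \<nu>" "j \<le> j'"
  shows "cyl_at a (deg \<Lambda> \<mu> + j') (deg \<Lambda> \<nu> + j') \<subseteq> cyl_at a (deg \<Lambda> \<mu> + j) (deg \<Lambda> \<nu> + j)"
proof -
  obtain x n y where [simp]: "a = (x, n, y)" by (cases a)
  have a: "x \<in> IP" "y \<in> IP" "shift (deg \<Lambda> \<mu> + j) x = shift (deg \<Lambda> \<nu> + j) y"
    using assms by (auto simp: cylinder_iff' intro: shift_eq_add)
  show ?thesis
    using cyl_at_mono[OF a, of n "j' - j"] assms(3) by (simp add: add.assoc)
qed

lemma cyl_at_in_cylinders:
  assumes "same_src \<mu> \<nu>" "a \<in> Z \<mu> \<nu>"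
  shows "cyl_at a (deg \<Lambda> \<mu> + j) (deg \<Lambda> \<nu> + j) \<in> cylinders"
proof -
  obtain x n y where [simp]: "a = (x, n, y)" by (cases a)
  have "same_src (x (0, deg \<Lambda> \<mu> + j)) (y (0, deg \<Lambda> \<nu> + j))"
    using assms by (intro same_src_segments shift_eq_add) (auto simp: cylinder_iff')
  then show ?thesis
    by (auto simp: cylinders_def cyl_at_def)
qed

text \<open>
  Two cylinders meet in a union of parts of either one, provided the parts are cut at a level \<open>j\<close>
  beyond the degrees of the other.
\<close>

lemma cyl_at_subset_cylinder:
  assumes s: "same_src \<mu> \<nu>" "same_src \<mu>' \<nu>'" and a: "a \<in> Z \<mu> \<nu>" "a \<in> Z \<mu>' \<nu>'"
    and le: "deg \<Lambda> \<mu>' \<le> deg \<Lambda> \<mu> + j"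
  shows "cyl_at a (deg \<Lambda> \<mu> + j) (deg \<Lambda> \<nu> + j) \<subseteq> Z \<mu>' \<nu>'"
proof -
  obtain x n y where [simp]: "a = (x, n, y)" by (cases a)
  define i where "i = deg \<Lambda> \<mu> + j - deg \<Lambda> \<mu>'"
  have i: "deg \<Lambda> \<mu> + j = deg \<Lambda> \<mu>' + i"
    using le by (simp add: i_def)
  have "deg_diff (deg \<Lambda> \<mu>) (deg \<Lambda> \<nu>) = deg_diff (deg \<Lambda> \<mu>') (deg \<Lambda> \<nu>')"
    using s a by (auto simp: cylinder_iff')
  then have "deg \<Lambda> \<mu> + deg \<Lambda> \<nu>' = deg \<Lambda> \<mu>' + deg \<Lambda> \<nu>"
    by (simp add: deg_diff_eq_iff)
  from nat_vec_exchange[OF i this] have "deg \<Lambda> \<nu> + j = deg \<Lambda> \<nu>' + i" .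
  then show ?thesis
    using cyl_at_subset[OF s(2) a(2), of i] i by simp
qed

lemma cyl_at_disjoint_cylinder:
  assumes s: "same_src \<mu> \<nu>" "same_src \<mu>' \<nu>'" and a: "a \<in> Z \<mu> \<nu>" "a \<notin> Z \<mu>' \<nu>'"
    and le: "deg \<Lambda> \<mu>' \<le> deg \<Lambda> \<mu> + j"
  shows "cyl_at a (deg \<Lambda> \<mu> + j) (deg \<Lambda> \<nu> + j) \<inter> Z \<mu>' \<nu>' = {}"
  using assms cyl_at_subset_cylinder[OF s _ _ le] cyl_at_eq[OF s(1) a(1)]
    cyl_at_subset[OF s(1) a(1)] in_own_cyl_at[OF s(1) a(1)]
  by blast

section \<open>Partition of a cylinder into finer cylinders\<close>

definition parts :: "'m \<Rightarrow> 'm \<Rightarrow> nat ^ 'k \<Rightarrow> ('m, 'k) garrow set set" where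
  "parts \<mu> \<nu> j = (\<lambda>a. cyl_at a (deg \<Lambda> \<mu> + j) (deg \<Lambda> \<nu> + j)) ` Z \<mu> \<nu>"

lemma parts_in_cylinders: "same_src \<mu> \<nu> \<Longrightarrow> parts \<mu> \<nu> j \<subseteq> cylinders"
  using cyl_at_in_cylinders unfolding parts_def by blast

text \<open>Each part is \<open>Z (\<mu> \<cdot> \<alpha>) (\<nu> \<cdot> \<alpha>)\<close> with
  \<open>\<alpha>\<close> the first \<open>j\<close> steps of the common tail, and row finiteness
  bounds the number of such \<open>\<alpha>\<close>.\<close>

lemma finite_parts:
  assumes "same_src \<mu> \<nu>"
  shows "finite (parts \<mu> \<nu> j)"
proof -
  have "parts \<mu> \<nu> j \<subseteq> (\<lambda>\<alpha>. Z (\<mu> \<cdot> \<alpha>) (\<nu> \<cdot> \<alpha>)) ` paths_to \<Lambda> j (src \<Lambda> \<mu>)"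
  proof
    fix C assume "C \<in> parts \<mu> \<nu> j"
    then obtain x n y where a: "(x, n, y) \<in> Z \<mu> \<nu>"
      "C = cyl_at (x, n, y) (deg \<Lambda> \<mu> + j) (deg \<Lambda> \<nu> + j)"
      by (auto simp: parts_def)
    have a': "x \<in> IP" "y \<in> IP" "x (0, deg \<Lambda> \<mu>) = \<mu>" "y (0, deg \<Lambda> \<nu>) = \<nu>"
      "shift (deg \<Lambda> \<mu>) x = shift (deg \<Lambda> \<nu>) y"
      using assms a(1) by (auto simp: cylinder_iff')
    define \<alpha> where "\<alpha> = shift (deg \<Lambda> \<mu>) x (0, j)"
    have "C = Z (\<mu> \<cdot> \<alpha>) (\<nu> \<cdot> \<alpha>)"
      unfolding a(2) cyl_at_def g_rng.simps g_src.simps inf_path_split[OF a'(1)]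
        inf_path_split[OF a'(2)] a'(3,4) a'(5)[symmetric] \<alpha>_def ..
    moreover have "src \<Lambda> (x (0, deg \<Lambda> \<mu>)) = rng \<Lambda> \<alpha>" "\<alpha> \<in> mor \<Lambda>" "deg \<Lambda> \<alpha> = j"
      using a'(1) by (simp_all add: \<alpha>_def)
    ultimately show "C \<in> (\<lambda>\<alpha>. Z (\<mu> \<cdot> \<alpha>) (\<nu> \<cdot> \<alpha>)) ` paths_to \<Lambda> j (src \<Lambda> \<mu>)"
      unfolding a'(3) by (auto simp: paths_to_def)
  qed
  then show ?thesis
    using finite_paths_to_src[of \<mu> j] assms by (auto simp: same_src_def intro: finite_subset)
qed

lemma part_unique:
  assumes "same_src \<mu> \<nu>" "C \<in> parts \<mu> \<nu> j" "a \<in> C"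
  shows "C = cyl_at a (deg \<Lambda> \<mu> + j) (deg \<Lambda> \<nu> + j)"
  using assms cyl_at_eq unfolding parts_def by blast

lemma part_subset: "same_src \<mu> \<nu> \<Longrightarrow> C \<in> parts \<mu> \<nu> j \<Longrightarrow> C \<subseteq> Z \<mu> \<nu>"
  using cyl_at_subset unfolding parts_def by blast

text \<open>The parts partition the cylinder, so a step function on it is evaluated through the one
  part containing the arrow.\<close>

lemma sum_over_parts:
  fixes c :: "('m, 'k) garrow set \<Rightarrow> complex"
  assumes "same_src \<mu> \<nu>"
  shows "(\<Sum>C\<in>parts \<mu> \<nu> j. c C * indicator C a)
    = (if a \<in> Z \<mu> \<nu> then c (cyl_at a (deg \<Lambda> \<mu> + j) (deg \<Lambda> \<nu> + j)) else 0)"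
proof (cases "a \<in> Z \<mu> \<nu>")
  case True
  let ?A = "cyl_at a (deg \<Lambda> \<mu> + j) (deg \<Lambda> \<nu> + j)"
  have "c C * indicator C a = (if C = ?A then c C else 0)" if "C \<in> parts \<mu> \<nu> j" for C
    using part_unique[OF assms that, of a] in_own_cyl_at[OF assms True, of j]
    by (cases "C = ?A") (simp, force)
  then have "(\<Sum>C\<in>parts \<mu> \<nu> j. c C * indicator C a)
      = (\<Sum>C\<in>parts \<mu> \<nu> j. if C = ?A then c C else 0)"
    by (intro sum.cong) simp_all
  also have "\<dots> = c ?A"
  proof -
    have "?A \<in> parts \<mu> \<nu> j" using True unfolding parts_def by blast
    then show ?thesis using finite_parts[OF assms] by simp
  qed
  finally show ?thesis using True by simp
next
  case False
  then have "a \<notin> C" if "C \<in> parts \<mu> \<nu> j" for C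
    using part_subset[OF assms that] by blast
  then show ?thesis
    using False by (simp add: sum.neutral)
qed

section \<open>Groupoid operations and compactness of cylinders\<close>

lemma mem_groupoid_iff_cylinder: "a \<in> G \<longleftrightarrow> (\<exists>\<mu> \<nu>. same_src \<mu> \<nu> \<and> a \<in> Z \<mu> \<nu>)"
proof
  assume "a \<in> G"
  then obtain x y p q where "a = (x, deg_diff p q, y)" "x \<in> IP" "y \<in> IP" "shift p x = shift q y"
    by (cases a) (auto simp: groupoid_iff)
  then have "same_src (x (0, p)) (y (0, q))" "a \<in> cyl_at a p q"
    using same_src_segments by (auto simp: in_cyl_at_iff)
  then show "\<exists>\<mu> \<nu>. same_src \<mu> \<nu> \<and> a \<in> Z \<mu> \<nu>"
    using \<open>a = _\<close> by (auto simp: cyl_at_def)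
qed (use cylinder_subset_groupoid in auto)

lemma groupoid_inv [simp]: "g_inv a \<in> G \<longleftrightarrow> a \<in> G"
  by (cases a) (auto simp: groupoid_iff, (metis deg_diff_uminus equation_minus_iff)+)

lemma groupoid_mult:
  assumes "a \<in> G" "b \<in> G" "g_src a = g_rng b"
  shows "g_mult a b \<in> G"
proof -
  obtain x y p q where a: "a = (x, deg_diff p q, y)" "x \<in> IP" "y \<in> IP" "shift p x = shift q y"
    using assms(1) by (cases a) (auto simp: groupoid_iff)
  obtain z p' q' where b: "b = (y, deg_diff p' q', z)" "z \<in> IP" "shift p' y = shift q' z"
    using assms(2,3) a by (cases b) (auto simp: groupoid_iff)
  have "shift (p + p') x = shift (q + p') y" "shift (p' + q) y = shift (q' + q) z"
    using a b by (auto intro: shift_eq_add)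
  then show ?thesis
    using a b by (auto simp: groupoid_iff deg_diff_add add.commute)
qed

lemma inf_path_unit: "x \<in> IP \<Longrightarrow> (x, 0, x) \<in> G"
  by (auto simp: groupoid_iff intro!: exI[of _ 0])

text \<open>Compactness in terms of levels: a property that holds at some level around each arrow,
  persists at higher levels and is shared within a small cylinder holds at one level throughout.
  Counterexamples at the levels \<open>(K, ..., K)\<close> would have tails clustering at some
  \<open>w\<close>, and the arrow with tail \<open>w\<close> could not satisfy \<open>Q\<close> at
  any level.\<close>

lemma cylinder_compactness:
  assumes s: "same_src \<mu> \<nu>"
    and ex: "\<And>a. a \<in> Z \<mu> \<nu> \<Longrightarrow> \<exists>j. Q a j"
    and mono: "\<And>a j j'. a \<in> Z \<mu> \<nu> \<Longrightarrow> Q a j \<Longrightarrow> j \<le> j' \<Longrightarrow> Q a j'"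
    and local: "\<And>a b j. a \<in> Z \<mu> \<nu> \<Longrightarrow> b \<in> cyl_at a (deg \<Lambda> \<mu> + j) (deg \<Lambda> \<nu> + j) \<Longrightarrow> Q a j \<Longrightarrow> Q b j"
  shows "\<exists>J. \<forall>a\<in>Z \<mu> \<nu>. Q a J"
proof (rule ccontr)
  assume "\<not> ?thesis"
  then have "\<forall>K. \<exists>a\<in>Z \<mu> \<nu>. \<not> Q a (\<chi> i. K)" by blast
  then obtain A where A: "\<And>K. A K \<in> Z \<mu> \<nu>" "\<And>K. \<not> Q (A K) (\<chi> i. K)" by metis
  define z where "z K = shift (deg \<Lambda> \<mu>) (g_rng (A K))" for K
  have mn: "\<mu> \<in> mor \<Lambda>" "\<nu> \<in> mor \<Lambda>" "src \<Lambda> \<mu> = src \<Lambda> \<nu>"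
    using s by (auto simp: same_src_def)
  have AK: "g_rng (A K) \<in> IP" "g_src (A K) \<in> IP" "g_rng (A K) (0, deg \<Lambda> \<mu>) = \<mu>"
    "g_src (A K) (0, deg \<Lambda> \<nu>) = \<nu>" "shift (deg \<Lambda> \<nu>) (g_src (A K)) = z K" for K
    using A(1)[of K] s by (cases "A K"; simp add: cylinder_iff' z_def)+
  have z: "z K \<in> IP" "z K (0, 0) = src \<Lambda> \<mu>" for K
    using AK(1)[of K] prepend_eqI(2)[OF mn(1) AK(1,3)] by (auto simp: z_def)
  obtain w where w: "w \<in> IP" "w (0, 0) = src \<Lambda> \<mu>" "\<And>n K. \<exists>L\<ge>K. z L (0, n) = w (0, n)"
    using inf_path_cluster_point[of \<mu> z, OF mn(1) z] by metis
  define a where "a = (prepend \<Lambda> \<mu> w, deg_diff (deg \<Lambda> \<mu>) (deg \<Lambda> \<nu>), prepend \<Lambda> \<nu> w)"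
  have a: "a \<in> Z \<mu> \<nu>"
    using w by (auto simp: a_def cylinder_def)
  obtain j where j: "Q a j" using ex[OF a] by blast
  obtain K where K: "j \<le> (\<chi> i. K)" using nat_vec_le_constant by blast
  obtain L where L: "L \<ge> K" "z L (0, j) = w (0, j)" using w(3) by blast
  have pr: "prepend \<Lambda> \<mu> w (0, deg \<Lambda> \<mu> + j) = \<mu> \<cdot> w (0, j)"
    "prepend \<Lambda> \<nu> w (0, deg \<Lambda> \<nu> + j) = \<nu> \<cdot> w (0, j)"
    using prepend[OF mn(1) w(1,2)] prepend[OF mn(2) w(1)] w(2) mn(3)
    by (simp_all add: inf_path_split)
  \<comment> \<open>The tail of \<open>A L\<close> agrees with \<open>w\<close> on the first
    \<open>j\<close> steps, so \<open>A L\<close> and \<open>a\<close> have the same heads to level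
    \<open>j\<close>.\<close>
  have "A L \<in> cyl_at a (deg \<Lambda> \<mu> + j) (deg \<Lambda> \<nu> + j)"
    unfolding in_cyl_at_iff'[OF s a]
    using A(1) inf_path_split[OF AK(1), of L "deg \<Lambda> \<mu>" j] inf_path_split[OF AK(2), of L "deg \<Lambda> \<nu>" j]
      AK(3,4,5)[of L] L(2) pr
    by (simp add: a_def flip: z_def)
  then have "Q (A L) j" using local a j by blast
  \<comment> \<open>Level \<open>j\<close> lies below \<open>(K, ..., K)\<close> and hence below
    \<open>(L, ..., L)\<close>, where \<open>Q\<close> was chosen to fail.\<close>
  then have "Q (A L) (\<chi> i. L)"
    using mono A(1) order_trans[OF K constant_vec_le[OF L(1)]] by blast
  then show False using A(2) by blast
qed

end

section \<open>The reduced norm as a bilinear form bound\<close>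

lemma L2_set_power2: "(L2_set f F)\<^sup>2 = (\<Sum>i\<in>F. (f i)\<^sup>2)"
  by (simp add: L2_set_def sum_nonneg)

lemma L2_set_subset: "finite F \<Longrightarrow> H \<subseteq> F \<Longrightarrow> L2_set f H \<le> L2_set f F"
  by (auto simp: L2_set_def intro: sum_mono2)

lemma cmod_sum_mult_le_L2_set:
  "cmod (\<Sum>i\<in>F. f i * g i) \<le> L2_set (\<lambda>i. cmod (f i)) F * L2_set (\<lambda>i. cmod (g i)) F"
proof -
  have "cmod (\<Sum>i\<in>F. f i * g i) \<le> (\<Sum>i\<in>F. \<bar>cmod (f i)\<bar> * \<bar>cmod (g i)\<bar>)"
    by (rule order_trans[OF norm_sum]) (simp add: norm_mult)
  also have "\<dots> \<le> L2_set (\<lambda>i. cmod (f i)) F * L2_set (\<lambda>i. cmod (g i)) F"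
    by (rule L2_set_mult_ineq)
  finally show ?thesis .
qed

text \<open>Duality in finite-dimensional l2, tested on the conjugate of \<open>u\<close>.\<close>

lemma L2_set_dual_bound:
  assumes "finite H" "0 \<le> C"
    and "\<And>\<eta>. cmod (\<Sum>a\<in>H. u a * \<eta> a) \<le> C * L2_set (\<lambda>a. cmod (\<eta> a)) H"
  shows "L2_set (\<lambda>a. cmod (u a)) H \<le> C"
proof -
  let ?L = "L2_set (\<lambda>a. cmod (u a)) H"
  have "u a * cnj (u a) = of_real ((cmod (u a))\<^sup>2)" for a
    by (simp add: complex_norm_square[symmetric])
  then have "(\<Sum>a\<in>H. u a * cnj (u a)) = of_real (?L\<^sup>2)"
    by (simp add: L2_set_power2)
  then have "cmod (\<Sum>a\<in>H. u a * cnj (u a)) = ?L\<^sup>2"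
    by (metis abs_power2 norm_of_real)
  then have "?L\<^sup>2 \<le> C * ?L"
    using assms(3)[of "\<lambda>a. cnj (u a)"] by simp
  then show ?thesis
    using assms(2) L2_set_nonneg[of "\<lambda>a. cmod (u a)" H]
    by (cases "?L = 0") (auto simp: power2_eq_square)
qed

definition quo :: "('m, 'k::finite) garrow \<Rightarrow> ('m, 'k) garrow \<Rightarrow> ('m, 'k) garrow" where
  "quo a b = g_mult a (g_inv b)"

lemma quo_triple [simp]: "quo (x, n, z) (y, m, z') = (x, n - m, y)"
  by (simp add: quo_def)

fun g_deg :: "('m, 'k::finite) garrow \<Rightarrow> int ^ 'k" where
  "g_deg (x, n, y) = n"

lemma quo_simps [simp]: "g_rng (quo a b) = g_rng a" "g_src (quo a b) = g_rng b"
  "g_deg (quo a b) = g_deg a - g_deg b" "g_inv (quo a b) = quo b a"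
  by (cases a; cases b; simp)+

lemma garrow_eqI: "g_rng a = g_rng b \<Longrightarrow> g_deg a = g_deg b \<Longrightarrow> g_src a = g_src b \<Longrightarrow> a = b"
  by (cases a; cases b) simp

context higher_rank_graph
begin

definition fib :: "('m, 'k) ipath \<Rightarrow> ('m, 'k) garrow set" where
  "fib x = {a \<in> G. g_src a = x}"

lemma quo_in_groupoid: "a \<in> fib x \<Longrightarrow> b \<in> fib x \<Longrightarrow> quo a b \<in> G"
  unfolding quo_def fib_def by (auto intro: groupoid_mult)

text \<open>A factorization \<open>b c = a\<close> is determined by \<open>c\<close>, since
  \<open>b\<close> must be \<open>quo a c\<close>; so the sum may run over the arrows with the
  source of \<open>a\<close>.\<close>

lemma conv_fib:
  assumes "a \<in> G"
  shows "conv \<Lambda> f g a = (\<Sum>\<^sub>\<infinity>c\<in>fib (g_src a). f (quo a c) * g c)"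
proof -
  have "bij_betw (\<lambda>c. (quo a c, c)) (fib (g_src a))
      {(b, c). b \<in> G \<and> c \<in> G \<and> g_src b = g_rng c \<and> g_mult b c = a}"
  proof (rule bij_betwI[where g = snd])
    show "(\<lambda>c. (quo a c, c)) \<in> fib (g_src a)
        \<rightarrow> {(b, c). b \<in> G \<and> c \<in> G \<and> g_src b = g_rng c \<and> g_mult b c = a}"
    proof
      fix c assume c: "c \<in> fib (g_src a)"
      then have "quo a c \<in> G" "c \<in> G"
        using quo_in_groupoid[of a "g_src a" c] assms by (auto simp: fib_def)
      moreover have "g_mult (quo a c) c = a"
        using c by (cases a; cases c) (simp add: fib_def)
      ultimately show "(quo a c, c) \<in> {(b, c). b \<in> G \<and> c \<in> G \<and> g_src b = g_rng c \<and> g_mult b c = a}"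
        by simp
    qed
    show "snd \<in> {(b, c). b \<in> G \<and> c \<in> G \<and> g_src b = g_rng c \<and> g_mult b c = a} \<rightarrow> fib (g_src a)"
      by (auto simp: fib_def)
  qed auto
  from infsum_reindex_bij_betw[OF this, of "\<lambda>(b, c). f b * g c"] show ?thesis
    using assms by (simp add: conv_def)
qed

lemma conv_finite_support:
  assumes "finite S" "S \<subseteq> fib x" "\<And>a. g a \<noteq> 0 \<Longrightarrow> a \<in> S" "a \<in> G"
  shows "conv \<Lambda> f g a = (if g_src a = x then \<Sum>b\<in>S. f (quo a b) * g b else 0)"
proof (cases "g_src a = x")
  case True
  have "(\<Sum>\<^sub>\<infinity>c\<in>fib (g_src a). f (quo a c) * g c) = (\<Sum>\<^sub>\<infinity>c\<in>S. f (quo a c) * g c)"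
    using assms True by (intro infsum_cong_neutral) auto
  then show ?thesis
    using assms True by (simp add: conv_fib)
next
  case False
  have "g c = 0" if "c \<in> fib (g_src a)" for c
  proof -
    have "c \<notin> S"
      using assms(2) False that by (auto simp: fib_def)
    then show ?thesis
      using assms(3) by metis
  qed
  then have "(\<Sum>\<^sub>\<infinity>c\<in>fib (g_src a). f (quo a c) * g c) = 0"
    by (intro infsum_0) simp
  then show ?thesis
    using assms False by (simp add: conv_fib)
qed

text \<open>
  \<open>opbd f C\<close> bounds the matrices \<open>f (a b\<^sup>-\<^sup>1)\<close>, \<open>a, b \<in> G\<^sub>x\<close>, of the regular representations by \<open>C\<close>.
\<close>

definition opbd :: "(('m, 'k) garrow \<Rightarrow> complex) \<Rightarrow> real \<Rightarrow> bool" where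
  "opbd f C \<longleftrightarrow> 0 \<le> C \<and> (\<forall>x\<in>IP. \<forall>F \<xi> \<eta>. finite F \<and> F \<subseteq> fib x \<longrightarrow>
     cmod (\<Sum>a\<in>F. \<Sum>b\<in>F. f (quo a b) * \<xi> b * \<eta> a)
       \<le> C * L2_set (\<lambda>b. cmod (\<xi> b)) F * L2_set (\<lambda>a. cmod (\<eta> a)) F)"

lemma opbdI:
  assumes "0 \<le> C" "\<And>x F \<xi> \<eta>. x \<in> IP \<Longrightarrow> finite F \<Longrightarrow> F \<subseteq> fib x \<Longrightarrow>
     cmod (\<Sum>a\<in>F. \<Sum>b\<in>F. f (quo a b) * \<xi> b * \<eta> a)
       \<le> C * L2_set (\<lambda>b. cmod (\<xi> b)) F * L2_set (\<lambda>a. cmod (\<eta> a)) F"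
  shows "opbd f C"
  using assms by (simp add: opbd_def)

lemma opbdD:
  assumes "opbd f C" "x \<in> IP" "finite F" "F \<subseteq> fib x"
  shows "cmod (\<Sum>a\<in>F. \<Sum>b\<in>F. f (quo a b) * \<xi> b * \<eta> a)
       \<le> C * L2_set (\<lambda>b. cmod (\<xi> b)) F * L2_set (\<lambda>a. cmod (\<eta> a)) F"
  using assms by (simp add: opbd_def)

lemma opbd_nonneg: "opbd f C \<Longrightarrow> 0 \<le> C"
  by (simp add: opbd_def)

text \<open>Extending both vectors by zero to \<open>F \<union> H\<close> reduces this to the square
  case of the definition.\<close>

lemma opbd_rect:
  assumes f: "opbd f C" "x \<in> IP" and F: "finite F" "F \<subseteq> fib x" and H: "finite H" "H \<subseteq> fib x"
  shows "cmod (\<Sum>a\<in>H. \<Sum>b\<in>F. f (quo a b) * \<xi> b * \<eta> a)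
       \<le> C * L2_set (\<lambda>b. cmod (\<xi> b)) F * L2_set (\<lambda>a. cmod (\<eta> a)) H"
proof -
  define \<xi>' where "\<xi>' b = (if b \<in> F then \<xi> b else 0)" for b
  define \<eta>' where "\<eta>' b = (if b \<in> H then \<eta> b else 0)" for b
  have "(\<Sum>b\<in>F. f (quo a b) * \<xi> b * \<eta> a) = (\<Sum>b\<in>F \<union> H. f (quo a b) * \<xi>' b * \<eta> a)" for a
    using F H by (intro sum.mono_neutral_cong_left) (auto simp: \<xi>'_def)
  then have "(\<Sum>a\<in>H. \<Sum>b\<in>F. f (quo a b) * \<xi> b * \<eta> a)
      = (\<Sum>a\<in>H. \<Sum>b\<in>F \<union> H. f (quo a b) * \<xi>' b * \<eta> a)"
    by simp
  also have "\<dots> = (\<Sum>a\<in>F \<union> H. \<Sum>b\<in>F \<union> H. f (quo a b) * \<xi>' b * \<eta>' a)"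
    using F H by (intro sum.mono_neutral_cong_left) (auto simp: \<eta>'_def)
  finally have "(\<Sum>a\<in>H. \<Sum>b\<in>F. f (quo a b) * \<xi> b * \<eta> a)
      = (\<Sum>a\<in>F \<union> H. \<Sum>b\<in>F \<union> H. f (quo a b) * \<xi>' b * \<eta>' a)" .
  moreover have "L2_set (\<lambda>b. cmod (\<xi>' b)) (F \<union> H) = L2_set (\<lambda>b. cmod (\<xi> b)) F"
    unfolding L2_set_def using F H
    by (intro arg_cong[where f = sqrt] sum.mono_neutral_cong_right) (auto simp: \<xi>'_def)
  moreover have "L2_set (\<lambda>b. cmod (\<eta>' b)) (F \<union> H) = L2_set (\<lambda>b. cmod (\<eta> b)) H"
    unfolding L2_set_def using F H
    by (intro arg_cong[where f = sqrt] sum.mono_neutral_cong_right) (auto simp: \<eta>'_def)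
  ultimately show ?thesis
    using opbdD[OF f, of "F \<union> H" \<xi>' \<eta>'] F H by simp
qed

lemma opbd_column:
  assumes f: "opbd f C" "x \<in> IP" and F: "finite F" "F \<subseteq> fib x" and H: "finite H" "H \<subseteq> fib x"
  shows "L2_set (\<lambda>a. cmod (\<Sum>b\<in>F. f (quo a b) * \<xi> b)) H \<le> C * L2_set (\<lambda>b. cmod (\<xi> b)) F"
proof (rule L2_set_dual_bound)
  show "cmod (\<Sum>a\<in>H. (\<Sum>b\<in>F. f (quo a b) * \<xi> b) * \<eta> a)
      \<le> C * L2_set (\<lambda>b. cmod (\<xi> b)) F * L2_set (\<lambda>a. cmod (\<eta> a)) H" for \<eta>
    using opbd_rect[OF assms] by (simp add: sum_distrib_right)
qed (use assms opbd_nonneg in \<open>auto intro!: mult_nonneg_nonneg\<close>)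

lemma opbd_row:
  assumes f: "opbd f C" "x \<in> IP" and F: "finite F" "F \<subseteq> fib x" and H: "finite H" "H \<subseteq> fib x"
  shows "L2_set (\<lambda>b. cmod (\<Sum>a\<in>H. f (quo a b) * \<eta> a)) F \<le> C * L2_set (\<lambda>a. cmod (\<eta> a)) H"
proof (rule L2_set_dual_bound)
  fix \<xi>
  have "(\<Sum>b\<in>F. (\<Sum>a\<in>H. f (quo a b) * \<eta> a) * \<xi> b) = (\<Sum>a\<in>H. \<Sum>b\<in>F. f (quo a b) * \<xi> b * \<eta> a)"
    by (subst sum.swap) (simp add: sum_distrib_left sum_distrib_right ac_simps)
  then show "cmod (\<Sum>b\<in>F. (\<Sum>a\<in>H. f (quo a b) * \<eta> a) * \<xi> b)
      \<le> C * L2_set (\<lambda>a. cmod (\<eta> a)) H * L2_set (\<lambda>a. cmod (\<xi> a)) F"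
    using opbd_rect[OF assms, of \<xi> \<eta>] by (simp only: mult.assoc mult.commute[of "L2_set _ H"])
qed (use assms opbd_nonneg in \<open>auto intro!: mult_nonneg_nonneg\<close>)

lemma l2_norm_le_iff:
  assumes "0 \<le> C"
  shows "l2_norm \<Lambda> \<xi> \<le> ennreal C \<longleftrightarrow> (\<forall>F. finite F \<and> F \<subseteq> G \<longrightarrow> L2_set (\<lambda>a. cmod (\<xi> a)) F \<le> C)"
  using assms by (auto simp: l2_norm_def SUP_le_iff)

text \<open>From right to left the column estimate bounds every image vector; from left to right
  \<open>\<xi>\<close> is scaled to a unit vector and its image is paired with \<open>\<eta>\<close>
  by Cauchy-Schwarz. Norm estimates thereby become inequalities between finite sums.\<close>

lemma red_norm_le_iff:
  assumes C: "0 \<le> C"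
  shows "red_norm \<Lambda> f \<le> ennreal C \<longleftrightarrow> opbd f C"
proof
  assume f: "opbd f C"
  show "red_norm \<Lambda> f \<le> ennreal C"
    unfolding red_norm_def
  proof (intro SUP_least)
    fix x \<xi> assume x: "x \<in> IP" and \<xi>: "\<xi> \<in> unit_vectors \<Lambda> x"
    define S where "S = {a. \<xi> a \<noteq> 0}"
    have S: "finite S" "S \<subseteq> fib x" "\<And>a. \<xi> a \<noteq> 0 \<Longrightarrow> a \<in> S" "S \<subseteq> G"
      using \<xi> by (auto simp: S_def unit_vectors_def fib_def)
    have \<xi>1: "L2_set (\<lambda>a. cmod (\<xi> a)) S \<le> 1"
      using \<xi> S(1,4) l2_norm_le_iff[of 1 \<xi>] by (simp add: unit_vectors_def)
    have conv: "conv \<Lambda> f \<xi> a = (if g_src a = x then \<Sum>b\<in>S. f (quo a b) * \<xi> b else 0)" if "a \<in> G" for a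
      by (rule conv_finite_support[OF S(1-3) that])
    show "l2_norm \<Lambda> (conv \<Lambda> f \<xi>) \<le> ennreal C"
      unfolding l2_norm_le_iff[OF C]
    proof (intro allI impI, elim conjE)
      fix F assume F: "finite F" "F \<subseteq> G"
      let ?H = "F \<inter> fib x"
      have "L2_set (\<lambda>a. cmod (conv \<Lambda> f \<xi> a)) F = L2_set (\<lambda>a. cmod (\<Sum>b\<in>S. f (quo a b) * \<xi> b)) ?H"
        unfolding L2_set_def using F conv
        by (intro arg_cong[where f = sqrt] sum.mono_neutral_cong_right) (auto simp: fib_def subset_eq)
      also have "\<dots> \<le> C * L2_set (\<lambda>b. cmod (\<xi> b)) S"
        using F S by (intro opbd_column[OF f x]) auto
      also have "\<dots> \<le> C"
        using \<xi>1 C by (simp add: mult_left_le)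
      finally show "L2_set (\<lambda>a. cmod (conv \<Lambda> f \<xi> a)) F \<le> C" .
    qed
  qed
next
  assume red: "red_norm \<Lambda> f \<le> ennreal C"
  show "opbd f C"
  proof (rule opbdI[OF C])
    fix x F and \<xi> \<eta> :: "('m, 'k) garrow \<Rightarrow> complex"
    assume x: "x \<in> IP" and F: "finite F" "F \<subseteq> fib x"
    let ?L = "L2_set (\<lambda>b. cmod (\<xi> b)) F"
    show "cmod (\<Sum>a\<in>F. \<Sum>b\<in>F. f (quo a b) * \<xi> b * \<eta> a) \<le> C * ?L * L2_set (\<lambda>a. cmod (\<eta> a)) F"
    proof (cases "?L = 0")
      \<comment> \<open>The zero vector cannot be normalised, but then both sides vanish.\<close>
      case True
      then have "\<forall>b\<in>F. \<xi> b = 0"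
        using F(1) by (simp add: L2_set_eq_0_iff)
      then show ?thesis
        using True by simp
    next
      case False
      then have L: "?L > 0"
        using L2_set_nonneg[of "\<lambda>b. cmod (\<xi> b)" F] by (metis less_eq_real_def)
      define \<zeta> where "\<zeta> b = (if b \<in> F then \<xi> b / of_real ?L else 0)" for b
      have \<zeta>: "\<And>b. \<zeta> b \<noteq> 0 \<Longrightarrow> b \<in> F"
        by (auto simp: \<zeta>_def split: if_splits)
      have "L2_set (\<lambda>a. cmod (\<zeta> a)) H \<le> 1" if H: "finite H" for H
      proof -
        have "L2_set (\<lambda>a. cmod (\<zeta> a)) H \<le> L2_set (\<lambda>a. cmod (\<zeta> a)) (F \<union> H)"
          using F H by (intro L2_set_subset) auto
        also have "\<dots> = L2_set (\<lambda>a. (1 / ?L) * cmod (\<xi> a)) F"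
          unfolding L2_set_def using F H L
          by (intro arg_cong[where f = sqrt] sum.mono_neutral_cong_right)
            (auto simp: \<zeta>_def norm_divide L2_set_def)
        also have "\<dots> = 1"
          using L by (subst L2_set_right_distrib[symmetric]) auto
        finally show ?thesis .
      qed
      then have "l2_norm \<Lambda> \<zeta> \<le> 1"
        using l2_norm_le_iff[of 1 \<zeta>] by simp
      moreover have "{a. \<zeta> a \<noteq> 0} \<subseteq> F"
        using \<zeta> by blast
      ultimately have "\<zeta> \<in> unit_vectors \<Lambda> x"
        using F finite_subset unfolding unit_vectors_def fib_def by blast
      then have "l2_norm \<Lambda> (conv \<Lambda> f \<zeta>) \<le> red_norm \<Lambda> f"
        unfolding red_norm_def using x by (blast intro: SUP_upper2)
      then have "l2_norm \<Lambda> (conv \<Lambda> f \<zeta>) \<le> ennreal C"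
        using red by (rule order_trans)
      then have "L2_set (\<lambda>a. cmod (conv \<Lambda> f \<zeta> a)) F \<le> C"
        using F l2_norm_le_iff[OF C] by (auto simp: fib_def)
      moreover have conv: "conv \<Lambda> f \<zeta> a = (\<Sum>b\<in>F. f (quo a b) * \<xi> b) / of_real ?L" if "a \<in> F" for a
      proof -
        have "a \<in> G" "g_src a = x"
          using that F by (auto simp: fib_def)
        then show ?thesis
          using conv_finite_support[OF F \<zeta>, of \<zeta> a f]
          by (simp add: \<zeta>_def sum_divide_distrib)
      qed
      ultimately have le: "L2_set (\<lambda>a. cmod ((\<Sum>b\<in>F. f (quo a b) * \<xi> b) / of_real ?L)) F \<le> C"
        by (simp cong: L2_set_cong)
      have "(\<Sum>a\<in>F. \<Sum>b\<in>F. f (quo a b) * \<xi> b * \<eta> a)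
          = (\<Sum>a\<in>F. of_real ?L * (((\<Sum>b\<in>F. f (quo a b) * \<xi> b) / of_real ?L) * \<eta> a))"
        using L by (simp flip: sum_distrib_right)
      also have "\<dots> = of_real ?L * (\<Sum>a\<in>F. ((\<Sum>b\<in>F. f (quo a b) * \<xi> b) / of_real ?L) * \<eta> a)"
        by (simp only: sum_distrib_left)
      finally have "(\<Sum>a\<in>F. \<Sum>b\<in>F. f (quo a b) * \<xi> b * \<eta> a)
          = of_real ?L * (\<Sum>a\<in>F. ((\<Sum>b\<in>F. f (quo a b) * \<xi> b) / of_real ?L) * \<eta> a)" .
      then have "cmod (\<Sum>a\<in>F. \<Sum>b\<in>F. f (quo a b) * \<xi> b * \<eta> a)
          = ?L * cmod (\<Sum>a\<in>F. ((\<Sum>b\<in>F. f (quo a b) * \<xi> b) / of_real ?L) * \<eta> a)"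
        using L by (simp only: norm_mult) simp
      also have "\<dots> \<le> ?L * (L2_set (\<lambda>a. cmod ((\<Sum>b\<in>F. f (quo a b) * \<xi> b) / of_real ?L)) F
          * L2_set (\<lambda>a. cmod (\<eta> a)) F)"
        using L by (intro mult_left_mono cmod_sum_mult_le_L2_set) auto
      also have "\<dots> \<le> ?L * (C * L2_set (\<lambda>a. cmod (\<eta> a)) F)"
        using le L by (intro mult_left_mono mult_right_mono) auto
      finally show ?thesis
        by (simp add: ac_simps)
    qed
  qed
qed

section \<open>Elementary norm estimates\<close>

lemma opbd_mono: "opbd f C \<Longrightarrow> C \<le> D \<Longrightarrow> opbd f D"
  using red_norm_le_iff[of C f] red_norm_le_iff[of D f] opbd_nonneg[of f C]
  by (meson ennreal_leI order_trans)

lemma opbd_add: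
  assumes "opbd f C" "opbd g D"
  shows "opbd (\<lambda>a. f a + g a) (C + D)"
proof (rule opbdI)
  fix x F and \<xi> \<eta> :: "('m, 'k) garrow \<Rightarrow> complex"
  assume x: "x \<in> IP" and F: "finite F" "F \<subseteq> fib x"
  have "(\<Sum>a\<in>F. \<Sum>b\<in>F. (f (quo a b) + g (quo a b)) * \<xi> b * \<eta> a)
    = (\<Sum>a\<in>F. \<Sum>b\<in>F. f (quo a b) * \<xi> b * \<eta> a) + (\<Sum>a\<in>F. \<Sum>b\<in>F. g (quo a b) * \<xi> b * \<eta> a)"
    by (simp add: distrib_right sum.distrib)
  also have "cmod \<dots> \<le> C * L2_set (\<lambda>b. cmod (\<xi> b)) F * L2_set (\<lambda>a. cmod (\<eta> a)) F
     + D * L2_set (\<lambda>b. cmod (\<xi> b)) F * L2_set (\<lambda>a. cmod (\<eta> a)) F"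
    by (intro norm_triangle_mono opbdD[OF assms(1) x F] opbdD[OF assms(2) x F])
  finally show "cmod (\<Sum>a\<in>F. \<Sum>b\<in>F. (f (quo a b) + g (quo a b)) * \<xi> b * \<eta> a)
    \<le> (C + D) * L2_set (\<lambda>b. cmod (\<xi> b)) F * L2_set (\<lambda>a. cmod (\<eta> a)) F"
    by (simp add: algebra_simps)
qed (use assms opbd_nonneg in \<open>simp add: add_nonneg_nonneg\<close>)

lemma opbd_scale:
  assumes "opbd f C"
  shows "opbd (\<lambda>a. c * f a) (cmod c * C)"
proof (rule opbdI)
  fix x F and \<xi> \<eta> :: "('m, 'k) garrow \<Rightarrow> complex"
  assume x: "x \<in> IP" and F: "finite F" "F \<subseteq> fib x"
  have "(\<Sum>a\<in>F. \<Sum>b\<in>F. (c * f (quo a b)) * \<xi> b * \<eta> a)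
    = c * (\<Sum>a\<in>F. \<Sum>b\<in>F. f (quo a b) * \<xi> b * \<eta> a)"
    by (simp add: sum_distrib_left mult.assoc)
  also have "cmod \<dots> \<le> cmod c * (C * L2_set (\<lambda>b. cmod (\<xi> b)) F * L2_set (\<lambda>a. cmod (\<eta> a)) F)"
    unfolding norm_mult by (intro mult_left_mono opbdD[OF assms x F]) simp
  finally show "cmod (\<Sum>a\<in>F. \<Sum>b\<in>F. (c * f (quo a b)) * \<xi> b * \<eta> a)
    \<le> cmod c * C * L2_set (\<lambda>b. cmod (\<xi> b)) F * L2_set (\<lambda>a. cmod (\<eta> a)) F"
    by (simp add: algebra_simps)
qed (use assms opbd_nonneg in simp)

lemma opbd_zero: "0 \<le> C \<Longrightarrow> opbd (\<lambda>a. 0) C"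
  by (rule opbdI) simp_all

lemma opbd_uminus: "opbd f C \<Longrightarrow> opbd (\<lambda>a. - f a) C"
  using opbd_scale[of f C "-1"] by simp

lemma opbd_diff: "opbd f C \<Longrightarrow> opbd g D \<Longrightarrow> opbd (\<lambda>a. f a - g a) (C + D)"
  using opbd_add[of f C "\<lambda>a. - g a" D] opbd_uminus[of g D] by simp

lemma opbd_diff_commute: "opbd (\<lambda>a. f a - g a) C \<longleftrightarrow> opbd (\<lambda>a. g a - f a) C"
  using opbd_uminus[of "\<lambda>a. f a - g a" C] opbd_uminus[of "\<lambda>a. g a - f a" C] by auto

lemma opbd_triangle:
  "opbd (\<lambda>a. f a - g a) C \<Longrightarrow> opbd (\<lambda>a. g a - h a) D \<Longrightarrow> opbd (\<lambda>a. f a - h a) (C + D)"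
  using opbd_add[of "\<lambda>a. f a - g a" C "\<lambda>a. g a - h a" D] by simp

lemma opbd_star:
  assumes "opbd f C"
  shows "opbd (star \<Lambda> f) C"
proof (rule opbdI)
  fix x F and \<xi> \<eta> :: "('m, 'k) garrow \<Rightarrow> complex"
  assume x: "x \<in> IP" and F: "finite F" "F \<subseteq> fib x"
  have "(\<Sum>a\<in>F. \<Sum>b\<in>F. star \<Lambda> f (quo a b) * \<xi> b * \<eta> a)
      = cnj (\<Sum>a\<in>F. \<Sum>b\<in>F. f (quo a b) * cnj (\<eta> b) * cnj (\<xi> a))"
  proof -
    have "star \<Lambda> f (quo a b) = cnj (f (quo b a))" if "a \<in> F" "b \<in> F" for a b
      using quo_in_groupoid[of a x b] that F by (auto simp: star_def)
    then have "(\<Sum>a\<in>F. \<Sum>b\<in>F. star \<Lambda> f (quo a b) * \<xi> b * \<eta> a)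
        = (\<Sum>a\<in>F. \<Sum>b\<in>F. cnj (f (quo b a)) * \<xi> b * \<eta> a)"
      by simp
    also have "\<dots> = (\<Sum>b\<in>F. \<Sum>a\<in>F. cnj (f (quo b a)) * \<xi> b * \<eta> a)"
      by (rule sum.swap)
    finally show ?thesis
      by (simp add: ac_simps)
  qed
  then have "cmod (\<Sum>a\<in>F. \<Sum>b\<in>F. star \<Lambda> f (quo a b) * \<xi> b * \<eta> a)
      = cmod (\<Sum>a\<in>F. \<Sum>b\<in>F. f (quo a b) * cnj (\<eta> b) * cnj (\<xi> a))"
    by (simp only: complex_mod_cnj)
  then show "cmod (\<Sum>a\<in>F. \<Sum>b\<in>F. star \<Lambda> f (quo a b) * \<xi> b * \<eta> a)
      \<le> C * L2_set (\<lambda>b. cmod (\<xi> b)) F * L2_set (\<lambda>a. cmod (\<eta> a)) F"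
    using opbdD[OF assms x F, of "\<lambda>a. cnj (\<eta> a)" "\<lambda>a. cnj (\<xi> a)"] by (simp add: ac_simps)
qed (use assms opbd_nonneg in simp)

text \<open>The value \<open>f a\<close> is a matrix entry of \<open>f\<close>, in the row of
  \<open>a\<close> and the column of the unit \<open>u\<close> at its source. So convergence in norm
  implies uniform convergence on the groupoid.\<close>

lemma cmod_le_opbd:
  assumes f: "opbd f C" and a: "a \<in> G"
  shows "cmod (f a) \<le> C"
proof -
  define u where "u = (g_src a, 0 :: int ^ 'k, g_src a)"
  have src: "g_src a \<in> IP"
    using a by (cases a) (simp add: groupoid_iff)
  have u: "u \<in> fib (g_src a)" "a \<in> fib (g_src a)" "quo a u = a"
    using inf_path_unit[OF src] a by (cases a; auto simp: u_def fib_def)+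
  show ?thesis
    using opbd_rect[OF f src, of "{u}" "{a}" "\<lambda>_. 1" "\<lambda>_. 1"] u by simp
qed

section \<open>Bisections and Schur multipliers\<close>

definition bisection :: "('m, 'k) garrow set \<Rightarrow> bool" where
  "bisection S \<longleftrightarrow> inj_on g_rng S \<and> inj_on g_src S"

text \<open>Along a bisection the matrix has at most one non-zero entry in each row and each column,
  so a bound on the entries bounds the operator. Functions supported in one cylinder are thus
  estimated by their supremum.\<close>

lemma opbd_bisection:
  assumes S: "bisection S" and supp: "\<And>a. a \<in> G \<Longrightarrow> f a \<noteq> 0 \<Longrightarrow> a \<in> S"
    and bd: "\<And>a. a \<in> S \<Longrightarrow> cmod (f a) \<le> C" and C: "0 \<le> C"
  shows "opbd f C"
proof (rule opbdI[OF C])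
  fix x F and \<xi> \<eta> :: "('m, 'k) garrow \<Rightarrow> complex"
  assume x: "x \<in> IP" and F: "finite F" "F \<subseteq> fib x"
  define T where "T = {(a, b). a \<in> F \<and> b \<in> F \<and> quo a b \<in> S}"
  have T: "finite T" "fst ` T \<subseteq> F" "snd ` T \<subseteq> F"
    using finite_subset[of T "F \<times> F"] F by (auto simp: T_def)
  have inj1: "inj_on fst T"
  proof (rule inj_onI)
    fix p q assume p: "p \<in> T" and q: "q \<in> T" and eq: "fst p = fst q"
    obtain a b c where [simp]: "p = (a, b)" "q = (a, c)"
      using eq by (cases p; cases q) auto
    have "quo a b \<in> S" "quo a c \<in> S" "b \<in> fib x" "c \<in> fib x"
      using p q F by (auto simp: T_def)
    then have e: "quo a b = quo a c"
      using S unfolding bisection_def by (metis inj_onD quo_simps(1))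
    have "b = c"
      using arg_cong[OF e, of g_src] arg_cong[OF e, of g_deg] \<open>b \<in> fib x\<close> \<open>c \<in> fib x\<close>
      by (intro garrow_eqI) (auto simp: fib_def)
    then show "p = q" by simp
  qed
  have inj2: "inj_on snd T"
  proof (rule inj_onI)
    fix p q assume p: "p \<in> T" and q: "q \<in> T" and eq: "snd p = snd q"
    obtain a b c where [simp]: "p = (b, a)" "q = (c, a)"
      using eq by (cases p; cases q) auto
    have "quo b a \<in> S" "quo c a \<in> S" "b \<in> fib x" "c \<in> fib x"
      using p q F by (auto simp: T_def)
    then have e: "quo b a = quo c a"
      using S unfolding bisection_def by (metis inj_onD quo_simps(2))
    have "b = c"
      using arg_cong[OF e, of g_rng] arg_cong[OF e, of g_deg] \<open>b \<in> fib x\<close> \<open>c \<in> fib x\<close>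
      by (intro garrow_eqI) (auto simp: fib_def)
    then show "p = q" by simp
  qed
  have "(\<Sum>a\<in>F. \<Sum>b\<in>F. f (quo a b) * \<xi> b * \<eta> a) = (\<Sum>(a, b)\<in>F \<times> F. f (quo a b) * \<xi> b * \<eta> a)"
    by (simp add: sum.cartesian_product)
  also have "\<dots> = (\<Sum>(a, b)\<in>T. f (quo a b) * \<xi> b * \<eta> a)"
  proof (rule sum.mono_neutral_right)
    have "f (quo a b) = 0" if "a \<in> F" "b \<in> F" "(a, b) \<notin> T" for a b
    proof -
      have "quo a b \<in> G" "quo a b \<notin> S"
        using that F(2) quo_in_groupoid by (blast, simp add: T_def)
      then show ?thesis using supp by metis
    qed
    then show "\<forall>i\<in>F \<times> F - T. (case i of (a, b) \<Rightarrow> f (quo a b) * \<xi> b * \<eta> a) = 0"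
      unfolding case_prod_beta by (metis DiffD1 DiffD2 mem_Times_iff mult_zero_left prod.collapse)
  qed (use F in \<open>auto simp: T_def\<close>)
  also have "cmod \<dots> \<le> (\<Sum>(a, b)\<in>T. C * (cmod (\<xi> b) * cmod (\<eta> a)))"
  proof (rule sum_norm_le)
    fix p assume "p \<in> T"
    then have "cmod (f (quo (fst p) (snd p))) \<le> C"
      using bd by (auto simp: T_def)
    then show "cmod (case p of (a, b) \<Rightarrow> f (quo a b) * \<xi> b * \<eta> a)
        \<le> (case p of (a, b) \<Rightarrow> C * (cmod (\<xi> b) * cmod (\<eta> a)))"
      by (simp add: case_prod_beta norm_mult mult.assoc mult_right_mono)
  qed
  also have "\<dots> = C * (\<Sum>p\<in>T. \<bar>cmod (\<xi> (snd p))\<bar> * \<bar>cmod (\<eta> (fst p))\<bar>)"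
    by (simp add: sum_distrib_left case_prod_beta)
  also have "\<dots> \<le> C * (L2_set (\<lambda>p. cmod (\<xi> (snd p))) T * L2_set (\<lambda>p. cmod (\<eta> (fst p))) T)"
    using C by (intro mult_left_mono L2_set_mult_ineq)
  also have "L2_set (\<lambda>p. cmod (\<xi> (snd p))) T = L2_set (\<lambda>b. cmod (\<xi> b)) (snd ` T)"
    by (simp add: L2_set_def sum.reindex[OF inj2])
  also have "L2_set (\<lambda>p. cmod (\<eta> (fst p))) T = L2_set (\<lambda>b. cmod (\<eta> b)) (fst ` T)"
    by (simp add: L2_set_def sum.reindex[OF inj1])
  also have "C * (L2_set (\<lambda>b. cmod (\<xi> b)) (snd ` T) * L2_set (\<lambda>b. cmod (\<eta> b)) (fst ` T))
      \<le> C * (L2_set (\<lambda>b. cmod (\<xi> b)) F * L2_set (\<lambda>b. cmod (\<eta> b)) F)"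
    using C F T by (intro mult_left_mono mult_mono L2_set_subset) auto
  finally show "cmod (\<Sum>a\<in>F. \<Sum>b\<in>F. f (quo a b) * \<xi> b * \<eta> a)
      \<le> C * L2_set (\<lambda>b. cmod (\<xi> b)) F * L2_set (\<lambda>a. cmod (\<eta> a)) F"
    by (simp add: mult.assoc)
qed

lemma bisection_cylinder:
  assumes "same_src \<mu> \<nu>"
  shows "bisection (Z \<mu> \<nu>)"
  unfolding bisection_def
proof
  show "inj_on g_rng (Z \<mu> \<nu>)"
  proof (rule inj_onI)
    fix a b assume "a \<in> Z \<mu> \<nu>" "b \<in> Z \<mu> \<nu>" "g_rng a = g_rng b"
    then show "a = b"
      using assms inf_path_eq_shiftI[of "g_src a" "g_src b" "deg \<Lambda> \<nu>"]
      by (cases a; cases b) (auto simp: cylinder_iff')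
  qed
  show "inj_on g_src (Z \<mu> \<nu>)"
  proof (rule inj_onI)
    fix a b assume "a \<in> Z \<mu> \<nu>" "b \<in> Z \<mu> \<nu>" "g_src a = g_src b"
    then show "a = b"
      using assms inf_path_eq_shiftI[of "g_rng a" "g_rng b" "deg \<Lambda> \<mu>"]
      by (cases a; cases b) (auto simp: cylinder_iff')
  qed
qed

text \<open>
  The easy half of Grothendieck's characterisation of Schur multipliers.
\<close>

lemma opbd_schur_multiplier:
  fixes f g :: "('m, 'k) garrow \<Rightarrow> complex"
  assumes f: "opbd f C"
    and mult: "\<And>x F. x \<in> IP \<Longrightarrow> finite F \<Longrightarrow> F \<subseteq> fib x \<Longrightarrow>
      \<exists>(J :: 'i set) p q. finite J \<and> (\<forall>a\<in>F. (\<Sum>i\<in>J. (cmod (p i a))\<^sup>2) \<le> 1)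
        \<and> (\<forall>a\<in>F. (\<Sum>i\<in>J. (cmod (q i a))\<^sup>2) \<le> 1)
        \<and> (\<forall>a\<in>F. \<forall>b\<in>F. g (quo a b) = (\<Sum>i\<in>J. p i a * q i b) * f (quo a b))"
  shows "opbd g C"
proof (rule opbdI)
  show C: "0 \<le> C" using f by (rule opbd_nonneg)
  fix x F and \<xi> \<eta> :: "('m, 'k) garrow \<Rightarrow> complex"
  assume x: "x \<in> IP" and F: "finite F" "F \<subseteq> fib x"
  obtain J :: "'i set" and p q where J: "finite J"
    and p: "\<And>a. a \<in> F \<Longrightarrow> (\<Sum>i\<in>J. (cmod (p i a))\<^sup>2) \<le> 1"
    and q: "\<And>a. a \<in> F \<Longrightarrow> (\<Sum>i\<in>J. (cmod (q i a))\<^sup>2) \<le> 1"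
    and g: "\<And>a b. a \<in> F \<Longrightarrow> b \<in> F \<Longrightarrow> g (quo a b) = (\<Sum>i\<in>J. p i a * q i b) * f (quo a b)"
    using mult[OF x F] by blast
  \<comment> \<open>The array \<open>h i b * \<zeta> b\<close> has at most the norm of
    \<open>\<zeta>\<close>, because its coefficients at each fixed \<open>b\<close> form a vector of
    norm at most 1.\<close>
  have le: "L2_set (\<lambda>i. L2_set (\<lambda>b. cmod (h i b * \<zeta> b)) F) J \<le> L2_set (\<lambda>b. cmod (\<zeta> b)) F"
    if h: "\<And>a. a \<in> F \<Longrightarrow> (\<Sum>i\<in>J. (cmod (h i a))\<^sup>2) \<le> 1"
    for h :: "'i \<Rightarrow> ('m, 'k) garrow \<Rightarrow> complex" and \<zeta> :: "('m, 'k) garrow \<Rightarrow> complex"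
  proof (rule power2_le_imp_le)
    have "(L2_set (\<lambda>i. L2_set (\<lambda>b. cmod (h i b * \<zeta> b)) F) J)\<^sup>2
        = (\<Sum>i\<in>J. \<Sum>b\<in>F. (cmod (h i b))\<^sup>2 * (cmod (\<zeta> b))\<^sup>2)"
      by (simp add: L2_set_power2 norm_mult power_mult_distrib)
    also have "\<dots> = (\<Sum>b\<in>F. (\<Sum>i\<in>J. (cmod (h i b))\<^sup>2) * (cmod (\<zeta> b))\<^sup>2)"
      by (subst sum.swap) (simp add: sum_distrib_right)
    also have "\<dots> \<le> (\<Sum>b\<in>F. 1 * (cmod (\<zeta> b))\<^sup>2)"
      by (intro sum_mono mult_right_mono h) auto
    finally show "(L2_set (\<lambda>i. L2_set (\<lambda>b. cmod (h i b * \<zeta> b)) F) J)\<^sup>2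
        \<le> (L2_set (\<lambda>b. cmod (\<zeta> b)) F)\<^sup>2"
      by (simp add: L2_set_power2)
  qed simp
  have "(\<Sum>a\<in>F. \<Sum>b\<in>F. g (quo a b) * \<xi> b * \<eta> a)
      = (\<Sum>a\<in>F. \<Sum>b\<in>F. \<Sum>i\<in>J. f (quo a b) * (q i b * \<xi> b) * (p i a * \<eta> a))"
    by (intro sum.cong refl) (simp add: g sum_distrib_left sum_distrib_right ac_simps)
  also have "\<dots> = (\<Sum>a\<in>F. \<Sum>i\<in>J. \<Sum>b\<in>F. f (quo a b) * (q i b * \<xi> b) * (p i a * \<eta> a))"
    by (intro sum.cong refl sum.swap)
  also have "\<dots> = (\<Sum>i\<in>J. \<Sum>a\<in>F. \<Sum>b\<in>F. f (quo a b) * (q i b * \<xi> b) * (p i a * \<eta> a))"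
    by (rule sum.swap)
  also have "cmod \<dots> \<le> (\<Sum>i\<in>J. C * L2_set (\<lambda>b. cmod (q i b * \<xi> b)) F * L2_set (\<lambda>b. cmod (p i b * \<eta> b)) F)"
    by (intro sum_norm_le opbdD[OF f x F])
  also have "\<dots> = C * (\<Sum>i\<in>J. \<bar>L2_set (\<lambda>b. cmod (q i b * \<xi> b)) F\<bar> * \<bar>L2_set (\<lambda>b. cmod (p i b * \<eta> b)) F\<bar>)"
    by (simp add: sum_distrib_left mult.assoc)
  also have "\<dots> \<le> C * (L2_set (\<lambda>i. L2_set (\<lambda>b. cmod (q i b * \<xi> b)) F) J
      * L2_set (\<lambda>i. L2_set (\<lambda>b. cmod (p i b * \<eta> b)) F) J)"
    using C by (intro mult_left_mono L2_set_mult_ineq)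
  also have "\<dots> \<le> C * (L2_set (\<lambda>b. cmod (\<xi> b)) F * L2_set (\<lambda>b. cmod (\<eta> b)) F)"
    using C le[of q \<xi>] le[of p \<eta>] p q by (intro mult_left_mono mult_mono) auto
  finally show "cmod (\<Sum>a\<in>F. \<Sum>b\<in>F. g (quo a b) * \<xi> b * \<eta> a)
      \<le> C * L2_set (\<lambda>b. cmod (\<xi> b)) F * L2_set (\<lambda>a. cmod (\<eta> a)) F"
    by (simp add: mult.assoc)
qed

text \<open>With labels \<open>u\<close> on rows and \<open>v\<close> on columns, keeping the
  entries with equal labels is a sum of compressions by mutually orthogonal projections on either
  side, hence contractive. The label \<open>None\<close> deletes a row or column.\<close>

lemma opbd_block:
  fixes u v :: "('m, 'k) garrow \<Rightarrow> 'c option"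
  assumes f: "opbd f C"
    and g: "\<And>x a b. a \<in> fib x \<Longrightarrow> b \<in> fib x \<Longrightarrow>
      g (quo a b) = (if u a \<noteq> None \<and> u a = v b then f (quo a b) else 0)"
  shows "opbd g C"
proof (rule opbd_schur_multiplier[OF f])
  fix x F assume x: "x \<in> IP" and F: "finite F" "F \<subseteq> fib x"
  let ?J = "u ` F - {None}"
  let ?p = "\<lambda>i a. of_bool (u a = i) :: complex" and ?q = "\<lambda>i a. of_bool (v a = i) :: complex"
  have le: "(\<Sum>i\<in>?J. (cmod (of_bool (w a = i)))\<^sup>2) \<le> 1" for w :: "('m, 'k) garrow \<Rightarrow> 'c option" and a
  proof -
    have "(\<Sum>i\<in>?J. (cmod (of_bool (w a = i)))\<^sup>2) = (\<Sum>i\<in>?J. if w a = i then 1 else 0)"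
      by (intro sum.cong) auto
    then show ?thesis
      using F(1) by simp
  qed
  moreover have "g (quo a b) = (\<Sum>i\<in>?J. ?p i a * ?q i b) * f (quo a b)" if "a \<in> F" "b \<in> F" for a b
  proof -
    have "(\<Sum>i\<in>?J. ?p i a * ?q i b) = (\<Sum>i\<in>?J. if u a = i then of_bool (u a = v b) else 0)"
      by (intro sum.cong) auto
    also have "\<dots> = (if u a \<noteq> None \<and> u a = v b then 1 else 0)"
      using F(1) that(1) by simp
    finally show ?thesis
      using g[OF subsetD[OF F(2) that(1)] subsetD[OF F(2) that(2)]] by auto
  qed
  ultimately show "\<exists>(J :: 'c option set) p q. finite J \<and> (\<forall>a\<in>F. (\<Sum>i\<in>J. (cmod (p i a))\<^sup>2) \<le> 1)
        \<and> (\<forall>a\<in>F. (\<Sum>i\<in>J. (cmod (q i a))\<^sup>2) \<le> 1)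
        \<and> (\<forall>a\<in>F. \<forall>b\<in>F. g (quo a b) = (\<Sum>i\<in>J. p i a * q i b) * f (quo a b))"
    using F(1) by - (rule exI[of _ ?J], rule exI[of _ ?p], rule exI[of _ ?q], blast)
qed

lemma opbd_rank_one_multiplier:
  assumes f: "opbd f C"
    and pq: "\<And>a. cmod (p a) \<le> 1" "\<And>a. cmod (q a) \<le> 1"
    and g: "\<And>x a b. a \<in> fib x \<Longrightarrow> b \<in> fib x \<Longrightarrow> g (quo a b) = p a * q b * f (quo a b)"
  shows "opbd g C"
proof (rule opbd_schur_multiplier[OF f])
  fix x F assume x: "x \<in> IP" and F: "finite F" "F \<subseteq> fib x"
  have "(cmod (p a))\<^sup>2 \<le> 1" "(cmod (q a))\<^sup>2 \<le> 1" for a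
    using pq by (simp_all add: power_le_one)
  then show "\<exists>(J :: unit set) p q. finite J \<and> (\<forall>a\<in>F. (\<Sum>i\<in>J. (cmod (p i a))\<^sup>2) \<le> 1)
        \<and> (\<forall>a\<in>F. (\<Sum>i\<in>J. (cmod (q i a))\<^sup>2) \<le> 1)
        \<and> (\<forall>a\<in>F. \<forall>b\<in>F. g (quo a b) = (\<Sum>i\<in>J. p i a * q i b) * f (quo a b))"
    using g[of _ x] F by - (rule exI[of _ "{()}"], rule exI[of _ "\<lambda>_. p"], rule exI[of _ "\<lambda>_. q"], simp add: subset_eq)
qed

text \<open>
  The Fejer kernel \<open>1 - \<bar>s - t\<bar> / N\<close> is the proportion of the windows \<open>{l..<l + N}\<close> containing \<open>s\<close>
  that also contain \<open>t\<close>.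
\<close>

definition fejer :: "nat \<Rightarrow> int \<Rightarrow> real" where
  "fejer N n = max 0 (1 - \<bar>of_int n\<bar> / real N)"

lemma opbd_fejer:
  assumes f: "opbd f C" and N: "N > 0"
  shows "opbd (\<lambda>a. of_real (fejer N (g_deg a $ i)) * f a) C"
proof (rule opbd_schur_multiplier[OF f])
  fix x F assume x: "x \<in> IP" and F: "finite F" "F \<subseteq> fib x"
  define d where "d a = g_deg a $ i" for a :: "('m, 'k) garrow"
  define W where "W a = {d a - int N + 1..d a}" for a
  define J where "J = (\<Union>a\<in>F. W a)"
  have J: "finite J" "\<And>a. a \<in> F \<Longrightarrow> W a \<subseteq> J"
    using F(1) by (auto simp: J_def W_def)
  \<comment> \<open>\<open>W a\<close> consists of the left ends of the \<open>N\<close> windows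
    containing \<open>d a\<close>. Its normalised indicator is a unit vector, and the Fejer kernel
    is the inner product of two of these.\<close>
  define p where "p l a = (of_bool (l \<in> W a) :: complex) / of_real (sqrt (real N))" for l a
  have le: "(\<Sum>l\<in>J. (cmod (p l a))\<^sup>2) \<le> 1" if "a \<in> F" for a
  proof -
    have "(\<Sum>l\<in>J. (cmod (p l a))\<^sup>2) = (\<Sum>l\<in>W a. 1 / real N)"
      using J that by (intro sum.mono_neutral_cong_right)
        (auto simp: p_def norm_divide power_divide)
    also have "\<dots> = 1"
      using N by (simp add: W_def)
    finally show ?thesis by simp
  qed
  have fej: "of_real (fejer N (d a - d b)) = (\<Sum>l\<in>J. p l a * p l b)" if "a \<in> F" "b \<in> F" for a b
  proof -
    have "(\<Sum>l\<in>J. p l a * p l b) = (\<Sum>l\<in>W a \<inter> W b. 1 / of_nat N)"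
      using J(1) J(2)[OF that(1)] N by (intro sum.mono_neutral_cong_right)
        (auto simp: p_def simp flip: of_real_mult)
    also have "W a \<inter> W b = {max (d a) (d b) - int N + 1..min (d a) (d b)}"
      by (auto simp: W_def)
    also have "(\<Sum>l\<in>{max (d a) (d b) - int N + 1..min (d a) (d b)}. 1 / of_nat N)
        = (of_real (real (nat (int N - \<bar>d a - d b\<bar>)) / real N) :: complex)"
    proof -
      have "nat (min (d a) (d b) + (int N - max (d a) (d b))) = nat (int N - \<bar>d a - d b\<bar>)"
        by (rule arg_cong[where f = nat]) (auto simp: min_def max_def)
      then show ?thesis by simp
    qed
    \<comment> \<open>The truncation in \<open>nat\<close> matches the \<open>max 0\<close> of the
      kernel: no window contains two points at distance \<open>N\<close> or more.\<close>
    also have "real (nat (int N - \<bar>d a - d b\<bar>)) / real N = fejer N (d a - d b)"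
      using N by (cases "\<bar>d a - d b\<bar> \<le> int N") (auto simp: fejer_def field_simps max_def)
    finally show ?thesis by simp
  qed
  show "\<exists>(J :: int set) p q. finite J \<and> (\<forall>a\<in>F. (\<Sum>i\<in>J. (cmod (p i a))\<^sup>2) \<le> 1)
        \<and> (\<forall>a\<in>F. (\<Sum>i\<in>J. (cmod (q i a))\<^sup>2) \<le> 1)
        \<and> (\<forall>a\<in>F. \<forall>b\<in>F. of_real (fejer N (g_deg (quo a b) $ i)) * f (quo a b)
            = (\<Sum>i\<in>J. p i a * q i b) * f (quo a b))"
    using le fej J(1) by - (rule exI[of _ J], rule exI[of _ p], rule exI[of _ p], simp add: d_def)
qed

end

section \<open>Density of the span of cylinder functions\<close>

declare split_paired_All [simp del] split_paired_Ex [simp del]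

context higher_rank_graph
begin

section \<open>Norm closures and closed subspaces\<close>

lemma norm_closure_iff:
  "f \<in> norm_closure \<Lambda> S \<longleftrightarrow> (\<forall>a. a \<notin> G \<longrightarrow> f a = 0) \<and> (\<forall>\<epsilon>>0. \<exists>g\<in>S. opbd (\<lambda>a. f a - g a) \<epsilon>)"
proof -
  have "(\<forall>\<epsilon>>0. \<exists>g\<in>S. red_norm \<Lambda> (\<lambda>a. f a - g a) < ennreal \<epsilon>)
      \<longleftrightarrow> (\<forall>\<epsilon>>0. \<exists>g\<in>S. red_norm \<Lambda> (\<lambda>a. f a - g a) \<le> ennreal \<epsilon>)" (is "?L \<longleftrightarrow> ?R")
  proof
    assume R: ?R
    show ?L
    proof (intro allI impI)
      fix \<epsilon> :: real assume "\<epsilon> > 0"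
      then obtain g where "g \<in> S" "red_norm \<Lambda> (\<lambda>a. f a - g a) \<le> ennreal (\<epsilon> / 2)"
        using R by (metis half_gt_zero)
      moreover have "ennreal (\<epsilon> / 2) < ennreal \<epsilon>"
        using \<open>\<epsilon> > 0\<close> by (intro ennreal_lessI) auto
      ultimately show "\<exists>g\<in>S. red_norm \<Lambda> (\<lambda>a. f a - g a) < ennreal \<epsilon>"
        by (meson le_less_trans)
    qed
  qed (meson less_imp_le)
  then show ?thesis
    unfolding norm_closure_def by (simp add: red_norm_le_iff cong: conj_cong)
qed

lemma norm_closureI:
  assumes "\<And>a. a \<notin> G \<Longrightarrow> f a = 0" "\<And>\<epsilon>. \<epsilon> > 0 \<Longrightarrow> \<exists>g\<in>S. opbd (\<lambda>a. f a - g a) \<epsilon>"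
  shows "f \<in> norm_closure \<Lambda> S"
  using assms by (simp add: norm_closure_iff)

lemma norm_closureE:
  assumes "f \<in> norm_closure \<Lambda> S" "\<epsilon> > 0"
  obtains g where "g \<in> S" "opbd (\<lambda>a. f a - g a) \<epsilon>"
  using assms by (auto simp: norm_closure_iff)

lemma norm_closure_outside: "f \<in> norm_closure \<Lambda> S \<Longrightarrow> a \<notin> G \<Longrightarrow> f a = 0"
  by (metis norm_closure_iff)

lemma norm_closure_mono: "S \<subseteq> T \<Longrightarrow> norm_closure \<Lambda> S \<subseteq> norm_closure \<Lambda> T"
  unfolding norm_closure_def by blast

lemma norm_closure_superset: "(\<And>a. a \<notin> G \<Longrightarrow> f a = 0) \<Longrightarrow> f \<in> S \<Longrightarrow> f \<in> norm_closure \<Lambda> S"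
  by (intro norm_closureI) (auto intro!: bexI[of _ f] opbd_zero)

lemma norm_closure_idem:
  assumes "T \<subseteq> norm_closure \<Lambda> S"
  shows "norm_closure \<Lambda> T \<subseteq> norm_closure \<Lambda> S"
proof
  fix f assume f: "f \<in> norm_closure \<Lambda> T"
  show "f \<in> norm_closure \<Lambda> S"
  proof (rule norm_closureI)
    fix \<epsilon> :: real assume "\<epsilon> > 0"
    then have e: "\<epsilon> / 2 > 0" by simp
    obtain g where g: "g \<in> T" "opbd (\<lambda>a. f a - g a) (\<epsilon> / 2)"
      using f e by (rule norm_closureE)
    obtain h where h: "h \<in> S" "opbd (\<lambda>a. g a - h a) (\<epsilon> / 2)"
      using norm_closureE[OF subsetD[OF assms g(1)] e] by blast
    show "\<exists>g\<in>S. opbd (\<lambda>a. f a - g a) \<epsilon>"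
      using opbd_triangle[OF g(2) h(2)] h(1) by auto
  qed (use f in \<open>simp add: norm_closure_outside\<close>)
qed

definition closed_subspace :: "(('m, 'k) garrow \<Rightarrow> complex) set \<Rightarrow> bool" where
  "closed_subspace V \<longleftrightarrow> (\<lambda>a. 0) \<in> V \<and> (\<forall>f\<in>V. \<forall>g\<in>V. (\<lambda>a. f a + g a) \<in> V)
     \<and> (\<forall>c. \<forall>f\<in>V. (\<lambda>a. c * f a) \<in> V) \<and> norm_closure \<Lambda> V \<subseteq> V"

lemma closed_subspaceD:
  assumes "closed_subspace V"
  shows "(\<lambda>a. 0) \<in> V" "\<And>f g. f \<in> V \<Longrightarrow> g \<in> V \<Longrightarrow> (\<lambda>a. f a + g a) \<in> V"
    "\<And>c f. f \<in> V \<Longrightarrow> (\<lambda>a. c * f a) \<in> V" "\<And>f. f \<in> norm_closure \<Lambda> V \<Longrightarrow> f \<in> V"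
  using assms by (auto simp: closed_subspace_def)

lemma closed_subspace_diff:
  assumes "closed_subspace V" "f \<in> V" "g \<in> V"
  shows "(\<lambda>a. f a - g a) \<in> V"
  using closed_subspaceD(2)[OF assms(1,2) closed_subspaceD(3)[OF assms(1,3), of "-1"]] by simp

lemma closed_subspace_sum:
  assumes "closed_subspace V" "finite I" "\<And>i. i \<in> I \<Longrightarrow> f i \<in> V"
  shows "(\<lambda>a. \<Sum>i\<in>I. f i a) \<in> V"
  using assms(2,3)
  by (induction I rule: finite_induct) (simp_all add: closed_subspaceD[OF assms(1)])

lemma closed_subspace_norm_closure:
  assumes "(\<lambda>a. 0) \<in> V" "\<And>f g. f \<in> V \<Longrightarrow> g \<in> V \<Longrightarrow> (\<lambda>a. f a + g a) \<in> V"
    "\<And>c f. f \<in> V \<Longrightarrow> (\<lambda>a. c * f a) \<in> V"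
  shows "closed_subspace (norm_closure \<Lambda> V)"
  unfolding closed_subspace_def
proof (intro conjI ballI allI)
  show "(\<lambda>a. 0) \<in> norm_closure \<Lambda> V"
    using assms(1) by (intro norm_closure_superset) auto
  show "norm_closure \<Lambda> (norm_closure \<Lambda> V) \<subseteq> norm_closure \<Lambda> V"
    by (rule norm_closure_idem) simp
next
  fix f g assume f: "f \<in> norm_closure \<Lambda> V" and g: "g \<in> norm_closure \<Lambda> V"
  show "(\<lambda>a. f a + g a) \<in> norm_closure \<Lambda> V"
  proof (rule norm_closureI)
    fix \<epsilon> :: real assume "\<epsilon> > 0"
    then have e: "\<epsilon> / 2 > 0" by simp
    obtain f' where f': "f' \<in> V" "opbd (\<lambda>a. f a - f' a) (\<epsilon> / 2)" using f e by (rule norm_closureE)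
    obtain g' where g': "g' \<in> V" "opbd (\<lambda>a. g a - g' a) (\<epsilon> / 2)" using g e by (rule norm_closureE)
    show "\<exists>h\<in>V. opbd (\<lambda>a. f a + g a - h a) \<epsilon>"
      using opbd_add[OF f'(2) g'(2)] assms(2)[OF f'(1) g'(1)]
      by (intro bexI[of _ "\<lambda>a. f' a + g' a"]) (simp_all add: algebra_simps)
  qed (use f g in \<open>simp add: norm_closure_outside\<close>)
next
  fix c f assume f: "f \<in> norm_closure \<Lambda> V"
  show "(\<lambda>a. c * f a) \<in> norm_closure \<Lambda> V"
  proof (rule norm_closureI)
    fix \<epsilon> :: real assume e: "\<epsilon> > 0"
    \<comment> \<open>The added 1 covers the case \<open>c = 0\<close>.\<close>
    have pos: "\<epsilon> / (cmod c + 1) > 0"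
      using e by (intro divide_pos_pos) (auto intro: add_nonneg_pos)
    obtain f' where f': "f' \<in> V" "opbd (\<lambda>a. f a - f' a) (\<epsilon> / (cmod c + 1))"
      using norm_closureE[OF f pos] .
    have "cmod c * (\<epsilon> / (cmod c + 1)) \<le> \<epsilon>"
    proof -
      have "cmod c * \<epsilon> \<le> \<epsilon> * (cmod c + 1)"
        using e by (simp add: algebra_simps)
      moreover have "0 < cmod c + 1"
        by (simp add: add_nonneg_pos)
      ultimately show ?thesis
        by (simp add: pos_divide_le_eq)
    qed
    then have "opbd (\<lambda>a. c * f a - c * f' a) \<epsilon>"
      using opbd_mono[OF opbd_scale[OF f'(2), of c]] by (simp add: right_diff_distrib)
    then show "\<exists>h\<in>V. opbd (\<lambda>a. c * f a - h a) \<epsilon>"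
      by (rule bexI[of _ "\<lambda>a. c * f' a", OF _ assms(3)[OF f'(1)]])
  qed (use f in \<open>simp add: norm_closure_outside\<close>)
qed

section \<open>Finite combinations of cylinder indicators\<close>

inductive_set cspan :: "(('m, 'k) garrow \<Rightarrow> complex) set" where
  zero: "(\<lambda>a. 0) \<in> cspan"
| step: "f \<in> cspan \<Longrightarrow> C \<in> cylinders \<Longrightarrow> (\<lambda>a. f a + c * indicator C a) \<in> cspan"

lemma cspan_add: "g \<in> cspan \<Longrightarrow> f \<in> cspan \<Longrightarrow> (\<lambda>a. f a + g a) \<in> cspan"
proof (induction g rule: cspan.induct)
  case (step g C c)
  then show ?case
    using cspan.step[of "\<lambda>a. f a + g a" C c] by (simp add: add.assoc)
qed simp

lemma cspan_scale: "f \<in> cspan \<Longrightarrow> (\<lambda>a. d * f a) \<in> cspan"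
proof (induction f rule: cspan.induct)
  case (step g C c)
  then show ?case
    using cspan.step[of "\<lambda>a. d * g a" C "d * c"] by (simp add: algebra_simps)
qed (simp add: cspan.zero)

lemma cspan_indicator: "C \<in> cylinders \<Longrightarrow> indicator C \<in> cspan"
  using cspan.step[OF cspan.zero, of C 1] by simp

lemma cspan_sum:
  assumes "finite \<C>" "\<C> \<subseteq> cylinders"
  shows "(\<lambda>a. \<Sum>C\<in>\<C>. c C * indicator C a) \<in> cspan"
  using assms
proof (induction \<C> rule: finite_induct)
  case (insert C \<C>)
  then show ?case
    using cspan.step[of "\<lambda>a. \<Sum>C\<in>\<C>. c C * indicator C a" C "c C"]
    unfolding sum.insert[OF insert.hyps] by (simp only: add.commute insert_subset)
qed (simp add: cspan.zero)

lemma cspan_outside: "f \<in> cspan \<Longrightarrow> a \<notin> G \<Longrightarrow> f a = 0"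
  by (induction f rule: cspan.induct) (use cylinders_subset_groupoid in \<open>auto simp: indicator_def\<close>)

lemma bisection_cylinders: "C \<in> cylinders \<Longrightarrow> bisection C"
  using bisection_cylinder by (auto simp: cylinders_def)

lemma opbd_cspan: "f \<in> cspan \<Longrightarrow> \<exists>C. opbd f C"
proof (induction f rule: cspan.induct)
  case zero
  show ?case using opbd_zero[of 0] by blast
next
  case (step f C c)
  have "opbd (\<lambda>a. c * indicator C a) (cmod c)"
    by (rule opbd_bisection[OF bisection_cylinders[OF step(2)]])
      (auto simp: indicator_def split: if_splits)
  then show ?case
    using step.IH opbd_add by blast
qed

lemma cspan_support:
  "f \<in> cspan \<Longrightarrow> \<exists>I. finite I \<and> (\<forall>(\<mu>, \<nu>)\<in>I. same_src \<mu> \<nu>) \<and> (\<forall>a. f a \<noteq> 0 \<longrightarrow> (\<exists>(\<mu>, \<nu>)\<in>I. a \<in> Z \<mu> \<nu>))"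
proof (induction f rule: cspan.induct)
  case zero
  show ?case by (intro exI[of _ "{}"]) simp
next
  case (step f C c)
  obtain I where I: "finite I" "\<forall>(\<mu>, \<nu>)\<in>I. same_src \<mu> \<nu>" "\<forall>a. f a \<noteq> 0 \<longrightarrow> (\<exists>(\<mu>, \<nu>)\<in>I. a \<in> Z \<mu> \<nu>)"
    using step.IH by blast
  obtain \<mu> \<nu> where C: "C = Z \<mu> \<nu>" "same_src \<mu> \<nu>"
    using step(2) by (auto simp: cylinders_def)
  have "\<exists>(\<mu>', \<nu>')\<in>insert (\<mu>, \<nu>) I. a \<in> Z \<mu>' \<nu>'" if "f a + c * indicator C a \<noteq> 0" for a
  proof (cases "a \<in> C")
    case True
    then show ?thesis using C by simp
  next
    case False
    then have "f a \<noteq> 0" using that by simp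
    then show ?thesis using I(3) by blast
  qed
  then show ?case
    using I C by (intro exI[of _ "insert (\<mu>, \<nu>) I"]) simp
qed

text \<open>This is uniform continuity on each cylinder, with its parts as the scale; the vanishing
  oscillation is what lets step functions on the parts approximate \<open>f\<close>.\<close>

definition asymp_locally_constant :: "(('m, 'k) garrow \<Rightarrow> complex) \<Rightarrow> bool" where
  "asymp_locally_constant f \<longleftrightarrow> (\<forall>\<mu> \<nu> \<epsilon>. same_src \<mu> \<nu> \<and> \<epsilon> > 0 \<longrightarrow>
     (\<exists>j0. \<forall>j\<ge>j0. \<forall>a\<in>Z \<mu> \<nu>. \<forall>b\<in>cyl_at a (deg \<Lambda> \<mu> + j) (deg \<Lambda> \<nu> + j). cmod (f b - f a) < \<epsilon>))"

text \<open>A cylinder \<open>Z \<mu>' \<nu>'\<close> of the combination meets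
  \<open>Z \<mu> \<nu>\<close> in a union of parts once the level reaches
  \<open>deg \<Lambda> \<mu>'\<close>. Adding this degree to the level at each step of the induction
  serves all cylinders at once.\<close>

lemma cspan_locally_constant:
  assumes "f \<in> cspan" "same_src \<mu> \<nu>"
  shows "\<exists>j0. \<forall>j\<ge>j0. \<forall>a\<in>Z \<mu> \<nu>. \<forall>b\<in>cyl_at a (deg \<Lambda> \<mu> + j) (deg \<Lambda> \<nu> + j). f b = f a"
  using assms(1)
proof (induction f rule: cspan.induct)
  case (step f C c)
  obtain j0 where j0: "\<And>j a b. j0 \<le> j \<Longrightarrow> a \<in> Z \<mu> \<nu> \<Longrightarrow> b \<in> cyl_at a (deg \<Lambda> \<mu> + j) (deg \<Lambda> \<nu> + j) \<Longrightarrow> f b = f a"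
    using step.IH by blast
  obtain \<mu>' \<nu>' where C: "C = Z \<mu>' \<nu>'" "same_src \<mu>' \<nu>'"
    using step(2) by (auto simp: cylinders_def)
  have "f b + c * indicator C b = f a + c * indicator C a"
    if j: "j0 + deg \<Lambda> \<mu>' \<le> j" and ab: "a \<in> Z \<mu> \<nu>" "b \<in> cyl_at a (deg \<Lambda> \<mu> + j) (deg \<Lambda> \<nu> + j)" for j a b
  proof -
    have "f b = f a"
      using j0[OF order_trans[OF nat_vec_le_add(1) j] ab] .
    moreover have le: "deg \<Lambda> \<mu>' \<le> deg \<Lambda> \<mu> + j"
      using j order_trans by (metis nat_vec_le_add(2))
    have "b \<in> C \<longleftrightarrow> a \<in> C"
      using cyl_at_subset_cylinder[OF assms(2) C(2) ab(1) _ le] C(1)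
        cyl_at_disjoint_cylinder[OF assms(2) C(2) ab(1) _ le] ab(2) by blast
    ultimately show ?thesis
      by (simp add: indicator_def)
  qed
  then show ?case by blast
qed simp

lemma asymp_locally_constant_norm_closure:
  assumes "f \<in> norm_closure \<Lambda> cspan"
  shows "asymp_locally_constant f"
  unfolding asymp_locally_constant_def
proof (intro allI impI, elim conjE)
  fix \<mu> \<nu> and \<epsilon> :: real assume s: "same_src \<mu> \<nu>" and e: "\<epsilon> > 0"
  have e3: "\<epsilon> / 3 > 0" using e by simp
  obtain g where g: "g \<in> cspan" "opbd (\<lambda>a. f a - g a) (\<epsilon> / 3)"
    using assms e3 by (rule norm_closureE)
  obtain j0 where j0: "\<And>j a b. j0 \<le> j \<Longrightarrow> a \<in> Z \<mu> \<nu> \<Longrightarrow> b \<in> cyl_at a (deg \<Lambda> \<mu> + j) (deg \<Lambda> \<nu> + j) \<Longrightarrow> g b = g a"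
    using cspan_locally_constant[OF g(1) s] by blast
  have "cmod (f b - f a) < \<epsilon>"
    if j: "j0 \<le> j" and ab: "a \<in> Z \<mu> \<nu>" "b \<in> cyl_at a (deg \<Lambda> \<mu> + j) (deg \<Lambda> \<nu> + j)" for j a b
  proof -
    have "a \<in> G" "b \<in> G"
      using ab cyl_at_subset[OF s ab(1), of j] cylinder_subset_groupoid[OF s] by auto
    then have "cmod (f a - g a) \<le> \<epsilon> / 3" "cmod (f b - g b) \<le> \<epsilon> / 3"
      using cmod_le_opbd[OF g(2)] by auto
    then have "cmod ((f b - g b) - (f a - g a)) \<le> \<epsilon> / 3 + \<epsilon> / 3"
      using norm_triangle_ineq4[of "f b - g b" "f a - g a"] by linarith
    then show ?thesis
      using j0[OF j ab] e by simp
  qed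
  then show "\<exists>j0. \<forall>j\<ge>j0. \<forall>a\<in>Z \<mu> \<nu>. \<forall>b\<in>cyl_at a (deg \<Lambda> \<mu> + j) (deg \<Lambda> \<nu> + j). cmod (f b - f a) < \<epsilon>"
    by blast
qed

text \<open>Both terms live on one bisection, so the pointwise bound is a norm bound.\<close>

lemma opbd_parts:
  assumes s: "same_src \<mu> \<nu>" and e: "0 \<le> \<epsilon>"
    and c: "\<And>a. a \<in> Z \<mu> \<nu> \<Longrightarrow> cmod (f a - c (cyl_at a (deg \<Lambda> \<mu> + j) (deg \<Lambda> \<nu> + j))) \<le> \<epsilon>"
  shows "opbd (\<lambda>a. f a * indicator (Z \<mu> \<nu>) a - (\<Sum>C\<in>parts \<mu> \<nu> j. c C * indicator C a)) \<epsilon>"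
  by (rule opbd_bisection[OF bisection_cylinder[OF s] _ _ e])
    (use c in \<open>auto simp: sum_over_parts[OF s] split: if_splits\<close>)

definition rep :: "('m, 'k) garrow set \<Rightarrow> ('m, 'k) garrow" where
  "rep C = (SOME a. a \<in> C)"

text \<open>Sampling \<open>f\<close> at one arrow \<open>rep C\<close> of each part gives the
  approximating step function.\<close>

lemma asymp_locally_constant_approx:
  assumes f: "asymp_locally_constant f" and s: "same_src \<mu> \<nu>" and e: "\<epsilon> > 0"
  shows "\<exists>g\<in>cspan. opbd (\<lambda>a. f a * indicator (Z \<mu> \<nu>) a - g a) \<epsilon>"
proof -
  obtain j where j: "\<And>a b. a \<in> Z \<mu> \<nu> \<Longrightarrow> b \<in> cyl_at a (deg \<Lambda> \<mu> + j) (deg \<Lambda> \<nu> + j) \<Longrightarrow> cmod (f b - f a) < \<epsilon>"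
    using f s e unfolding asymp_locally_constant_def by blast
  have "opbd (\<lambda>a. f a * indicator (Z \<mu> \<nu>) a - (\<Sum>C\<in>parts \<mu> \<nu> j. f (rep C) * indicator C a)) \<epsilon>"
  proof (rule opbd_parts[OF s])
    fix a assume a: "a \<in> Z \<mu> \<nu>"
    let ?C = "cyl_at a (deg \<Lambda> \<mu> + j) (deg \<Lambda> \<nu> + j)"
    have "rep ?C \<in> ?C"
      unfolding rep_def using in_own_cyl_at[OF s a] by (rule someI)
    then show "cmod (f a - f (rep ?C)) \<le> \<epsilon>"
      using j[OF a] by (metis norm_minus_commute less_imp_le)
  qed (use e in simp)
  then show ?thesis
    by (intro bexI[of _ "\<lambda>a. \<Sum>C\<in>parts \<mu> \<nu> j. f (rep C) * indicator C a"]
      cspan_sum finite_parts[OF s] parts_in_cylinders[OF s])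
qed

section \<open>Topology of the groupoid\<close>

abbreviation T where "T \<equiv> groupoid_topology \<Lambda>"

lemma groupoid_topology_eq: "T = topology_generated_by cylinders"
  unfolding groupoid_topology_def cylinders_def same_src_def ..

lemma topspace_groupoid [simp]: "topspace T = G"
proof -
  have "\<Union> cylinders = G"
    using mem_groupoid_iff_cylinder unfolding cylinders_def by blast
  then show ?thesis
    by (simp add: groupoid_topology_eq)
qed

lemma openin_cylinder: "C \<in> cylinders \<Longrightarrow> openin T C"
  unfolding groupoid_topology_eq by (rule topology_generated_by_Basis)

text \<open>Cylinders at growing levels form a neighbourhood base at \<open>a\<close>. Intersections
  are handled by passing to the sum of two levels, and a generating cylinder contains the part cut
  at its own range degree.\<close>

lemma open_contains_cyl_at:
  assumes U: "openin T U" and s: "same_src \<mu> \<nu>" and a: "a \<in> Z \<mu> \<nu>" "a \<in> U"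
  shows "\<exists>j. cyl_at a (deg \<Lambda> \<mu> + j) (deg \<Lambda> \<nu> + j) \<subseteq> U"
proof -
  have "generate_topology_on cylinders U"
    using U by (simp add: groupoid_topology_eq openin_topology_generated_by_iff)
  then show ?thesis
    using a(2)
  proof (induction U rule: generate_topology_on.induct)
    case (Int U V)
    then obtain j k where "cyl_at a (deg \<Lambda> \<mu> + j) (deg \<Lambda> \<nu> + j) \<subseteq> U"
      "cyl_at a (deg \<Lambda> \<mu> + k) (deg \<Lambda> \<nu> + k) \<subseteq> V"
      by blast
    then show ?case
      using cyl_at_antimono[OF s a(1), of j "j + k"] cyl_at_antimono[OF s a(1), of k "j + k"]
      by (intro exI[of _ "j + k"]) auto
  next
    case (UN K)
    then show ?case by blast
  next
    case (Basis C)
    then obtain \<mu>' \<nu>' where "C = Z \<mu>' \<nu>'" "same_src \<mu>' \<nu>'"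
      by (auto simp: cylinders_def)
    then show ?case
      using Basis cyl_at_subset_cylinder[OF s _ a(1), of \<mu>' \<nu>' "deg \<Lambda> \<mu>'"] by auto
  qed simp
qed

text \<open>An arrow outside the cylinder has a part around it, cut at level
  \<open>deg \<Lambda> \<mu>\<close>, that avoids the cylinder. Being clopen, cylinders can be split
  off a continuous function.\<close>

lemma openin_complement_cylinder:
  assumes "C \<in> cylinders"
  shows "openin T (G - C)"
proof (subst openin_subopen, intro ballI)
  obtain \<mu> \<nu> where C: "C = Z \<mu> \<nu>" "same_src \<mu> \<nu>"
    using assms by (auto simp: cylinders_def)
  fix a assume a: "a \<in> G - C"
  then obtain \<mu>' \<nu>' where s: "same_src \<mu>' \<nu>'" "a \<in> Z \<mu>' \<nu>'"
    using mem_groupoid_iff_cylinder by blast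
  let ?D = "cyl_at a (deg \<Lambda> \<mu>' + deg \<Lambda> \<mu>) (deg \<Lambda> \<nu>' + deg \<Lambda> \<mu>)"
  have "?D \<in> cylinders" "a \<in> ?D" "?D \<inter> C = {}"
    using cyl_at_in_cylinders[OF s] in_own_cyl_at[OF s]
      cyl_at_disjoint_cylinder[OF s(1) C(2) s(2), of "deg \<Lambda> \<mu>"] a C(1) by auto
  then show "\<exists>T'. openin T T' \<and> a \<in> T' \<and> T' \<subseteq> G - C"
    using openin_cylinder cylinders_subset_groupoid by (intro exI[of _ ?D]) blast
qed

text \<open>A Lebesgue number argument: the property passed to \<open>cylinder_compactness\<close>
  is that a single member of the cover contains the part. At one level every part then fits into a
  member, and the parts are finite in number.\<close>

lemma compactin_cylinder:
  assumes "C \<in> cylinders"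
  shows "compactin T C"
  unfolding compactin_def
proof (intro conjI allI impI)
  show "C \<subseteq> topspace T"
    using cylinders_subset_groupoid[OF assms] by simp
next
  obtain \<mu> \<nu> where C: "C = Z \<mu> \<nu>" and s: "same_src \<mu> \<nu>"
    using assms by (auto simp: cylinders_def)
  fix \<U> assume U: "Ball \<U> (openin T) \<and> C \<subseteq> \<Union> \<U>"
  have "\<exists>J. \<forall>a\<in>Z \<mu> \<nu>. \<exists>U\<in>\<U>. cyl_at a (deg \<Lambda> \<mu> + J) (deg \<Lambda> \<nu> + J) \<subseteq> U"
  proof (rule cylinder_compactness[OF s])
    fix a assume a: "a \<in> Z \<mu> \<nu>"
    then obtain U' where U': "U' \<in> \<U>" "a \<in> U'"
      using U C by blast
    then have "openin T U'"
      using U by blast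
    from open_contains_cyl_at[OF this s a U'(2)]
    show "\<exists>j. \<exists>U\<in>\<U>. cyl_at a (deg \<Lambda> \<mu> + j) (deg \<Lambda> \<nu> + j) \<subseteq> U"
      using U'(1) by blast
  next
    show "\<exists>U\<in>\<U>. cyl_at a (deg \<Lambda> \<mu> + j') (deg \<Lambda> \<nu> + j') \<subseteq> U"
      if "a \<in> Z \<mu> \<nu>" "\<exists>U\<in>\<U>. cyl_at a (deg \<Lambda> \<mu> + j) (deg \<Lambda> \<nu> + j) \<subseteq> U" "j \<le> j'" for a j j'
      using cyl_at_antimono[OF s that(1,3)] that(2) by blast
  next
    show "\<exists>U\<in>\<U>. cyl_at b (deg \<Lambda> \<mu> + j) (deg \<Lambda> \<nu> + j) \<subseteq> U"
      if "a \<in> Z \<mu> \<nu>" "b \<in> cyl_at a (deg \<Lambda> \<mu> + j) (deg \<Lambda> \<nu> + j)"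
        "\<exists>U\<in>\<U>. cyl_at a (deg \<Lambda> \<mu> + j) (deg \<Lambda> \<nu> + j) \<subseteq> U" for a b j
      using cyl_at_eq[OF s that(1,2)] that(3) by simp
  qed
  then obtain J where "\<forall>D\<in>parts \<mu> \<nu> J. \<exists>U\<in>\<U>. D \<subseteq> U"
    unfolding parts_def by blast
  then obtain u where u: "\<And>D. D \<in> parts \<mu> \<nu> J \<Longrightarrow> u D \<in> \<U> \<and> D \<subseteq> u D"
    by metis
  have "C \<subseteq> \<Union> (parts \<mu> \<nu> J)"
    unfolding C parts_def using in_own_cyl_at[OF s] by blast
  then have "C \<subseteq> \<Union> (u ` parts \<mu> \<nu> J)"
    using u by blast
  then show "\<exists>\<F>. finite \<F> \<and> \<F> \<subseteq> \<U> \<and> C \<subseteq> \<Union> \<F>"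
    using u finite_parts[OF s] by (intro exI[of _ "u ` parts \<mu> \<nu> J"]) auto
qed

lemma continuous_map_mult_indicator:
  assumes f: "continuous_map T euclidean f" and C: "C \<in> cylinders"
  shows "continuous_map T euclidean (\<lambda>a. f a * indicator C a :: complex)"
    "continuous_map T euclidean (\<lambda>a. f a * (1 - indicator C a) :: complex)"
proof -
  have *: "continuous_map T euclidean (\<lambda>a. if a \<in> D then f a else 0)"
    if D: "openin T D" "openin T (G - D)" for D
    unfolding continuous_map_def
  proof (intro conjI allI impI)
    fix U :: "complex set" assume "openin euclidean U"
    then have "openin T ({a \<in> topspace T. f a \<in> U})"
      using f by (simp add: continuous_map_def)
    then have "openin T ({a \<in> topspace T. f a \<in> U} \<inter> D \<union> (if 0 \<in> U then G - D else {}))"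
      using D by auto
    moreover have "{a \<in> topspace T. f a \<in> U} \<inter> D \<union> (if 0 \<in> U then G - D else {})
        = {a \<in> topspace T. (if a \<in> D then f a else 0) \<in> U}"
      using openin_subset[OF D(1)] by auto
    ultimately show "openin T {a \<in> topspace T. (if a \<in> D then f a else 0) \<in> U}"
      by simp
  qed simp
  have C': "openin T C" "openin T (G - C)" "G - (G - C) = C"
    using openin_cylinder[OF C] openin_complement_cylinder[OF C] cylinders_subset_groupoid[OF C] by auto
  show "continuous_map T euclidean (\<lambda>a. f a * indicator C a :: complex)"
    by (rule continuous_map_eq[OF *[OF C'(1,2)]]) simp
  have "continuous_map T euclidean (\<lambda>a. if a \<in> G - C then f a else 0)"
    by (rule *) (use C' in simp_all)
  then show "continuous_map T euclidean (\<lambda>a. f a * (1 - indicator C a) :: complex)"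
    by (rule continuous_map_eq) simp
qed

text \<open>The property passed to \<open>cylinder_compactness\<close> compares any two arrows of
  the part instead of comparing with its centre, so that it depends on the part alone.\<close>

lemma continuous_asymp_locally_constant:
  fixes f :: "('m, 'k) garrow \<Rightarrow> complex"
  assumes f: "continuous_map T euclidean f"
  shows "asymp_locally_constant f"
  unfolding asymp_locally_constant_def
proof (intro allI impI, elim conjE)
  fix \<mu> \<nu> and \<epsilon> :: real assume s: "same_src \<mu> \<nu>" and e: "\<epsilon> > 0"
  let ?cyl = "\<lambda>a j. cyl_at a (deg \<Lambda> \<mu> + j) (deg \<Lambda> \<nu> + j)"
  have "\<exists>J. \<forall>a\<in>Z \<mu> \<nu>. \<forall>b\<in>?cyl a J. \<forall>c\<in>?cyl a J. cmod (f b - f c) < \<epsilon>"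
  proof (rule cylinder_compactness[OF s])
    fix a assume a: "a \<in> Z \<mu> \<nu>"
    let ?U = "{b \<in> topspace T. f b \<in> ball (f a) (\<epsilon> / 2)}"
    have "openin T ?U"
      by (rule openin_continuous_map_preimage[OF f]) simp
    moreover have "a \<in> ?U"
      using a cylinder_subset_groupoid[OF s] e by auto
    ultimately obtain j where j: "?cyl a j \<subseteq> ?U"
      using open_contains_cyl_at[OF _ s a, of ?U] by metis
    have "cmod (f b - f c) < \<epsilon>" if "b \<in> ?cyl a j" "c \<in> ?cyl a j" for b c
    proof -
      have "dist (f a) (f b) < \<epsilon> / 2" "dist (f a) (f c) < \<epsilon> / 2"
        using that j by auto
      then show ?thesis
        using dist_triangle_half_r[of "f a" "f b" \<epsilon> "f c"] by (simp add: dist_norm)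
    qed
    then show "\<exists>j. \<forall>b\<in>?cyl a j. \<forall>c\<in>?cyl a j. cmod (f b - f c) < \<epsilon>" by blast
  next
    show "\<forall>b\<in>?cyl a j'. \<forall>c\<in>?cyl a j'. cmod (f b - f c) < \<epsilon>"
      if "a \<in> Z \<mu> \<nu>" "\<forall>b\<in>?cyl a j. \<forall>c\<in>?cyl a j. cmod (f b - f c) < \<epsilon>" "j \<le> j'" for a j j'
      using cyl_at_antimono[OF s that(1,3)] that(2) by blast
  next
    show "\<forall>b\<in>?cyl d j. \<forall>c\<in>?cyl d j. cmod (f b - f c) < \<epsilon>"
      if "a \<in> Z \<mu> \<nu>" "d \<in> ?cyl a j" "\<forall>b\<in>?cyl a j. \<forall>c\<in>?cyl a j. cmod (f b - f c) < \<epsilon>" for a d j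
      using cyl_at_eq[OF s that(1,2)] that(3) by simp
  qed
  then obtain J where J: "\<And>a b c. a \<in> Z \<mu> \<nu> \<Longrightarrow> b \<in> ?cyl a J \<Longrightarrow> c \<in> ?cyl a J \<Longrightarrow> cmod (f b - f c) < \<epsilon>"
    by blast
  have "cmod (f b - f a) < \<epsilon>" if "J \<le> j" "a \<in> Z \<mu> \<nu>" "b \<in> ?cyl a j" for j a b
    using J[OF that(2)] cyl_at_antimono[OF s that(2,1)] that(3) in_own_cyl_at[OF s that(2)] by blast
  then show "\<exists>j0. \<forall>j\<ge>j0. \<forall>a\<in>Z \<mu> \<nu>. \<forall>b\<in>?cyl a j. cmod (f b - f a) < \<epsilon>"
    by blast
qed

section \<open>Density in the C*-algebra\<close>

lemma closed_subspace_closure_cspan: "closed_subspace (norm_closure \<Lambda> cspan)"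
  by (rule closed_subspace_norm_closure) (use cspan.zero cspan_add cspan_scale in auto)

text \<open>The cylinders of the cover may overlap. Splitting off \<open>f * indicator C\<close>
  leaves a function that vanishes on \<open>C\<close> and is still continuous because
  \<open>C\<close> is clopen.\<close>

lemma continuous_in_closure_cspan:
  fixes f :: "('m, 'k) garrow \<Rightarrow> complex"
  assumes "finite \<C>" "\<C> \<subseteq> cylinders" "continuous_map T euclidean f" "\<And>a. f a \<noteq> 0 \<Longrightarrow> a \<in> \<Union> \<C>"
  shows "f \<in> norm_closure \<Lambda> cspan"
  using assms
proof (induction \<C> arbitrary: f rule: finite_induct)
  case empty
  then have "f = (\<lambda>a. 0)" by blast
  then show ?case
    using closed_subspaceD(1)[OF closed_subspace_closure_cspan] by simp
next
  case (insert C \<C>)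
  then obtain \<mu> \<nu> where C: "C = Z \<mu> \<nu>" "same_src \<mu> \<nu>" "C \<in> cylinders"
    by (auto simp: cylinders_def)
  have "(\<lambda>a. f a * indicator C a) \<in> norm_closure \<Lambda> cspan"
  proof (rule norm_closureI)
    show "f a * indicator C a = 0" if "a \<notin> G" for a
      using that C(1) cylinder_subset_groupoid[OF C(2)] by (auto simp: indicator_def)
    show "\<exists>g\<in>cspan. opbd (\<lambda>a. f a * indicator C a - g a) \<epsilon>" if "\<epsilon> > 0" for \<epsilon>
      unfolding C(1)
      by (rule asymp_locally_constant_approx[OF continuous_asymp_locally_constant[OF insert.prems(2)] C(2) that])
  qed
  moreover have "(\<lambda>a. f a * (1 - indicator C a)) \<in> norm_closure \<Lambda> cspan"
  proof (rule insert.IH)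
    show "continuous_map T euclidean (\<lambda>a. f a * (1 - indicator C a) :: complex)"
      by (rule continuous_map_mult_indicator(2)) (use insert.prems C in auto)
    show "a \<in> \<Union> \<C>" if "f a * (1 - indicator C a) \<noteq> 0" for a
      using that insert.prems(3)[of a] by (auto simp: indicator_def split: if_splits)
  qed (use insert.prems in auto)
  ultimately have "(\<lambda>a. f a * indicator C a + f a * (1 - indicator C a)) \<in> norm_closure \<Lambda> cspan"
    by (rule closed_subspaceD(2)[OF closed_subspace_closure_cspan])
  then show ?case
    by (simp add: algebra_simps)
qed

lemma Cc_subset_closure_cspan: "Cc \<Lambda> \<subseteq> norm_closure \<Lambda> cspan"
proof
  fix f assume "f \<in> Cc \<Lambda>"
  then have f: "\<And>a. a \<notin> G \<Longrightarrow> f a = 0" "continuous_map T euclidean f"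
    and K: "compactin T (T closure_of {a \<in> G. f a \<noteq> 0})"
    by (auto simp: Cc_def)
  have "T closure_of {a \<in> G. f a \<noteq> 0} \<subseteq> \<Union> cylinders"
    using closure_of_subset_topspace[of T] mem_groupoid_iff_cylinder by (fastforce simp: cylinders_def)
  then obtain \<C> where \<C>: "finite \<C>" "\<C> \<subseteq> cylinders" "T closure_of {a \<in> G. f a \<noteq> 0} \<subseteq> \<Union> \<C>"
    using compactinD[OF K, of cylinders] openin_cylinder by blast
  show "f \<in> norm_closure \<Lambda> cspan"
  proof (rule continuous_in_closure_cspan[OF \<C>(1,2) f(2)])
    show "a \<in> \<Union> \<C>" if "f a \<noteq> 0" for a
      using that f(1)[of a] \<C>(3) closure_of_subset[of "{a \<in> G. f a \<noteq> 0}" T] by auto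
  qed
qed

lemma indicator_in_Cc:
  assumes C: "C \<in> cylinders"
  shows "indicator C \<in> Cc \<Lambda>"
proof -
  have "continuous_map T euclidean (\<lambda>a. 1 * indicator C a :: complex)"
    by (rule continuous_map_mult_indicator(1)[OF _ C]) simp
  then have "continuous_map T euclidean (indicator C :: _ \<Rightarrow> complex)"
    by (simp only: mult_1_left)
  moreover have "T closure_of C = C"
    using closure_of_closedin[of T C] openin_complement_cylinder[OF C] cylinders_subset_groupoid[OF C]
    by (simp add: closedin_def)
  moreover have "{a \<in> G. (indicator C a :: complex) \<noteq> 0} = C"
    using cylinders_subset_groupoid[OF C] by (auto simp: indicator_def)
  ultimately show ?thesis
    using compactin_cylinder[OF C] cylinders_subset_groupoid[OF C]
    unfolding Cc_def by (auto intro: indicator_simps)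
qed

lemma Cc_add_scale:
  assumes f: "f \<in> Cc \<Lambda>" and g: "g \<in> Cc \<Lambda>"
  shows "(\<lambda>a. f a + c * g a) \<in> Cc \<Lambda>"
proof -
  let ?cl = "\<lambda>h. T closure_of {a \<in> G. h a \<noteq> (0::complex)}"
  have "?cl (\<lambda>a. f a + c * g a) \<subseteq> T closure_of ({a \<in> G. f a \<noteq> 0} \<union> {a \<in> G. g a \<noteq> 0})"
    by (rule closure_of_mono) auto
  then have "?cl (\<lambda>a. f a + c * g a) \<subseteq> ?cl f \<union> ?cl g"
    by simp
  moreover have "compactin T (?cl f \<union> ?cl g)"
    using f g by (intro compactin_Un) (auto simp: Cc_def)
  ultimately have "compactin T (?cl (\<lambda>a. f a + c * g a))"
    by (meson closed_compactin closedin_closure_of)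
  moreover have "continuous_map T euclidean (\<lambda>a. f a + c * g a)"
    using f g unfolding Cc_def
    by (intro continuous_map_add continuous_map_compose[of T euclidean g euclidean "\<lambda>z. c * z", unfolded o_def])
      (auto intro!: continuous_intros)
  ultimately show ?thesis
    using f g by (simp add: Cc_def)
qed

lemma cspan_subset_Cc: "cspan \<subseteq> Cc \<Lambda>"
proof
  fix f assume "f \<in> cspan"
  then show "f \<in> Cc \<Lambda>"
  proof (induction f rule: cspan.induct)
    case zero
    show ?case by (simp add: Cc_def)
  qed (intro Cc_add_scale indicator_in_Cc)
qed

text \<open>Continuous functions on compact cylinders are limits of step functions, so finite
  combinations of cylinder indicators suffice as approximants in everything that follows.\<close>

lemma Cstar_eq: "Cstar \<Lambda> = norm_closure \<Lambda> cspan"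
  unfolding Cstar_def
  using norm_closure_idem[OF Cc_subset_closure_cspan] norm_closure_mono[OF cspan_subset_Cc] by blast

lemma closed_subspace_Cstar: "closed_subspace (Cstar \<Lambda>)"
  by (simp add: Cstar_eq closed_subspace_closure_cspan)

lemma cspan_subset_Cstar: "cspan \<subseteq> Cstar \<Lambda>"
  unfolding Cstar_eq by (intro subsetI norm_closure_superset) (auto simp: cspan_outside)

lemma Cstar_outside: "f \<in> Cstar \<Lambda> \<Longrightarrow> a \<notin> G \<Longrightarrow> f a = 0"
  unfolding Cstar_eq by (rule norm_closure_outside)

lemma CstarE:
  assumes "f \<in> Cstar \<Lambda>" "\<epsilon> > 0"
  obtains g where "g \<in> cspan" "opbd (\<lambda>a. f a - g a) \<epsilon>"
  using assms unfolding Cstar_eq by (rule norm_closureE)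

lemma opbd_Cstar:
  assumes "f \<in> Cstar \<Lambda>"
  shows "\<exists>C. opbd f C"
proof -
  obtain g where g: "g \<in> cspan" "opbd (\<lambda>a. f a - g a) 1"
    using CstarE[OF assms zero_less_one] .
  obtain C where "opbd g C"
    using opbd_cspan[OF g(1)] by blast
  then show ?thesis
    using opbd_add[OF g(2)] by fastforce
qed

lemma Cstar_asymp_locally_constant: "f \<in> Cstar \<Lambda> \<Longrightarrow> asymp_locally_constant f"
  unfolding Cstar_eq by (rule asymp_locally_constant_norm_closure)

end

section \<open>Convolution and gauge automorphisms\<close>

lemma has_sum_finite_sum:
  fixes h :: "'i \<Rightarrow> 'b \<Rightarrow> complex"
  assumes "finite I" "\<And>i. i \<in> I \<Longrightarrow> (h i has_sum s i) A"
  shows "((\<lambda>c. \<Sum>i\<in>I. h i c) has_sum (\<Sum>i\<in>I. s i)) A"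
  using assms by (induction I rule: finite_induct) (simp_all add: has_sum_add has_sum_0)

lemma has_sum_norm_le:
  fixes h :: "'b \<Rightarrow> complex"
  assumes "(h has_sum s) A" "\<And>H. finite H \<Longrightarrow> H \<subseteq> A \<Longrightarrow> cmod (sum h H) \<le> K"
  shows "cmod s \<le> K"
proof (rule tendsto_upperbound)
  show "((\<lambda>H. cmod (sum h H)) \<longlongrightarrow> cmod s) (finite_subsets_at_top A)"
    using assms(1) unfolding has_sum_def by (rule tendsto_norm)
  show "\<forall>\<^sub>F H in finite_subsets_at_top A. cmod (sum h H) \<le> K"
    using assms(2) by (intro eventually_finite_subsets_at_top_weakI)
qed (rule finite_subsets_at_top_neq_bot)

lemma infsum_single:
  fixes h :: "'b \<Rightarrow> complex"
  assumes "c0 \<in> A" "\<And>c. c \<in> A \<Longrightarrow> c \<noteq> c0 \<Longrightarrow> h c = 0"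
  shows "infsum h A = h c0"
proof -
  have "infsum h A = infsum h {c0}"
    using assms by (intro infsum_cong_neutral) auto
  then show ?thesis by simp
qed

context higher_rank_graph
begin

section \<open>Convolution as matrix multiplication\<close>

lemma bij_betw_quo_right:
  assumes b: "b \<in> fib x"
  shows "bij_betw (\<lambda>c. quo c b) (fib x) (fib (g_rng b))"
proof (rule bij_betwI[where g = "\<lambda>d. g_mult d b"])
  show "(\<lambda>c. quo c b) \<in> fib x \<rightarrow> fib (g_rng b)"
    using quo_in_groupoid[OF _ b] by (auto simp: fib_def)
  show "(\<lambda>d. g_mult d b) \<in> fib (g_rng b) \<rightarrow> fib x"
    using groupoid_mult[of _ b] b by (auto simp: fib_def)
  show "g_mult (quo c b) b = c" if "c \<in> fib x" for c
    using that b by (cases c; cases b) (simp add: fib_def)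
  show "quo (g_mult d b) b = d" if "d \<in> fib (g_rng b)" for d
    using that b by (cases d; cases b) (simp add: fib_def)
qed

lemma quo_quo: "quo (quo a b) (quo c b) = quo a c"
  by (rule garrow_eqI) simp_all

text \<open>Right translation by the inverse of \<open>b\<close> carries the fibre over
  \<open>x\<close> onto the fibre over the range of \<open>b\<close>, where the convolution sum
  runs; after this substitution the sum is an entry of the product of the two matrices.\<close>

lemma conv_quo:
  assumes "a \<in> fib x" "b \<in> fib x"
  shows "conv \<Lambda> f g (quo a b) = (\<Sum>\<^sub>\<infinity>c\<in>fib x. f (quo a c) * g (quo c b))"
proof -
  have "conv \<Lambda> f g (quo a b) = (\<Sum>\<^sub>\<infinity>d\<in>fib (g_rng b). f (quo (quo a b) d) * g d)"
    using conv_fib[OF quo_in_groupoid[OF assms]] by simp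
  also have "\<dots> = (\<Sum>\<^sub>\<infinity>c\<in>fib x. f (quo (quo a b) (quo c b)) * g (quo c b))"
    by (rule infsum_reindex_bij_betw[symmetric, OF bij_betw_quo_right[OF assms(2)]])
  finally show ?thesis
    by (simp add: quo_quo)
qed

text \<open>A row of \<open>f\<close> and a column of \<open>g\<close> are square summable with
  norms at most \<open>C\<close> and \<open>D\<close>, so their product is absolutely
  summable.\<close>

lemma summable_conv:
  assumes f: "opbd f C" and g: "opbd g D" and x: "x \<in> IP" and ab: "a \<in> fib x" "b \<in> fib x"
  shows "(\<lambda>c. f (quo a c) * g (quo c b)) summable_on fib x"
proof (rule abs_summable_summable)
  have "(\<Sum>c\<in>H. cmod (f (quo a c) * g (quo c b))) \<le> C * D" if H: "finite H" "H \<subseteq> fib x" for H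
  proof -
    have "(\<Sum>c\<in>H. cmod (f (quo a c) * g (quo c b)))
        = (\<Sum>c\<in>H. \<bar>cmod (f (quo a c))\<bar> * \<bar>cmod (g (quo c b))\<bar>)"
      by (simp add: norm_mult)
    also have "\<dots> \<le> L2_set (\<lambda>c. cmod (f (quo a c))) H * L2_set (\<lambda>c. cmod (g (quo c b))) H"
      by (rule L2_set_mult_ineq)
    also have "\<dots> \<le> C * D"
      using opbd_row[OF f x H, of "{a}" "\<lambda>_. 1"] opbd_column[OF g x _ _ H, of "{b}" "\<lambda>_. 1"] ab
        opbd_nonneg[OF f]
      by (intro mult_mono) simp_all
    finally show ?thesis .
  qed
  then show "(\<lambda>c. cmod (f (quo a c) * g (quo c b))) summable_on fib x"
    by (intro abs_summable_iff_bdd_above[THEN iffD2] bdd_aboveI[of _ "C * D"]) auto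
qed

lemma unit_in_fib:
  assumes "a \<in> G"
  shows "(g_src a, 0, g_src a) \<in> fib (g_src a)" "quo a (g_src a, 0, g_src a) = a" "g_src a \<in> IP"
    "a \<in> fib (g_src a)"
proof -
  show "g_src a \<in> IP"
    using assms by (cases a) (simp add: groupoid_iff)
  then show "(g_src a, 0, g_src a) \<in> fib (g_src a)"
    by (simp add: fib_def inf_path_unit)
  show "quo a (g_src a, 0, g_src a) = a"
    by (cases a) simp
  show "a \<in> fib (g_src a)"
    using assms by (simp add: fib_def)
qed

lemma conv_outside: "a \<notin> G \<Longrightarrow> conv \<Lambda> f g a = 0"
  by (simp add: conv_def)

lemma conv_add_left:
  assumes f: "opbd f C" "opbd f' C'" and g: "opbd g D"
  shows "conv \<Lambda> (\<lambda>a. f a + f' a) g = (\<lambda>a. conv \<Lambda> f g a + conv \<Lambda> f' g a)"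
proof
  fix a
  show "conv \<Lambda> (\<lambda>a. f a + f' a) g a = conv \<Lambda> f g a + conv \<Lambda> f' g a"
  proof (cases "a \<in> G")
    case True
    note u = unit_in_fib[OF True]
    have "conv \<Lambda> h g a = (\<Sum>\<^sub>\<infinity>c\<in>fib (g_src a). h (quo a c) * g (quo c (g_src a, 0, g_src a)))" for h
      using conv_quo[OF u(4,1), of h g] u(2) by simp
    then show ?thesis
      using infsum_add[OF summable_conv[OF f(1) g u(3,4,1)] summable_conv[OF f(2) g u(3,4,1)]]
      by (simp add: distrib_right)
  qed (simp add: conv_outside)
qed

lemma conv_add_right:
  assumes f: "opbd f C" and g: "opbd g D" "opbd g' D'"
  shows "conv \<Lambda> f (\<lambda>a. g a + g' a) = (\<lambda>a. conv \<Lambda> f g a + conv \<Lambda> f g' a)"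
proof
  fix a
  show "conv \<Lambda> f (\<lambda>a. g a + g' a) a = conv \<Lambda> f g a + conv \<Lambda> f g' a"
  proof (cases "a \<in> G")
    case True
    note u = unit_in_fib[OF True]
    have "conv \<Lambda> f h a = (\<Sum>\<^sub>\<infinity>c\<in>fib (g_src a). f (quo a c) * h (quo c (g_src a, 0, g_src a)))" for h
      using conv_quo[OF u(4,1), of f h] u(2) by simp
    then show ?thesis
      using infsum_add[OF summable_conv[OF f g(1) u(3,4,1)] summable_conv[OF f g(2) u(3,4,1)]]
      by (simp add: distrib_left)
  qed (simp add: conv_outside)
qed

lemma conv_scale_left: "conv \<Lambda> (\<lambda>a. c * f a) g = (\<lambda>a. c * conv \<Lambda> f g a)"
proof
  fix a
  show "conv \<Lambda> (\<lambda>a. c * f a) g a = c * conv \<Lambda> f g a"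
    by (cases "a \<in> G") (simp_all add: conv_outside conv_fib mult.assoc infsum_cmult_right')
qed

lemma conv_scale_right: "conv \<Lambda> f (\<lambda>a. c * g a) = (\<lambda>a. c * conv \<Lambda> f g a)"
proof
  fix a
  show "conv \<Lambda> f (\<lambda>a. c * g a) a = c * conv \<Lambda> f g a"
    by (cases "a \<in> G") (simp_all add: conv_outside conv_fib mult.left_commute infsum_cmult_right')
qed

text \<open>The inner index runs over a possibly infinite fibre. Its partial sums over finite
  \<open>H\<close> pair a row combination of \<open>f\<close> with a column combination of
  \<open>g\<close>; they are bounded independently of \<open>H\<close>, and the bound passes to the
  limit.\<close>

lemma opbd_conv:
  assumes f: "opbd f C" and g: "opbd g D"
  shows "opbd (conv \<Lambda> f g) (C * D)"
proof (rule opbdI)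
  show "0 \<le> C * D" using f g opbd_nonneg by simp
  fix x F and \<xi> \<eta> :: "('m, 'k) garrow \<Rightarrow> complex"
  assume x: "x \<in> IP" and F: "finite F" "F \<subseteq> fib x"
  define h where "h c = (\<Sum>a\<in>F. \<Sum>b\<in>F. f (quo a c) * g (quo c b) * (\<xi> b * \<eta> a))" for c
  have "(h has_sum (\<Sum>a\<in>F. \<Sum>b\<in>F. conv \<Lambda> f g (quo a b) * (\<xi> b * \<eta> a))) (fib x)"
    unfolding h_def
  proof (intro has_sum_finite_sum F(1) has_sum_cmult_left)
    fix a b assume "a \<in> F" "b \<in> F"
    then have ab: "a \<in> fib x" "b \<in> fib x" using F(2) by auto
    show "((\<lambda>c. f (quo a c) * g (quo c b)) has_sum conv \<Lambda> f g (quo a b)) (fib x)"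
      unfolding conv_quo[OF ab] using summable_conv[OF f g x ab] by (rule has_sum_infsum)
  qed
  then have "cmod (\<Sum>a\<in>F. \<Sum>b\<in>F. conv \<Lambda> f g (quo a b) * (\<xi> b * \<eta> a))
      \<le> (C * L2_set (\<lambda>a. cmod (\<eta> a)) F) * (D * L2_set (\<lambda>b. cmod (\<xi> b)) F)"
  proof (rule has_sum_norm_le)
    fix H assume H: "finite H" "H \<subseteq> fib x"
    have "h c = (\<Sum>a\<in>F. f (quo a c) * \<eta> a) * (\<Sum>b\<in>F. g (quo c b) * \<xi> b)" for c
      unfolding h_def sum_product by (simp add: ac_simps)
    then have "cmod (sum h H) = cmod (\<Sum>c\<in>H. (\<Sum>a\<in>F. f (quo a c) * \<eta> a) * (\<Sum>b\<in>F. g (quo c b) * \<xi> b))"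
      by simp
    also have "\<dots> \<le> L2_set (\<lambda>c. cmod (\<Sum>a\<in>F. f (quo a c) * \<eta> a)) H
        * L2_set (\<lambda>c. cmod (\<Sum>b\<in>F. g (quo c b) * \<xi> b)) H"
      by (rule cmod_sum_mult_le_L2_set)
    also have "\<dots> \<le> (C * L2_set (\<lambda>a. cmod (\<eta> a)) F) * (D * L2_set (\<lambda>b. cmod (\<xi> b)) F)"
      using opbd_row[OF f x H F] opbd_column[OF g x F H] opbd_nonneg[OF f]
      by (intro mult_mono) simp_all
    finally show "cmod (sum h H) \<le> (C * L2_set (\<lambda>a. cmod (\<eta> a)) F) * (D * L2_set (\<lambda>b. cmod (\<xi> b)) F)" .
  qed
  then show "cmod (\<Sum>a\<in>F. \<Sum>b\<in>F. conv \<Lambda> f g (quo a b) * \<xi> b * \<eta> a)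
      \<le> C * D * L2_set (\<lambda>b. cmod (\<xi> b)) F * L2_set (\<lambda>a. cmod (\<eta> a)) F"
    by (simp add: ac_simps)
qed

section \<open>Products and adjoints of cylinder indicators\<close>

lemma g_inv_in_cylinder:
  assumes "same_src \<mu> \<nu>"
  shows "g_inv a \<in> Z \<mu> \<nu> \<longleftrightarrow> a \<in> Z \<nu> \<mu>"
proof -
  have s: "same_src \<nu> \<mu>" using assms by (simp add: same_src_def)
  obtain x n y where [simp]: "a = (x, n, y)" by (cases a)
  have "- n = deg_diff (deg \<Lambda> \<mu>) (deg \<Lambda> \<nu>) \<longleftrightarrow> n = deg_diff (deg \<Lambda> \<nu>) (deg \<Lambda> \<mu>)"
    by (metis deg_diff_uminus minus_minus)
  then show ?thesis
    by (auto simp: cylinder_iff'[OF assms] cylinder_iff'[OF s])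
qed

lemma star_indicator:
  assumes "same_src \<mu> \<nu>"
  shows "star \<Lambda> (indicator (Z \<mu> \<nu>)) = indicator (Z \<nu> \<mu>)"
proof
  fix a
  have "same_src \<nu> \<mu>" using assms by (simp add: same_src_def)
  then show "star \<Lambda> (indicator (Z \<mu> \<nu>)) a = indicator (Z \<nu> \<mu>) a"
    using g_inv_in_cylinder[OF assms, of a] cylinder_subset_groupoid[of \<nu> \<mu>]
    by (auto simp: star_def indicator_def)
qed

text \<open>At an arrow of \<open>Z \<mu> \<rho>\<close> exactly one intermediate arrow contributes,
  because source is injective on \<open>Z \<nu> \<rho>\<close>; at any other arrow none does,
  because composites of the two cylinders lie in \<open>Z \<mu> \<rho>\<close>.\<close>

lemma conv_indicator:
  assumes s: "same_src \<mu> \<nu>" "same_src \<nu> \<rho>"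
  shows "conv \<Lambda> (indicator (Z \<mu> \<nu>)) (indicator (Z \<nu> \<rho>)) = indicator (Z \<mu> \<rho>)"
proof
  have s3: "same_src \<mu> \<rho>" using s by (simp add: same_src_def)
  fix a
  show "conv \<Lambda> (indicator (Z \<mu> \<nu>)) (indicator (Z \<nu> \<rho>)) a = indicator (Z \<mu> \<rho>) a"
  proof (cases "a \<in> G")
    case True
    obtain x n y where a: "a = (x, n, y)" by (cases a)
    show ?thesis
    proof (cases "a \<in> Z \<mu> \<rho>")
      case mem: True
      have m: "x \<in> IP" "y \<in> IP" "x (0, deg \<Lambda> \<mu>) = \<mu>" "y (0, deg \<Lambda> \<rho>) = \<rho>"
        "shift (deg \<Lambda> \<mu>) x = shift (deg \<Lambda> \<rho>) y" "n = deg_diff (deg \<Lambda> \<mu>) (deg \<Lambda> \<rho>)"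
        using mem a cylinder_iff'[OF s3] by auto
      have "shift (deg \<Lambda> \<mu>) x (0, 0) = src \<Lambda> \<nu>"
        using prepend_eqI(2)[of \<mu> x, OF _ m(1,3) refl] s by (simp add: same_src_def)
      moreover have "\<nu> \<in> mor \<Lambda>" "shift (deg \<Lambda> \<mu>) x \<in> IP"
        using s m(1) by (simp_all add: same_src_def)
      \<comment> \<open>The intermediate path is \<open>\<nu>\<close> followed by the common tail of
        \<open>x\<close> and \<open>y\<close>.\<close>
      ultimately obtain w where w: "w \<in> IP" "w (0, deg \<Lambda> \<nu>) = \<nu>" "shift (deg \<Lambda> \<nu>) w = shift (deg \<Lambda> \<mu>) x"
        using prepend_exists by blast
      define c0 where "c0 = (w, deg_diff (deg \<Lambda> \<nu>) (deg \<Lambda> \<rho>), y)"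
      have c0: "c0 \<in> Z \<nu> \<rho>"
        using w m by (simp add: c0_def cylinder_iff'[OF s(2)])
      have "deg_diff (deg \<Lambda> \<mu>) (deg \<Lambda> \<rho>) - deg_diff (deg \<Lambda> \<nu>) (deg \<Lambda> \<rho>) = deg_diff (deg \<Lambda> \<mu>) (deg \<Lambda> \<nu>)"
        by (simp add: deg_diff_def vec_eq_iff)
      then have q: "quo a c0 \<in> Z \<mu> \<nu>"
        using w m by (simp add: c0_def a cylinder_iff'[OF s(1)])
      have "conv \<Lambda> (indicator (Z \<mu> \<nu>)) (indicator (Z \<nu> \<rho>)) a
          = indicator (Z \<mu> \<nu>) (quo a c0) * indicator (Z \<nu> \<rho>) c0"
        unfolding conv_fib[OF True]
      proof (rule infsum_single)
        show "c0 \<in> fib (g_src a)"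
          using c0 cylinder_subset_groupoid[OF s(2)] by (auto simp: c0_def fib_def a)
        fix c assume c: "c \<in> fib (g_src a)" "c \<noteq> c0"
        have "c \<notin> Z \<nu> \<rho>"
        proof
          assume "c \<in> Z \<nu> \<rho>"
          moreover have "g_src c = g_src c0"
            using c(1) by (simp add: fib_def c0_def a)
          ultimately show False
            using c0 c(2) bisection_cylinder[OF s(2)] unfolding bisection_def by (meson inj_onD)
        qed
        then show "indicator (Z \<mu> \<nu>) (quo a c) * indicator (Z \<nu> \<rho>) c = (0 :: complex)"
          by simp
      qed
      then show ?thesis
        using c0 q mem by simp
    next
      case nmem: False
      have "indicator (Z \<mu> \<nu>) (quo a c) * indicator (Z \<nu> \<rho>) c = (0 :: complex)"
        if c: "c \<in> fib (g_src a)" for c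
      proof -
        obtain w m y' where c_eq: "c = (w, m, y')" by (cases c)
        have "\<not> (quo a c \<in> Z \<mu> \<nu> \<and> c \<in> Z \<nu> \<rho>)"
        proof
          assume q: "quo a c \<in> Z \<mu> \<nu> \<and> c \<in> Z \<nu> \<rho>"
          have "y' = y" using c by (simp add: c_eq a fib_def)
          then have "(x, n - m, w) \<in> Z \<mu> \<nu>" "(w, m, y) \<in> Z \<nu> \<rho>"
            using q by (simp_all add: c_eq a)
          from this(1)[unfolded cylinder_iff'[OF s(1)]] this(2)[unfolded cylinder_iff'[OF s(2)]]
          have "x \<in> IP \<and> y \<in> IP \<and> x (0, deg \<Lambda> \<mu>) = \<mu> \<and> y (0, deg \<Lambda> \<rho>) = \<rho>
              \<and> shift (deg \<Lambda> \<mu>) x = shift (deg \<Lambda> \<rho>) y"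
            and n: "n - m = deg_diff (deg \<Lambda> \<mu>) (deg \<Lambda> \<nu>)" "m = deg_diff (deg \<Lambda> \<nu>) (deg \<Lambda> \<rho>)"
            by simp_all
          moreover have "n = deg_diff (deg \<Lambda> \<mu>) (deg \<Lambda> \<rho>)"
          proof -
            have "n = deg_diff (deg \<Lambda> \<mu>) (deg \<Lambda> \<nu>) + m"
              using n(1) by (metis diff_add_cancel)
            then show ?thesis
              unfolding n(2) by (simp add: deg_diff_def vec_eq_iff)
          qed
          ultimately show False
            using nmem by (simp add: a cylinder_iff'[OF s3])
        qed
        then show ?thesis by (auto simp: indicator_def)
      qed
      then show ?thesis
        using nmem by (simp add: conv_fib[OF True] infsum_0)
    qed
  next
    case False
    then show ?thesis
      using cylinder_subset_groupoid[OF s3] by (auto simp: conv_outside indicator_def)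
  qed
qed

text \<open>A contributing intermediate path would begin with both \<open>\<nu>\<close> and
  \<open>\<mu>'\<close>, two different heads of the same degree.\<close>

lemma conv_indicator_orthogonal:
  assumes s: "same_src \<mu> \<nu>" "same_src \<mu>' \<nu>'" and ne: "\<nu> \<noteq> \<mu>'" "deg \<Lambda> \<nu> = deg \<Lambda> \<mu>'"
  shows "conv \<Lambda> (indicator (Z \<mu> \<nu>)) (indicator (Z \<mu>' \<nu>')) = (\<lambda>a. 0)"
proof
  fix a
  show "conv \<Lambda> (indicator (Z \<mu> \<nu>)) (indicator (Z \<mu>' \<nu>')) a = 0"
  proof (cases "a \<in> G")
    case True
    have "indicator (Z \<mu> \<nu>) (quo a c) * indicator (Z \<mu>' \<nu>') c = (0 :: complex)" for c
    proof -
      have "\<not> (quo a c \<in> Z \<mu> \<nu> \<and> c \<in> Z \<mu>' \<nu>')"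
        using ne by (cases a; cases c) (auto simp: cylinder_iff'[OF s(1)] cylinder_iff'[OF s(2)])
      then show ?thesis by (auto simp: indicator_def)
    qed
    then show ?thesis
      by (simp add: conv_fib[OF True] infsum_0)
  qed (simp add: conv_outside)
qed

lemma same_src_src: "\<mu> \<in> mor \<Lambda> \<Longrightarrow> same_src \<mu> (src \<Lambda> \<mu>)"
  by (simp add: same_src_def)

lemma conv_gen_star:
  assumes s: "same_src \<mu> \<nu>"
  shows "conv \<Lambda> (gen \<Lambda> \<mu>) (star \<Lambda> (gen \<Lambda> \<nu>)) = indicator (Z \<mu> \<nu>)"
proof -
  have m: "\<mu> \<in> mor \<Lambda>" "\<nu> \<in> mor \<Lambda>" "src \<Lambda> \<nu> = src \<Lambda> \<mu>" and s': "same_src (src \<Lambda> \<mu>) \<nu>"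
    using s by (auto simp: same_src_def)
  have "star \<Lambda> (gen \<Lambda> \<nu>) = indicator (Z (src \<Lambda> \<mu>) \<nu>)"
    using star_indicator[OF same_src_src[OF m(2)]] unfolding gen_def m(3) .
  then show ?thesis
    using conv_indicator[OF same_src_src[OF m(1)] s'] by (simp add: gen_def)
qed

lemma CK_partial_isometries_eq: "CK_partial_isometries \<Lambda> = indicator ` cylinders"
proof (rule set_eqI)
  fix f
  have "f \<in> CK_partial_isometries \<Lambda>
      \<longleftrightarrow> (\<exists>\<mu> \<nu>. f = conv \<Lambda> (gen \<Lambda> \<mu>) (star \<Lambda> (gen \<Lambda> \<nu>)) \<and> same_src \<mu> \<nu>)"
    by (simp add: CK_partial_isometries_def same_src_def)
  also have "\<dots> \<longleftrightarrow> (\<exists>\<mu> \<nu>. f = indicator (Z \<mu> \<nu>) \<and> same_src \<mu> \<nu>)"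
    using conv_gen_star by metis
  also have "\<dots> \<longleftrightarrow> f \<in> indicator ` cylinders"
    unfolding cylinders_def by blast
  finally show "f \<in> CK_partial_isometries \<Lambda> \<longleftrightarrow> f \<in> indicator ` cylinders" .
qed

text \<open>The bound is part of the conclusion since additivity of \<open>conv\<close> requires one
  for the partial sum already treated.\<close>

lemma conv_sum_left:
  assumes "finite I" "\<And>i. i \<in> I \<Longrightarrow> opbd (f i) (C i)" "opbd g D"
  shows "conv \<Lambda> (\<lambda>a. \<Sum>i\<in>I. f i a) g = (\<lambda>a. \<Sum>i\<in>I. conv \<Lambda> (f i) g a)
    \<and> opbd (\<lambda>a. \<Sum>i\<in>I. f i a) (\<Sum>i\<in>I. C i)"
  using assms(1,2)
proof (induction I rule: finite_induct)
  case empty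
  have "conv \<Lambda> (\<lambda>a. 0) g = (\<lambda>a. 0)"
    using conv_scale_left[of 0 "\<lambda>a. 0" g] by simp
  then show ?case by (simp add: opbd_zero)
next
  case (insert i I)
  then show ?case
    using conv_add_left[of "f i" "C i" "\<lambda>a. \<Sum>i\<in>I. f i a" "\<Sum>i\<in>I. C i", OF _ _ assms(3)]
      opbd_add[of "f i" "C i" "\<lambda>a. \<Sum>i\<in>I. f i a" "\<Sum>i\<in>I. C i"]
    by simp
qed

lemma conv_sum_right:
  assumes "finite I" "\<And>i. i \<in> I \<Longrightarrow> opbd (f i) (C i)" "opbd g D"
  shows "conv \<Lambda> g (\<lambda>a. \<Sum>i\<in>I. f i a) = (\<lambda>a. \<Sum>i\<in>I. conv \<Lambda> g (f i) a)
    \<and> opbd (\<lambda>a. \<Sum>i\<in>I. f i a) (\<Sum>i\<in>I. C i)"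
  using assms(1,2)
proof (induction I rule: finite_induct)
  case empty
  have "conv \<Lambda> g (\<lambda>a. 0) = (\<lambda>a. 0)"
    using conv_scale_right[of g 0 "\<lambda>a. 0"] by simp
  then show ?case by (simp add: opbd_zero)
next
  case (insert i I)
  then show ?case
    using conv_add_right[of g D "f i" "C i" "\<lambda>a. \<Sum>i\<in>I. f i a" "\<Sum>i\<in>I. C i", OF assms(3)]
      opbd_add[of "f i" "C i" "\<lambda>a. \<Sum>i\<in>I. f i a" "\<Sum>i\<in>I. C i"]
    by simp
qed

lemma opbd_indicator:
  assumes "C \<in> cylinders"
  shows "opbd (indicator C) 1"
  by (rule opbd_bisection[OF bisection_cylinders[OF assms]]) (auto simp: indicator_def split: if_splits)

lemma partsE:
  assumes "C \<in> parts \<mu> \<nu> j" "same_src \<mu> \<nu>"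
  obtains \<mu>' \<nu>' where "C = Z \<mu>' \<nu>'" "same_src \<mu>' \<nu>'" "deg \<Lambda> \<mu>' = deg \<Lambda> \<mu> + j" "deg \<Lambda> \<nu>' = deg \<Lambda> \<nu> + j"
proof -
  obtain a where a: "a \<in> Z \<mu> \<nu>" "C = cyl_at a (deg \<Lambda> \<mu> + j) (deg \<Lambda> \<nu> + j)"
    using assms(1) by (auto simp: parts_def)
  obtain x n y where [simp]: "a = (x, n, y)" by (cases a)
  have m: "x \<in> IP" "y \<in> IP" "shift (deg \<Lambda> \<mu>) x = shift (deg \<Lambda> \<nu>) y"
    using a(1) cylinder_iff'[OF assms(2)] by auto
  show thesis
  proof (rule that)
    show "C = Z (x (0, deg \<Lambda> \<mu> + j)) (y (0, deg \<Lambda> \<nu> + j))"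
      by (simp add: a(2) cyl_at_def)
    show "same_src (x (0, deg \<Lambda> \<mu> + j)) (y (0, deg \<Lambda> \<nu> + j))"
      using m by (intro same_src_segments shift_eq_add)
  qed (use m in simp_all)
qed

lemma indicator_eq_sum_parts:
  assumes "same_src \<mu> \<nu>"
  shows "indicator (Z \<mu> \<nu>) = (\<lambda>a. \<Sum>C\<in>parts \<mu> \<nu> j. indicator C a :: complex)"
proof
  fix a
  show "indicator (Z \<mu> \<nu>) a = (\<Sum>C\<in>parts \<mu> \<nu> j. indicator C a :: complex)"
    using sum_over_parts[OF assms, where c = "\<lambda>_. 1" and j = j and a = a] by (simp add: indicator_def)
qed

lemma conv_indicator_in_Cstar:
  assumes "C \<in> cylinders" "D \<in> cylinders"
  shows "conv \<Lambda> (indicator C) (indicator D) \<in> Cstar \<Lambda>"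
proof -
  obtain \<mu> \<nu> \<mu>' \<nu>' where C: "C = Z \<mu> \<nu>" "same_src \<mu> \<nu>" and D: "D = Z \<mu>' \<nu>'" "same_src \<mu>' \<nu>'"
    using assms by (auto simp: cylinders_def)
  \<comment> \<open>The levels are crossed so that the source legs in \<open>?P\<close> and the
    range legs in \<open>?Q\<close> both have degree
    \<open>deg \<Lambda> \<nu> + deg \<Lambda> \<mu>'\<close>; each product of parts is then a
    cylinder indicator or 0.\<close>
  let ?P = "parts \<mu> \<nu> (deg \<Lambda> \<mu>')" and ?Q = "parts \<mu>' \<nu>' (deg \<Lambda> \<nu>)"
  have fin: "finite ?P" "finite ?Q" "?P \<subseteq> cylinders" "?Q \<subseteq> cylinders"
    using finite_parts parts_in_cylinders C D by auto
  have PQ: "conv \<Lambda> (indicator C') (indicator D') \<in> Cstar \<Lambda>" if CD: "C' \<in> ?P" "D' \<in> ?Q" for C' D'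
  proof -
    obtain \<alpha> \<beta> where a: "C' = Z \<alpha> \<beta>" "same_src \<alpha> \<beta>" "deg \<Lambda> \<beta> = deg \<Lambda> \<nu> + deg \<Lambda> \<mu>'"
      using partsE[OF CD(1) C(2)] by blast
    obtain \<gamma> \<delta> where b: "D' = Z \<gamma> \<delta>" "same_src \<gamma> \<delta>" "deg \<Lambda> \<gamma> = deg \<Lambda> \<mu>' + deg \<Lambda> \<nu>"
      using partsE[OF CD(2) D(2)] by blast
    show ?thesis
    proof (cases "\<beta> = \<gamma>")
      case True
      then have "same_src \<alpha> \<delta>" using a b by (simp add: same_src_def)
      then have "Z \<alpha> \<delta> \<in> cylinders" by (auto simp: cylinders_def)
      then show ?thesis
        using conv_indicator[of \<alpha> \<beta> \<delta>] a b True cspan_indicator cspan_subset_Cstar by auto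
    next
      case False
      then show ?thesis
        using conv_indicator_orthogonal[OF a(2) b(2)] a b closed_subspaceD(1)[OF closed_subspace_Cstar]
        by (simp add: add.commute)
    qed
  qed
  have "indicator C = (\<lambda>a. \<Sum>C'\<in>?P. indicator C' a :: complex)"
    unfolding C(1) by (rule indicator_eq_sum_parts[OF C(2)])
  moreover have "indicator D = (\<lambda>a. \<Sum>D'\<in>?Q. indicator D' a :: complex)"
    unfolding D(1) by (rule indicator_eq_sum_parts[OF D(2)])
  moreover have "conv \<Lambda> (\<lambda>a. \<Sum>C'\<in>?P. indicator C' a) (indicator D)
      = (\<lambda>a. \<Sum>C'\<in>?P. conv \<Lambda> (indicator C') (indicator D) a)"
    using conv_sum_left[OF fin(1), of indicator "\<lambda>_. 1" "indicator D" 1] opbd_indicator assms(2) fin(3)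
    by blast
  moreover have "conv \<Lambda> (indicator C') (\<lambda>a. \<Sum>D'\<in>?Q. indicator D' a)
      = (\<lambda>a. \<Sum>D'\<in>?Q. conv \<Lambda> (indicator C') (indicator D') a)" if "C' \<in> ?P" for C'
    using conv_sum_right[OF fin(2), of indicator "\<lambda>_. 1" "indicator C'" 1] opbd_indicator that fin(3,4)
    by blast
  ultimately have "conv \<Lambda> (indicator C) (indicator D)
      = (\<lambda>a. \<Sum>C'\<in>?P. \<Sum>D'\<in>?Q. conv \<Lambda> (indicator C') (indicator D') a)"
    by simp
  then show ?thesis
    using PQ by (simp add: closed_subspace_sum[OF closed_subspace_Cstar] fin)
qed

lemma conv_cspan_in_Cstar:
  assumes f: "f \<in> cspan" and g: "g \<in> cspan"
  shows "conv \<Lambda> f g \<in> Cstar \<Lambda>"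
  using f
proof (induction f rule: cspan.induct)
  case zero
  show ?case
    using conv_scale_left[of 0 "\<lambda>a. 0" g] closed_subspaceD(1)[OF closed_subspace_Cstar] by simp
next
  case (step f C c)
  have C: "conv \<Lambda> (indicator C) g \<in> Cstar \<Lambda>"
    using g
  proof (induction g rule: cspan.induct)
    case zero
    show ?case
      using conv_scale_right[of _ 0 "\<lambda>a. 0"] closed_subspaceD(1)[OF closed_subspace_Cstar] by simp
  next
    case (step h D d)
    obtain K where K: "opbd h K" using opbd_cspan[OF step(1)] by blast
    have "conv \<Lambda> (indicator C) (\<lambda>a. h a + d * indicator D a)
        = (\<lambda>a. conv \<Lambda> (indicator C) h a + d * conv \<Lambda> (indicator C) (indicator D) a)"
      using conv_add_right[OF opbd_indicator[OF \<open>C \<in> cylinders\<close>] K opbd_scale[OF opbd_indicator[OF step(2)], of d]]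
      by (simp add: conv_scale_right)
    then show ?case
      using closed_subspaceD(2,3)[OF closed_subspace_Cstar] step.IH
        conv_indicator_in_Cstar[OF \<open>C \<in> cylinders\<close> step(2)] by simp
  qed
  obtain K L where K: "opbd f K" "opbd g L" using opbd_cspan[OF step(1)] opbd_cspan[OF g] by blast
  have "conv \<Lambda> (\<lambda>a. f a + c * indicator C a) g
      = (\<lambda>a. conv \<Lambda> f g a + c * conv \<Lambda> (indicator C) g a)"
    using conv_add_left[OF K(1) opbd_scale[OF opbd_indicator[OF step(2)], of c] K(2)]
    by (simp add: conv_scale_left)
  then show ?case
    using closed_subspaceD(2,3)[OF closed_subspace_Cstar] step.IH C by simp
qed

lemma conv_Cstar:
  assumes f: "f \<in> Cstar \<Lambda>" and g: "g \<in> Cstar \<Lambda>"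
  shows "conv \<Lambda> f g \<in> Cstar \<Lambda>"
proof (rule closed_subspaceD(4)[OF closed_subspace_Cstar norm_closureI])
  fix \<epsilon> :: real assume e: "\<epsilon> > 0"
  obtain D where D: "opbd g D" using opbd_Cstar[OF g] by blast
  have D0: "0 \<le> D" using D by (rule opbd_nonneg)
  \<comment> \<open>\<open>f\<close> is approximated first, relative to the bound \<open>D\<close>
    of \<open>g\<close>; the bound \<open>C\<close> of the approximant then fixes the accuracy
    required for \<open>g\<close>.\<close>
  have e1: "\<epsilon> / (2 * (D + 1)) > 0" using e D0 by simp
  obtain f' where f': "f' \<in> cspan" "opbd (\<lambda>a. f a - f' a) (\<epsilon> / (2 * (D + 1)))"
    using CstarE[OF f e1] .
  obtain C where C: "opbd f' C" using opbd_cspan[OF f'(1)] by blast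
  have C0: "0 \<le> C" using C by (rule opbd_nonneg)
  have e2: "\<epsilon> / (2 * (C + 1)) > 0" using e C0 by simp
  obtain g' where g': "g' \<in> cspan" "opbd (\<lambda>a. g a - g' a) (\<epsilon> / (2 * (C + 1)))"
    using CstarE[OF g e2] .
  obtain D' where D': "opbd g' D'" using opbd_cspan[OF g'(1)] by blast
  have le: "\<epsilon> / (2 * (K + 1)) * K \<le> \<epsilon> / 2" if "0 \<le> K" for K
    using that e by (simp add: field_simps)
  have "opbd (\<lambda>a. conv \<Lambda> f g a - conv \<Lambda> f' g a) (\<epsilon> / 2)"
  proof -
    have "conv \<Lambda> f g = (\<lambda>a. conv \<Lambda> (\<lambda>a. f a - f' a) g a + conv \<Lambda> f' g a)"
      using conv_add_left[OF f'(2) C D] by simp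
    then have "(\<lambda>a. conv \<Lambda> f g a - conv \<Lambda> f' g a) = conv \<Lambda> (\<lambda>a. f a - f' a) g"
      by (simp add: fun_eq_iff)
    then show ?thesis
      using opbd_mono[OF opbd_conv[OF f'(2) D] le[OF D0]] by simp
  qed
  moreover have "opbd (\<lambda>a. conv \<Lambda> f' g a - conv \<Lambda> f' g' a) (\<epsilon> / 2)"
  proof -
    have "conv \<Lambda> f' g = (\<lambda>a. conv \<Lambda> f' (\<lambda>a. g a - g' a) a + conv \<Lambda> f' g' a)"
      using conv_add_right[OF C g'(2) D'] by simp
    then have "(\<lambda>a. conv \<Lambda> f' g a - conv \<Lambda> f' g' a) = conv \<Lambda> f' (\<lambda>a. g a - g' a)"
      by (simp add: fun_eq_iff)
    then show ?thesis
      using opbd_mono[OF opbd_conv[OF C g'(2)]] le[OF C0] by (simp add: mult.commute)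
  qed
  ultimately have "opbd (\<lambda>a. conv \<Lambda> f g a - conv \<Lambda> f' g' a) \<epsilon>"
    using opbd_triangle by fastforce
  then show "\<exists>h\<in>Cstar \<Lambda>. opbd (\<lambda>a. conv \<Lambda> f g a - h a) \<epsilon>"
    using conv_cspan_in_Cstar[OF f'(1) g'(1)] by blast
qed (simp add: conv_outside)

lemma star_cspan: "f \<in> cspan \<Longrightarrow> star \<Lambda> f \<in> cspan"
proof (induction f rule: cspan.induct)
  case zero
  have "star \<Lambda> (\<lambda>a. 0) = (\<lambda>a. 0)" by (simp add: star_def fun_eq_iff)
  then show ?case by (simp add: cspan.zero)
next
  case (step f C c)
  obtain \<mu> \<nu> where C: "C = Z \<mu> \<nu>" "same_src \<mu> \<nu>"
    using step(2) by (auto simp: cylinders_def)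
  then have "same_src \<nu> \<mu>" by (simp add: same_src_def)
  then have D: "Z \<nu> \<mu> \<in> cylinders" by (auto simp: cylinders_def)
  have "star \<Lambda> (\<lambda>a. f a + c * indicator C a) = (\<lambda>a. star \<Lambda> f a + cnj c * star \<Lambda> (indicator C) a)"
    by (simp add: star_def fun_eq_iff)
  then show ?case
    using cspan.step[OF step.IH D, of "cnj c"] star_indicator[OF C(2)] C(1) by simp
qed

lemma star_Cstar:
  assumes f: "f \<in> Cstar \<Lambda>"
  shows "star \<Lambda> f \<in> Cstar \<Lambda>"
  unfolding Cstar_eq
proof (rule norm_closureI)
  fix \<epsilon> :: real assume "\<epsilon> > 0"
  from CstarE[OF f this] obtain g where g: "g \<in> cspan" "opbd (\<lambda>a. f a - g a) \<epsilon>" .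
  have "star \<Lambda> (\<lambda>a. f a - g a) = (\<lambda>a. star \<Lambda> f a - star \<Lambda> g a)"
    by (simp add: star_def fun_eq_iff)
  then show "\<exists>h\<in>cspan. opbd (\<lambda>a. star \<Lambda> f a - h a) \<epsilon>"
    using opbd_star[OF g(2)] by (intro bexI[OF _ star_cspan[OF g(1)]]) simp
qed (simp add: star_def)

text \<open>Only \<open>c = a\<close> makes \<open>quo a c\<close> a unit, so the diagonal acts by
  pointwise multiplication through the range map.\<close>

lemma conv_units_left:
  assumes h: "\<And>a. h a \<noteq> 0 \<Longrightarrow> a \<in> units \<Lambda>" and a: "a \<in> G"
  shows "conv \<Lambda> h f a = h (g_rng a, 0, g_rng a) * f a"
proof -
  have "conv \<Lambda> h f a = h (quo a a) * f a"
    unfolding conv_fib[OF a]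
  proof (rule infsum_single)
    show "a \<in> fib (g_src a)" using a by (simp add: fib_def)
    fix c assume c: "c \<in> fib (g_src a)" "c \<noteq> a"
    have "quo a c \<notin> units \<Lambda>"
      using c by (cases a; cases c) (auto simp: units_def fib_def)
    then have "h (quo a c) = 0" using h by blast
    then show "h (quo a c) * f c = 0" by simp
  qed
  moreover have "quo a a = (g_rng a, 0, g_rng a)"
    by (cases a) simp
  ultimately show ?thesis by simp
qed

lemma conv_units_right:
  assumes h: "\<And>a. h a \<noteq> 0 \<Longrightarrow> a \<in> units \<Lambda>" and a: "a \<in> G"
  shows "conv \<Lambda> f h a = f a * h (g_src a, 0, g_src a)"
proof -
  let ?u = "(g_src a, 0, g_src a)"
  have "conv \<Lambda> f h a = f (quo a ?u) * h ?u"
    unfolding conv_fib[OF a]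
  proof (rule infsum_single)
    show "?u \<in> fib (g_src a)" by (rule unit_in_fib[OF a])
    fix c assume c: "c \<in> fib (g_src a)" "c \<noteq> ?u"
    have "c \<notin> units \<Lambda>"
      using c by (cases c) (auto simp: units_def fib_def)
    then have "h c = 0" using h by blast
    then show "f (quo a c) * h c = 0" by simp
  qed
  then show ?thesis using unit_in_fib(2)[OF a] by simp
qed

lemma unit_in_cylinder_iff:
  "\<kappa> \<in> mor \<Lambda> \<Longrightarrow> x \<in> IP \<Longrightarrow> (x, 0, x) \<in> Z \<kappa> \<kappa> \<longleftrightarrow> x (0, deg \<Lambda> \<kappa>) = \<kappa>"
  by (simp add: cylinder_iff' same_src_def)

lemma indicator_in_diagonal:
  assumes "\<kappa> \<in> mor \<Lambda>"
  shows "indicator (Z \<kappa> \<kappa>) \<in> diagonal \<Lambda>"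
proof -
  have s: "same_src \<kappa> \<kappa>" using assms by (simp add: same_src_def)
  then have "Z \<kappa> \<kappa> \<in> cylinders" by (auto simp: cylinders_def)
  then have "indicator (Z \<kappa> \<kappa>) \<in> Cstar \<Lambda>"
    using cspan_indicator cspan_subset_Cstar by auto
  moreover have "a \<in> units \<Lambda>" if "a \<in> Z \<kappa> \<kappa>" for a
    using that inf_path_eq_shiftI[of "g_rng a" "g_src a" "deg \<Lambda> \<kappa>"]
    by (cases a) (auto simp: cylinder_iff'[OF s] units_def)
  ultimately show ?thesis
    by (auto simp: diagonal_def indicator_def split: if_splits)
qed

section \<open>The gauge action\<close>

definition zpow :: "complex ^ 'k \<Rightarrow> int ^ 'k \<Rightarrow> complex" where
  "zpow t n = (\<Prod>i\<in>UNIV. (t $ i) powi (n $ i))"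

lemma torus_nonzero:
  assumes "t \<in> torus"
  shows "t $ i \<noteq> 0"
proof -
  have "cmod (t $ i) = 1"
    using assms by (simp add: torus_def)
  then show ?thesis by fastforce
qed

lemma zpow_add: "t \<in> torus \<Longrightarrow> zpow t (m + n) = zpow t m * zpow t n"
  by (simp add: zpow_def power_int_add torus_nonzero prod.distrib)

lemma cmod_zpow [simp]: "t \<in> torus \<Longrightarrow> cmod (zpow t n) = 1"
  by (simp add: zpow_def norm_power_int torus_def flip: prod_norm)

lemma zpow_0 [simp]: "zpow t 0 = 1"
  by (simp add: zpow_def)

lemma zpow_uminus: "t \<in> torus \<Longrightarrow> zpow t (- n) * zpow t n = 1"
  using zpow_add[of t "- n" n] by simp

lemma cnj_zpow: "t \<in> torus \<Longrightarrow> cnj (zpow t (- n)) = zpow t n"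
proof -
  assume t: "t \<in> torus"
  have "zpow t (- n) * cnj (zpow t (- n)) = 1"
    using t by (simp add: complex_norm_square[symmetric])
  moreover have "zpow t (- n) \<noteq> 0"
    using zpow_uminus[OF t, of n] by auto
  ultimately show ?thesis
    using zpow_uminus[OF t, of n] by (metis mult_left_cancel)
qed

lemma zpow_deg_diff_0: "zpow t (deg_diff p 0) = tpow t p"
  by (simp add: zpow_def tpow_def deg_diff_def)

definition gauge_fun :: "complex ^ 'k \<Rightarrow> (('m, 'k) garrow \<Rightarrow> complex) \<Rightarrow> ('m, 'k) garrow \<Rightarrow> complex" where
  "gauge_fun t f = (\<lambda>a. zpow t (g_deg a) * f a)"

lemma g_deg_cylinder: "same_src \<mu> \<nu> \<Longrightarrow> a \<in> Z \<mu> \<nu> \<Longrightarrow> g_deg a = deg_diff (deg \<Lambda> \<mu>) (deg \<Lambda> \<nu>)"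
  by (cases a) (simp add: cylinder_iff')

text \<open>In each regular representation this is conjugation by the diagonal unitary with entries
  \<open>zpow t (g_deg a)\<close>.\<close>

lemma opbd_gauge:
  assumes t: "t \<in> torus" and f: "opbd f C"
  shows "opbd (gauge_fun t f) C"
proof (rule opbd_rank_one_multiplier[OF f])
  show "gauge_fun t f (quo a b) = zpow t (g_deg a) * zpow t (- g_deg b) * f (quo a b)" for a b
    using zpow_add[OF t, of "g_deg a" "- g_deg b"] by (simp add: gauge_fun_def)
qed (use t in simp_all)

lemma torus_inverse:
  assumes "t \<in> torus"
  shows "(\<chi> i. inverse (t $ i)) \<in> torus"
    "zpow (\<chi> i. inverse (t $ i)) n * zpow t n = 1"
proof -
  show "(\<chi> i. inverse (t $ i)) \<in> torus"
    using assms by (simp add: torus_def norm_inverse)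
  have "zpow (\<chi> i. inverse (t $ i)) n * zpow t n = (\<Prod>i\<in>UNIV. (inverse (t $ i) * t $ i) powi (n $ i))"
    by (simp add: zpow_def power_int_mult_distrib prod.distrib)
  then show "zpow (\<chi> i. inverse (t $ i)) n * zpow t n = 1"
    using torus_nonzero[OF assms] by simp
qed

lemma gauge_inverse:
  assumes "t \<in> torus"
  shows "gauge_fun (\<chi> i. inverse (t $ i)) (gauge_fun t f) = f" "gauge_fun t (gauge_fun (\<chi> i. inverse (t $ i)) f) = f"
proof -
  have e: "zpow (\<chi> i. inverse (t $ i)) n * (zpow t n * z) = z" for n z
    by (simp only: mult.assoc[symmetric] torus_inverse(2)[OF assms] mult_1_left)
  have e': "zpow t n * (zpow (\<chi> i. inverse (t $ i)) n * z) = z" for n z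
    using e[of n z] by (simp only: mult.left_commute)
  show "gauge_fun (\<chi> i. inverse (t $ i)) (gauge_fun t f) = f" "gauge_fun t (gauge_fun (\<chi> i. inverse (t $ i)) f) = f"
    unfolding gauge_fun_def e e' by simp_all
qed

lemma gauge_indicator:
  "same_src \<mu> \<nu> \<Longrightarrow> gauge_fun t (indicator (Z \<mu> \<nu>)) = (\<lambda>a. zpow t (deg_diff (deg \<Lambda> \<mu>) (deg \<Lambda> \<nu>)) * indicator (Z \<mu> \<nu>) a)"
  using g_deg_cylinder by (auto simp: gauge_fun_def indicator_def fun_eq_iff)

lemma gauge_cspan: "f \<in> cspan \<Longrightarrow> gauge_fun t f \<in> cspan"
proof (induction f rule: cspan.induct)
  case zero
  then show ?case by (simp add: gauge_fun_def cspan.zero)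
next
  case (step f C c)
  obtain \<mu> \<nu> where C: "C = Z \<mu> \<nu>" "same_src \<mu> \<nu>"
    using step(2) by (auto simp: cylinders_def)
  have "gauge_fun t (\<lambda>a. f a + c * indicator C a) = (\<lambda>a. gauge_fun t f a + c * gauge_fun t (indicator C) a)"
    by (simp add: gauge_fun_def algebra_simps)
  then show ?case
    using cspan.step[OF step.IH step(2), of "c * zpow t (deg_diff (deg \<Lambda> \<mu>) (deg \<Lambda> \<nu>))"]
      gauge_indicator[OF C(2)] C(1) by (simp add: mult.assoc)
qed

lemma gauge_diff: "gauge_fun t (\<lambda>a. f a - g a) = (\<lambda>a. gauge_fun t f a - gauge_fun t g a)"
  by (simp add: gauge_fun_def algebra_simps)

lemma gauge_Cstar:
  assumes t: "t \<in> torus" and f: "f \<in> Cstar \<Lambda>"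
  shows "gauge_fun t f \<in> Cstar \<Lambda>"
  unfolding Cstar_eq
proof (rule norm_closureI)
  fix \<epsilon> :: real assume "\<epsilon> > 0"
  from CstarE[OF f this] obtain g where g: "g \<in> cspan" "opbd (\<lambda>a. f a - g a) \<epsilon>" .
  then show "\<exists>h\<in>cspan. opbd (\<lambda>a. gauge_fun t f a - h a) \<epsilon>"
    using opbd_gauge[OF t g(2)] by (intro bexI[OF _ gauge_cspan[OF g(1)]]) (simp add: gauge_diff)
qed (use Cstar_outside[OF f] in \<open>simp add: gauge_fun_def\<close>)

text \<open>The contractive estimate for \<open>t\<close> and for its inverse gives the two
  inequalities; it is vacuous when the norm is infinite.\<close>

lemma red_norm_gauge:
  assumes t: "t \<in> torus"
  shows "red_norm \<Lambda> (gauge_fun t f) = red_norm \<Lambda> f"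
proof -
  have le: "red_norm \<Lambda> (gauge_fun s h) \<le> red_norm \<Lambda> h" if s: "s \<in> torus" for s h
  proof (cases "red_norm \<Lambda> h")
    case (real C)
    then show ?thesis
      using opbd_gauge[OF s, of h C] red_norm_le_iff[of C h] red_norm_le_iff[of C "gauge_fun s h"] by simp
  qed simp
  show ?thesis
    using le[OF t, of f] le[OF torus_inverse(1)[OF t], of "gauge_fun t f"] gauge_inverse(1)[OF t, of f]
    by simp
qed

lemma gauge_conv:
  assumes t: "t \<in> torus"
  shows "gauge_fun t (conv \<Lambda> f g) = conv \<Lambda> (gauge_fun t f) (gauge_fun t g)"
proof
  fix a
  show "gauge_fun t (conv \<Lambda> f g) a = conv \<Lambda> (gauge_fun t f) (gauge_fun t g) a"
  proof (cases "a \<in> G")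
    case True
    have z: "zpow t (g_deg a) = zpow t (g_deg a - g_deg c) * zpow t (g_deg c)" for c
      using zpow_add[OF t, of "g_deg a - g_deg c" "g_deg c"] by simp
    have "gauge_fun t f (quo a c) * gauge_fun t g c = zpow t (g_deg a) * (f (quo a c) * g c)" for c
      unfolding z[of c] gauge_fun_def by (simp add: ac_simps)
    then have "conv \<Lambda> (gauge_fun t f) (gauge_fun t g) a
        = zpow t (g_deg a) * (\<Sum>\<^sub>\<infinity>c\<in>fib (g_src a). f (quo a c) * g c)"
      unfolding conv_fib[OF True] by (simp only: infsum_cmult_right')
    then show ?thesis
      by (simp add: conv_fib[OF True] gauge_fun_def)
  qed (simp add: conv_outside gauge_fun_def)
qed

lemma g_deg_inv [simp]: "g_deg (g_inv a) = - g_deg a"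
  by (cases a) simp

lemma gauge_star:
  assumes t: "t \<in> torus"
  shows "gauge_fun t (star \<Lambda> f) = star \<Lambda> (gauge_fun t f)"
  using cnj_zpow[OF t] by (simp add: gauge_fun_def star_def fun_eq_iff)

lemma gen_in_Cstar: "\<mu> \<in> mor \<Lambda> \<Longrightarrow> gen \<Lambda> \<mu> \<in> Cstar \<Lambda>"
  using cspan_indicator[of "Z \<mu> (src \<Lambda> \<mu>)"] cspan_subset_Cstar same_src_src[of \<mu>]
  by (auto simp: gen_def cylinders_def)

lemma automorphism_gauge:
  assumes t: "t \<in> torus"
  shows "automorphism \<Lambda> (restrict (gauge_fun t) (Cstar \<Lambda>))"
proof -
  let ?s = "\<chi> i. inverse (t $ i)"
  note sub = closed_subspaceD(2,3)[OF closed_subspace_Cstar]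
  have "bij_betw (restrict (gauge_fun t) (Cstar \<Lambda>)) (Cstar \<Lambda>) (Cstar \<Lambda>)"
    by (rule bij_betwI[where g = "gauge_fun ?s"])
      (use gauge_Cstar[OF t] gauge_Cstar[OF torus_inverse(1)[OF t]] gauge_inverse[OF t] in auto)
  moreover have "gauge_fun t (\<lambda>a. f a + g a) = (\<lambda>a. gauge_fun t f a + gauge_fun t g a)" for f g
    by (simp add: gauge_fun_def algebra_simps)
  moreover have "gauge_fun t (\<lambda>a. c * f a) = (\<lambda>a. c * gauge_fun t f a)" for c f
    by (simp add: gauge_fun_def algebra_simps)
  ultimately show ?thesis
    unfolding automorphism_def
    using sub conv_Cstar star_Cstar gauge_conv[OF t] gauge_star[OF t] red_norm_gauge[OF t] by simp
qed

lemma gauge_gen: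
  assumes "\<mu> \<in> mor \<Lambda>"
  shows "gauge_fun t (gen \<Lambda> \<mu>) = (\<lambda>a. tpow t (deg \<Lambda> \<mu>) * gen \<Lambda> \<mu> a)"
  using gauge_indicator[OF same_src_src[OF assms], of t] assms
  by (simp add: gen_def zpow_deg_diff_0)

section \<open>Uniqueness of the gauge automorphisms\<close>

lemma automorphismD:
  assumes "automorphism \<Lambda> \<phi>" "f \<in> Cstar \<Lambda>"
  shows "\<phi> f \<in> Cstar \<Lambda>" "g \<in> Cstar \<Lambda> \<Longrightarrow> \<phi> (\<lambda>a. f a + g a) = (\<lambda>a. \<phi> f a + \<phi> g a)"
    "\<phi> (\<lambda>a. c * f a) = (\<lambda>a. c * \<phi> f a)"
    "g \<in> Cstar \<Lambda> \<Longrightarrow> \<phi> (conv \<Lambda> f g) = conv \<Lambda> (\<phi> f) (\<phi> g)"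
    "\<phi> (star \<Lambda> f) = star \<Lambda> (\<phi> f)" "red_norm \<Lambda> (\<phi> f) = red_norm \<Lambda> f"
  using assms unfolding automorphism_def by (auto dest: bij_betwE)

lemma automorphism_diff:
  assumes \<phi>: "automorphism \<Lambda> \<phi>" and f: "f \<in> Cstar \<Lambda>" "g \<in> Cstar \<Lambda>"
  shows "\<phi> (\<lambda>a. f a - g a) = (\<lambda>a. \<phi> f a - \<phi> g a)"
proof -
  have "(\<lambda>a. -1 * g a) \<in> Cstar \<Lambda>"
    by (rule closed_subspaceD(3)[OF closed_subspace_Cstar f(2)])
  then have "\<phi> (\<lambda>a. f a + -1 * g a) = (\<lambda>a. \<phi> f a + \<phi> (\<lambda>a. -1 * g a) a)"
    by (rule automorphismD(2)[OF \<phi> f(1)])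
  moreover have "\<phi> (\<lambda>a. -1 * g a) = (\<lambda>a. -1 * \<phi> g a)"
    by (rule automorphismD(3)[OF \<phi> f(2)])
  ultimately show ?thesis by simp
qed

text \<open>The indicator of \<open>Z \<mu> \<nu>\<close> is the convolution of
  \<open>gen \<Lambda> \<mu>\<close> with the adjoint of \<open>gen \<Lambda> \<nu>\<close>, so an
  automorphism is determined on it by its values on the generators.\<close>

lemma automorphism_eq_on_cspan:
  assumes \<phi>: "automorphism \<Lambda> \<phi>" and \<psi>: "automorphism \<Lambda> \<psi>"
    and eq: "\<And>\<mu>. \<mu> \<in> mor \<Lambda> \<Longrightarrow> \<phi> (gen \<Lambda> \<mu>) = \<psi> (gen \<Lambda> \<mu>)" and g: "g \<in> cspan"
  shows "\<phi> g = \<psi> g"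
  using g
proof (induction g rule: cspan.induct)
  case zero
  have z: "\<theta> (\<lambda>a. 0) = (\<lambda>a. 0)" if "automorphism \<Lambda> \<theta>" for \<theta>
    using automorphism_diff[OF that, of "\<lambda>a. 0" "\<lambda>a. 0"] closed_subspaceD(1)[OF closed_subspace_Cstar] by simp
  show ?case using z[OF \<phi>] z[OF \<psi>] by simp
next
  case (step g C c)
  obtain \<mu> \<nu> where C: "C = Z \<mu> \<nu>" "same_src \<mu> \<nu>"
    using step(2) by (auto simp: cylinders_def)
  then have m: "gen \<Lambda> \<mu> \<in> Cstar \<Lambda>" "gen \<Lambda> \<nu> \<in> Cstar \<Lambda>" "\<mu> \<in> mor \<Lambda>" "\<nu> \<in> mor \<Lambda>"
    using gen_in_Cstar by (auto simp: same_src_def)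
  have ind: "\<theta> (indicator C) = conv \<Lambda> (\<theta> (gen \<Lambda> \<mu>)) (star \<Lambda> (\<theta> (gen \<Lambda> \<nu>)))" if "automorphism \<Lambda> \<theta>" for \<theta>
    using automorphismD(4)[OF that m(1) star_Cstar[OF m(2)]] automorphismD(5)[OF that m(2)]
      conv_gen_star[OF C(2)] C(1) by simp
  have iC: "indicator C \<in> Cstar \<Lambda>" "g \<in> Cstar \<Lambda>"
    using step(1,2) cspan_indicator cspan_subset_Cstar by auto
  have lin: "\<theta> (\<lambda>a. g a + c * indicator C a) = (\<lambda>a. \<theta> g a + c * \<theta> (indicator C) a)" if "automorphism \<Lambda> \<theta>" for \<theta>
  proof -
    have "(\<lambda>a. c * indicator C a) \<in> Cstar \<Lambda>"
      by (rule closed_subspaceD(3)[OF closed_subspace_Cstar iC(1)])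
    then have "\<theta> (\<lambda>a. g a + c * indicator C a) = (\<lambda>a. \<theta> g a + \<theta> (\<lambda>a. c * indicator C a) a)"
      by (rule automorphismD(2)[OF that iC(2)])
    moreover have "\<theta> (\<lambda>a. c * indicator C a) = (\<lambda>a. c * \<theta> (indicator C) a)"
      by (rule automorphismD(3)[OF that iC(1)])
    ultimately show ?thesis by simp
  qed
  show ?case
    unfolding lin[OF \<phi>] lin[OF \<psi>] ind[OF \<phi>] ind[OF \<psi>] step.IH eq[OF m(3)] eq[OF m(4)] ..
qed

lemma opbd_automorphism:
  assumes \<phi>: "automorphism \<Lambda> \<phi>" and f: "f \<in> Cstar \<Lambda>" "opbd f C"
  shows "opbd (\<phi> f) C"
proof -
  have "red_norm \<Lambda> (\<phi> f) = red_norm \<Lambda> f"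
    by (rule automorphismD(6)[OF \<phi> f(1)])
  then show ?thesis
    using f(2) red_norm_le_iff[OF opbd_nonneg[OF f(2)]] by metis
qed

text \<open>Automorphisms preserve the norm, so agreement on \<open>cspan\<close> extends to limits,
  and the norm controls point values. This is what evaluates the definite description in
  \<open>gauge_aut\<close>.\<close>

lemma automorphism_unique:
  assumes \<phi>: "automorphism \<Lambda> \<phi>" "\<phi> \<in> extensional (Cstar \<Lambda>)"
    and \<psi>: "automorphism \<Lambda> \<psi>" "\<psi> \<in> extensional (Cstar \<Lambda>)"
    and eq: "\<And>\<mu>. \<mu> \<in> mor \<Lambda> \<Longrightarrow> \<phi> (gen \<Lambda> \<mu>) = \<psi> (gen \<Lambda> \<mu>)"
  shows "\<phi> = \<psi>"
proof (rule extensionalityI[OF \<phi>(2) \<psi>(2)])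
  fix f assume f: "f \<in> Cstar \<Lambda>"
  then have fs: "\<phi> f \<in> Cstar \<Lambda>" "\<psi> f \<in> Cstar \<Lambda>"
    using automorphismD(1) \<phi>(1) \<psi>(1) by auto
  show "\<phi> f = \<psi> f"
  proof
    fix a
    show "\<phi> f a = \<psi> f a"
    proof (cases "a \<in> G")
      case True
      have "cmod (\<phi> f a - \<psi> f a) \<le> 0 + \<epsilon>" if "\<epsilon> > 0" for \<epsilon>
      proof -
        have e2: "\<epsilon> / 2 > 0" using that by simp
        obtain g where g: "g \<in> cspan" "opbd (\<lambda>a. f a - g a) (\<epsilon> / 2)"
          using CstarE[OF f e2] .
        have gC: "g \<in> Cstar \<Lambda>" using g(1) cspan_subset_Cstar by blast
        have "(\<lambda>a. f a - g a) \<in> Cstar \<Lambda>"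
          by (rule closed_subspace_diff[OF closed_subspace_Cstar f gC])
        then have d: "opbd (\<lambda>a. \<phi> f a - \<phi> g a) (\<epsilon> / 2)" "opbd (\<lambda>a. \<psi> f a - \<psi> g a) (\<epsilon> / 2)"
          using opbd_automorphism[OF \<phi>(1) _ g(2)] opbd_automorphism[OF \<psi>(1) _ g(2)]
            automorphism_diff[OF \<phi>(1) f gC] automorphism_diff[OF \<psi>(1) f gC] by simp_all
        have "\<phi> g = \<psi> g"
          using automorphism_eq_on_cspan[OF \<phi>(1) \<psi>(1) eq g(1)] by blast
        then have "opbd (\<lambda>a. \<phi> g a - \<psi> f a) (\<epsilon> / 2)"
          using d(2) opbd_diff_commute[of "\<psi> f" "\<psi> g"] by simp
        from cmod_le_opbd[OF opbd_triangle[OF d(1) this] True] show ?thesis by simp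
      qed
      then have "cmod (\<phi> f a - \<psi> f a) \<le> 0" by (rule field_le_epsilon)
      then show ?thesis by simp
    qed (simp add: Cstar_outside[OF fs(1)] Cstar_outside[OF fs(2)])
  qed
qed

lemma gauge_aut_eq:
  assumes t: "t \<in> torus"
  shows "gauge_aut \<Lambda> t = restrict (gauge_fun t) (Cstar \<Lambda>)"
  unfolding gauge_aut_def
proof (rule the_equality)
  show *: "restrict (gauge_fun t) (Cstar \<Lambda>) \<in> extensional (Cstar \<Lambda>)
      \<and> automorphism \<Lambda> (restrict (gauge_fun t) (Cstar \<Lambda>))
      \<and> (\<forall>\<mu>\<in>mor \<Lambda>. restrict (gauge_fun t) (Cstar \<Lambda>) (gen \<Lambda> \<mu>) = (\<lambda>a. tpow t (deg \<Lambda> \<mu>) * gen \<Lambda> \<mu> a))"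
    using automorphism_gauge[OF t] gauge_gen gen_in_Cstar by simp
  fix \<phi> assume "\<phi> \<in> extensional (Cstar \<Lambda>) \<and> automorphism \<Lambda> \<phi>
      \<and> (\<forall>\<mu>\<in>mor \<Lambda>. \<phi> (gen \<Lambda> \<mu>) = (\<lambda>a. tpow t (deg \<Lambda> \<mu>) * gen \<Lambda> \<mu> a))"
  then show "\<phi> = restrict (gauge_fun t) (Cstar \<Lambda>)"
    using * by (intro automorphism_unique) auto
qed

end

section \<open>Bimodules\<close>

lemma sum_roots_of_unity:
  fixes k :: int
  assumes N: "N > 0"
  shows "(\<Sum>l<N. cis (of_nat l * (2 * pi * of_int k / of_nat N))) = (if k mod int N = 0 then of_nat N else 0)"
proof -
  define z where "z = cis (2 * pi * of_int k / of_nat N)"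
  have sum: "(\<Sum>l<N. cis (of_nat l * (2 * pi * of_int k / of_nat N))) = (\<Sum>l<N. z ^ l)"
    by (intro sum.cong refl) (simp only: z_def Complex.DeMoivre)
  have zN: "z ^ N = 1"
  proof -
    have "z ^ N = cis (2 * pi * of_int k)"
      unfolding z_def Complex.DeMoivre using N by simp
    then show ?thesis by simp
  qed
  show ?thesis
  proof (cases "k mod int N = 0")
    case True
    then obtain q where q: "k = int N * q" by (metis dvdE mod_eq_0_iff_dvd)
    have "2 * pi * of_int k / of_nat N = 2 * pi * of_int q"
      using N by (simp add: q)
    then have "z = 1" by (simp add: z_def)
    then show ?thesis
      using True sum by simp
  next
    case False
    have "z \<noteq> 1"
    proof
      assume "z = 1"
      then have "cos (2 * pi * of_int k / of_nat N) = 1"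
        by (simp add: z_def complex_eq_iff)
      then obtain q :: int where "2 * pi * of_int k / of_nat N = of_int q * 2 * pi"
        using cos_one_2pi_int by blast
      then have "real_of_int k = real_of_int (q * int N)"
        using N by (simp add: field_simps)
      then have "k = q * int N"
        by (simp only: of_int_eq_iff)
      then show False using False by simp
    qed
    then show ?thesis
      using False sum zN by (simp add: sum_gp_strict)
  qed
qed

lemma finite_int_box: "finite {m :: int ^ 'k::finite. \<forall>i. m $ i \<in> {-N..N}}"
proof -
  have "{m :: int ^ 'k. \<forall>i. m $ i \<in> {-N..N}} \<subseteq> vec_lambda ` (UNIV \<rightarrow>\<^sub>E {-N..N})"
  proof
    fix m :: "int ^ 'k" assume "m \<in> {m. \<forall>i. m $ i \<in> {-N..N}}"
    then have "(($) m) \<in> UNIV \<rightarrow>\<^sub>E {-N..N}" by auto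
    moreover have "m = vec_lambda (($) m)" by simp
    ultimately show "m \<in> vec_lambda ` (UNIV \<rightarrow>\<^sub>E {-N..N})" by blast
  qed
  moreover have "finite ((UNIV :: 'k set) \<rightarrow>\<^sub>E {-N..N})"
    by (intro finite_PiE) auto
  ultimately show ?thesis
    by (meson finite_imageI finite_subset)
qed

context higher_rank_graph
begin

lemma fejer_tendsto_1: "(\<lambda>N. fejer N n) \<longlonglongrightarrow> 1"
proof -
  have "(\<lambda>N. max 0 (1 - \<bar>of_int n\<bar> / real N)) \<longlonglongrightarrow> max 0 (1 - 0)"
    by (intro tendsto_max tendsto_const tendsto_diff lim_const_over_n)
  then show ?thesis by (simp add: fejer_def)
qed

section \<open>Compression by projections and averaging\<close>

lemma bimodule_closed_subspace: "bimodule \<Lambda> B \<Longrightarrow> closed_subspace B"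
  by (simp add: bimodule_def closed_subspace_def)

text \<open>Convolution with the projections \<open>indicator (Z \<kappa> \<kappa>)\<close> on the
  left and \<open>indicator (Z \<kappa>' \<kappa>')\<close> on the right multiplies \<open>f\<close>
  by indicators of conditions on range and source. Degree and tails remain free.\<close>

lemma bimodule_restrict_corner:
  assumes B: "bimodule \<Lambda> B" and f: "f \<in> B" and \<kappa>: "\<kappa> \<in> mor \<Lambda>" "\<kappa>' \<in> mor \<Lambda>"
  shows "(\<lambda>a. f a * indicator {a. g_rng a (0, deg \<Lambda> \<kappa>) = \<kappa> \<and> g_src a (0, deg \<Lambda> \<kappa>') = \<kappa>'} a) \<in> B"
proof -
  let ?h = "indicator (Z \<kappa> \<kappa>) :: _ \<Rightarrow> complex" and ?h' = "indicator (Z \<kappa>' \<kappa>') :: _ \<Rightarrow> complex"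
  have h: "?h \<in> diagonal \<Lambda>" "?h' \<in> diagonal \<Lambda>"
    using indicator_in_diagonal \<kappa> by auto
  then have hu: "?h a \<noteq> 0 \<Longrightarrow> a \<in> units \<Lambda>" "?h' a \<noteq> 0 \<Longrightarrow> a \<in> units \<Lambda>" for a
    unfolding diagonal_def by blast+
  have mem: "conv \<Lambda> ?h (conv \<Lambda> f ?h') \<in> B"
    using B f h unfolding bimodule_def by blast
  have eq: "conv \<Lambda> ?h (conv \<Lambda> f ?h') a
      = f a * indicator {a. g_rng a (0, deg \<Lambda> \<kappa>) = \<kappa> \<and> g_src a (0, deg \<Lambda> \<kappa>') = \<kappa>'} a" for a
  proof (cases "a \<in> G")
    case True
    then have IP: "g_rng a \<in> IP" "g_src a \<in> IP"
      by (cases a; simp add: groupoid_iff)+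
    have "conv \<Lambda> ?h (conv \<Lambda> f ?h') a = ?h (g_rng a, 0, g_rng a) * conv \<Lambda> f ?h' a"
      by (rule conv_units_left[OF _ True]) (rule hu(1))
    also have "conv \<Lambda> f ?h' a = f a * ?h' (g_src a, 0, g_src a)"
      by (rule conv_units_right[OF _ True]) (rule hu(2))
    finally show ?thesis
      using unit_in_cylinder_iff[OF \<kappa>(1) IP(1)] unit_in_cylinder_iff[OF \<kappa>(2) IP(2)]
      by (auto split: split_indicator)
  next
    case False
    then have "f a = 0"
      using B f Cstar_outside unfolding bimodule_def by blast
    then show ?thesis using False by (simp add: conv_outside)
  qed
  have "conv \<Lambda> ?h (conv \<Lambda> f ?h')
      = (\<lambda>a. f a * indicator {a. g_rng a (0, deg \<Lambda> \<kappa>) = \<kappa> \<and> g_src a (0, deg \<Lambda> \<kappa>') = \<kappa>'} a)"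
    by (rule ext) (rule eq)
  then show ?thesis using mem by (simp only:)
qed

definition gauge_invariant :: "(('m, 'k) garrow \<Rightarrow> complex) set \<Rightarrow> bool" where
  "gauge_invariant B \<longleftrightarrow> (\<forall>t\<in>torus. \<forall>f\<in>B. gauge_fun t f \<in> B)"

text \<open>
  Averaging over the \<open>N\<close>-th roots of unity in one coordinate keeps the degrees in a residue class
  modulo \<open>N\<close>; finite averages take the place of integration over the torus.
\<close>

lemma gauge_invariant_residue:
  assumes V: "closed_subspace B" and inv: "gauge_invariant B" and f: "f \<in> B" and N: "N > 0"
  shows "(\<lambda>a. f a * of_bool ((g_deg a $ i - r) mod int N = 0)) \<in> B"
proof -
  \<comment> \<open>\<open>t l\<close> moves only the coordinate \<open>i\<close>, by the
    \<open>l\<close>-th power of the basic \<open>N\<close>-th root of unity.\<close>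
  define t where "t l = (\<chi> i'. if i' = i then cis (of_nat l * (2 * pi / of_nat N)) else (1 :: complex))" for l :: nat
  have t: "t l \<in> torus" for l
    by (simp add: t_def torus_def)
  have zt: "zpow (t l) n = cis (of_int (n $ i) * (of_nat l * (2 * pi / of_nat N)))" for l n
  proof -
    have "zpow (t l) n = (\<Prod>i'\<in>UNIV. if i' = i then cis (of_nat l * (2 * pi / of_nat N)) powi (n $ i) else 1)"
      unfolding zpow_def by (intro prod.cong) (auto simp: t_def)
    then show ?thesis
      by (simp add: cis_power_int)
  qed
  \<comment> \<open>The coefficients are those of the finite Fourier transform at \<open>r\<close>,
    so that the average picks out the degrees congruent to \<open>r\<close>.\<close>
  define c where "c l = cis (of_nat l * (2 * pi * of_int (- r) / of_nat N)) / of_nat N" for l :: nat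
  have "(\<lambda>a. \<Sum>l<N. c l * gauge_fun (t l) f a) \<in> B"
    using inv f t unfolding gauge_invariant_def
    by (intro closed_subspace_sum[OF V] closed_subspaceD(3)[OF V]) auto
  moreover have "(\<Sum>l<N. c l * gauge_fun (t l) f a) = f a * of_bool ((g_deg a $ i - r) mod int N = 0)" for a
  proof -
    have "c l * zpow (t l) (g_deg a) = cis (of_nat l * (2 * pi * of_int (g_deg a $ i - r) / of_nat N)) / of_nat N" for l
    proof -
      have "of_nat l * (2 * pi * of_int (- r) / of_nat N) + of_int (g_deg a $ i) * (of_nat l * (2 * pi / of_nat N))
          = of_nat l * (2 * pi * of_int (g_deg a $ i - r) / of_nat N)"
        by (simp add: algebra_simps diff_divide_distrib)
      then show ?thesis
        unfolding c_def zt times_divide_eq_left cis_mult by simp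
    qed
    then have "(\<Sum>l<N. c l * gauge_fun (t l) f a)
        = (\<Sum>l<N. f a * (cis (of_nat l * (2 * pi * of_int (g_deg a $ i - r) / of_nat N)) / of_nat N))"
      unfolding gauge_fun_def by (intro sum.cong refl) (simp only: mult.assoc[symmetric] mult.commute[of "f a"])
    also have "\<dots> = f a * ((\<Sum>l<N. cis (of_nat l * (2 * pi * of_int (g_deg a $ i - r) / of_nat N))) / of_nat N)"
      by (simp only: sum_distrib_left sum_divide_distrib)
    also have "\<dots> = f a * of_bool ((g_deg a $ i - r) mod int N = 0)"
      unfolding sum_roots_of_unity[OF N] using N by simp
    finally show ?thesis .
  qed
  ultimately show ?thesis by simp
qed

lemma gauge_invariant_residues:
  assumes V: "closed_subspace B" and inv: "gauge_invariant B" and f: "f \<in> B" and N: "N > 0"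
  shows "(\<lambda>a. f a * of_bool (\<forall>i. (g_deg a $ i - m $ i) mod int N = 0)) \<in> B"
proof -
  have "(\<lambda>a. f a * of_bool (\<forall>i\<in>I. (g_deg a $ i - m $ i) mod int N = 0)) \<in> B" if "finite I" for I
    using that
  proof (induction I rule: finite_induct)
    case empty
    then show ?case using f by simp
  next
    case (insert i I)
    have "(\<lambda>a. f a * of_bool (\<forall>i\<in>insert i I. (g_deg a $ i - m $ i) mod int N = 0))
        = (\<lambda>a. f a * of_bool (\<forall>i\<in>I. (g_deg a $ i - m $ i) mod int N = 0) * of_bool ((g_deg a $ i - m $ i) mod int N = 0))"
      by (intro ext) auto
    then show ?case
      using gauge_invariant_residue[OF V inv insert.IH N, of i "m $ i"] by simp
  qed
  from this[of UNIV] show ?thesis by simp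
qed

section \<open>Truncation to a single cylinder\<close>

lemma cylinder_degree_shift:
  assumes "deg_diff p q = deg_diff p' q'" "p \<le> p'"
  obtains k where "p' = p + k" "q' = q + k"
proof -
  have "p + q' = p' + q" using assms(1) by (simp add: deg_diff_eq_iff)
  moreover have "p' = p + (p' - p)" using assms(2) by simp
  ultimately have "q' = q + (p' - p)"
    using nat_vec_exchange[of p' 0 p "p' - p" q q'] by simp
  then show thesis
    by (intro that[of "p' - p"]) (simp_all add: assms(2))
qed

lemma opbd_restrict_bisection:
  assumes f: "opbd f \<epsilon>" and s: "same_src \<mu> \<nu>"
  shows "opbd (\<lambda>a. f a * indicator (Z \<mu> \<nu>) a) \<epsilon>"
proof (rule opbd_bisection[OF bisection_cylinder[OF s]])
  show "cmod (f a * indicator (Z \<mu> \<nu>) a) \<le> \<epsilon>" if "a \<in> Z \<mu> \<nu>" for a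
    using that cmod_le_opbd[OF f, of a] cylinder_subset_groupoid[OF s] by auto
qed (use opbd_nonneg[OF f] in \<open>auto simp: indicator_def split: if_splits\<close>)

lemma groupoid_ends: "a \<in> G \<Longrightarrow> g_rng a \<in> IP" "a \<in> G \<Longrightarrow> g_src a \<in> IP"
  by (cases a; simp add: groupoid_iff)+

lemma in_cylinder_iff:
  assumes "same_src \<mu> \<nu>"
  shows "a \<in> Z \<mu> \<nu> \<longleftrightarrow> g_rng a \<in> IP \<and> g_src a \<in> IP \<and> g_rng a (0, deg \<Lambda> \<mu>) = \<mu>
    \<and> g_src a (0, deg \<Lambda> \<nu>) = \<nu> \<and> shift (deg \<Lambda> \<mu>) (g_rng a) = shift (deg \<Lambda> \<nu>) (g_src a)
    \<and> g_deg a = deg_diff (deg \<Lambda> \<mu>) (deg \<Lambda> \<nu>)"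
  by (cases a) (simp add: cylinder_iff'[OF assms])

text \<open>The weakening of \<open>Z \<mu> \<nu>\<close> in which the degree is tested only modulo
  \<open>N\<close> and the equality of tails only for \<open>j\<close> steps; averaging and
  compression can impose these conditions exactly.\<close>

definition corner_block :: "nat \<Rightarrow> nat ^ 'k \<Rightarrow> 'm \<Rightarrow> 'm \<Rightarrow> ('m, 'k) garrow set" where
  "corner_block N j \<mu> \<nu> = {a. (\<forall>i. (g_deg a $ i - deg_diff (deg \<Lambda> \<mu>) (deg \<Lambda> \<nu>) $ i) mod int N = 0)
     \<and> g_rng a (0, deg \<Lambda> \<mu>) = \<mu> \<and> g_src a (0, deg \<Lambda> \<nu>) = \<nu>
     \<and> g_rng a (deg \<Lambda> \<mu>, deg \<Lambda> \<mu> + j) = g_src a (deg \<Lambda> \<nu>, deg \<Lambda> \<nu> + j)}"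

text \<open>The \<open>j\<close> steps after the heads range over finitely many paths
  \<open>\<alpha>\<close>. Requiring them to agree on both sides amounts to summing the corners of
  the pairs \<open>\<mu> \<cdot> \<alpha>\<close>, \<open>\<nu> \<cdot> \<alpha>\<close>.\<close>

lemma bimodule_restrict_corner_block:
  assumes B: "bimodule \<Lambda> B" and inv: "gauge_invariant B" and f: "f \<in> B" and N: "N > 0"
    and s: "same_src \<mu> \<nu>"
  shows "(\<lambda>a. f a * indicator (corner_block N j \<mu> \<nu>) a) \<in> B"
proof -
  note V = bimodule_closed_subspace[OF B]
  define m where "m = deg_diff (deg \<Lambda> \<mu>) (deg \<Lambda> \<nu>)"
  define h where "h = (\<lambda>a. f a * of_bool (\<forall>i. (g_deg a $ i - m $ i) mod int N = 0))"
  have h: "h \<in> B"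
    unfolding h_def by (rule gauge_invariant_residues[OF V inv f N])
  let ?A = "paths_to \<Lambda> j (src \<Lambda> \<mu>)"
  have mn: "\<mu> \<in> mor \<Lambda>" "\<nu> \<in> mor \<Lambda>" "src \<Lambda> \<nu> = src \<Lambda> \<mu>"
    using s by (auto simp: same_src_def)
  have A: "finite ?A"
    by (rule finite_paths_to_src[OF mn(1)])
  have \<alpha>: "\<alpha> \<in> mor \<Lambda>" "deg \<Lambda> \<alpha> = j" "rng \<Lambda> \<alpha> = src \<Lambda> \<mu>" if "\<alpha> \<in> ?A" for \<alpha>
    using that by (auto simp: paths_to_def)
  let ?S = "\<lambda>\<alpha>. {a. g_rng a (0, deg \<Lambda> (\<mu> \<cdot> \<alpha>)) = \<mu> \<cdot> \<alpha> \<and> g_src a (0, deg \<Lambda> (\<nu> \<cdot> \<alpha>)) = \<nu> \<cdot> \<alpha>}"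
  have "(\<lambda>a. \<Sum>\<alpha>\<in>?A. h a * indicator (?S \<alpha>) a) \<in> B"
    using \<alpha> mn by (intro closed_subspace_sum[OF V A] bimodule_restrict_corner[OF B h]) auto
  moreover have "(\<Sum>\<alpha>\<in>?A. h a * indicator (?S \<alpha>) a) = f a * indicator (corner_block N j \<mu> \<nu>) a" for a
  proof (cases "a \<in> G")
    case True
    note IP = groupoid_ends[OF True]
    let ?x = "g_rng a" and ?y = "g_src a"
    \<comment> \<open>By unique factorization, beginning with
      \<open>\<kappa> \<cdot> \<alpha>\<close> means beginning with \<open>\<kappa>\<close> and
      continuing with \<open>\<alpha>\<close>.\<close>
    have head: "x (0, deg \<Lambda> (\<kappa> \<cdot> \<alpha>)) = \<kappa> \<cdot> \<alpha> \<longleftrightarrow> x (0, deg \<Lambda> \<kappa>) = \<kappa> \<and> x (deg \<Lambda> \<kappa>, deg \<Lambda> \<kappa> + j) = \<alpha>"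
      if x: "x \<in> IP" and \<kappa>: "\<kappa> \<in> mor \<Lambda>" "src \<Lambda> \<kappa> = src \<Lambda> \<mu>" and A: "\<alpha> \<in> ?A" for x \<kappa> \<alpha>
    proof -
      have d: "deg \<Lambda> (\<kappa> \<cdot> \<alpha>) = deg \<Lambda> \<kappa> + j"
        using \<kappa> \<alpha>[OF A] by simp
      have e: "x (0, deg \<Lambda> \<kappa> + j) = x (0, deg \<Lambda> \<kappa>) \<cdot> x (deg \<Lambda> \<kappa>, deg \<Lambda> \<kappa> + j)"
        using inf_path_compose[OF x, of 0 "deg \<Lambda> \<kappa>" "deg \<Lambda> \<kappa> + j"] by simp
      have u: "x (0, deg \<Lambda> \<kappa>) = \<kappa>" "x (deg \<Lambda> \<kappa>, deg \<Lambda> \<kappa> + j) = \<alpha>"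
        if "x (0, deg \<Lambda> \<kappa>) \<cdot> x (deg \<Lambda> \<kappa>, deg \<Lambda> \<kappa> + j) = \<kappa> \<cdot> \<alpha>"
      proof -
        have p: "x (0, deg \<Lambda> \<kappa>) \<in> mor \<Lambda>" "x (deg \<Lambda> \<kappa>, deg \<Lambda> \<kappa> + j) \<in> mor \<Lambda>"
          "src \<Lambda> (x (0, deg \<Lambda> \<kappa>)) = rng \<Lambda> (x (deg \<Lambda> \<kappa>, deg \<Lambda> \<kappa> + j))"
          "deg \<Lambda> (x (0, deg \<Lambda> \<kappa>)) = deg \<Lambda> \<kappa>"
          using x by simp_all
        have k: "src \<Lambda> \<kappa> = rng \<Lambda> \<alpha>" using \<kappa> \<alpha>[OF A] by simp
        show "x (0, deg \<Lambda> \<kappa>) = \<kappa>" "x (deg \<Lambda> \<kappa>, deg \<Lambda> \<kappa> + j) = \<alpha>"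
          using factor_unique[OF p(1-3) \<kappa>(1) \<alpha>(1)[OF A] k that p(4)] by simp_all
      qed
      show ?thesis
        unfolding d e using u by metis
    qed
    have S: "a \<in> ?S \<alpha> \<longleftrightarrow> (?x (0, deg \<Lambda> \<mu>) = \<mu> \<and> ?y (0, deg \<Lambda> \<nu>) = \<nu>
        \<and> ?x (deg \<Lambda> \<mu>, deg \<Lambda> \<mu> + j) = ?y (deg \<Lambda> \<nu>, deg \<Lambda> \<nu> + j)) \<and> \<alpha> = ?x (deg \<Lambda> \<mu>, deg \<Lambda> \<mu> + j)"
      (is "_ \<longleftrightarrow> ?Q \<and> _") if "\<alpha> \<in> ?A" for \<alpha>
      using head[OF IP(1) mn(1) refl that] head[OF IP(2) mn(2,3) that] by auto
    show ?thesis
    proof (cases ?Q)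
      case True
      have "src \<Lambda> (?x (0, deg \<Lambda> \<mu>)) = ?x (deg \<Lambda> \<mu>, deg \<Lambda> \<mu>)"
        using IP(1) by simp
      then have "src \<Lambda> \<mu> = ?x (deg \<Lambda> \<mu>, deg \<Lambda> \<mu>)"
        using True by metis
      then have "?x (deg \<Lambda> \<mu>, deg \<Lambda> \<mu> + j) \<in> ?A"
        using IP(1) by (simp add: paths_to_def)
      moreover have "(\<Sum>\<alpha>\<in>?A. h a * indicator (?S \<alpha>) a)
          = (\<Sum>\<alpha>\<in>?A. if \<alpha> = ?x (deg \<Lambda> \<mu>, deg \<Lambda> \<mu> + j) then h a else 0)"
        using S True by (intro sum.cong refl) (simp add: indicator_def del: mem_Collect_eq)
      ultimately have "(\<Sum>\<alpha>\<in>?A. h a * indicator (?S \<alpha>) a) = h a"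
        using A by simp
      then show ?thesis
        using True by (simp add: h_def corner_block_def m_def indicator_def)
    next
      case False
      then have "a \<notin> ?S \<alpha>" if "\<alpha> \<in> ?A" for \<alpha>
        using S[OF that] by blast
      then have "(\<Sum>\<alpha>\<in>?A. h a * indicator (?S \<alpha>) a) = 0"
        by (intro sum.neutral ballI) (simp del: mem_Collect_eq)
      moreover have "a \<notin> corner_block N j \<mu> \<nu>"
        using False unfolding corner_block_def by blast
      ultimately show ?thesis by simp
    qed
  next
    case False
    then have "f a = 0"
      using B f Cstar_outside unfolding bimodule_def by blast
    then show ?thesis by (simp add: h_def)
  qed
  ultimately show ?thesis by simp
qed

text \<open>\<open>quo a b\<close> lies in the block exactly when the label of row \<open>a\<close>
  (degree modulo \<open>N\<close> and the \<open>j\<close> steps after \<open>\<mu>\<close>) equals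
  that of column \<open>b\<close> (degree shifted by \<open>?m\<close>, modulo \<open>N\<close>, and
  the \<open>j\<close> steps after \<open>\<nu>\<close>).\<close>

lemma opbd_corner_block:
  assumes f: "opbd f C"
  shows "opbd (\<lambda>a. f a * indicator (corner_block N j \<mu> \<nu>) a) C"
proof (rule opbd_block[OF f])
  fix x a b assume ab: "a \<in> fib x" "b \<in> fib x"
  let ?m = "deg_diff (deg \<Lambda> \<mu>) (deg \<Lambda> \<nu>)"
  let ?u = "\<lambda>a. if g_rng a (0, deg \<Lambda> \<mu>) = \<mu>
    then Some ((\<lambda>i. g_deg a $ i mod int N), g_rng a (deg \<Lambda> \<mu>, deg \<Lambda> \<mu> + j)) else None"
  let ?v = "\<lambda>b. if g_rng b (0, deg \<Lambda> \<nu>) = \<nu>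
    then Some ((\<lambda>i. (g_deg b $ i + ?m $ i) mod int N), g_rng b (deg \<Lambda> \<nu>, deg \<Lambda> \<nu> + j)) else None"
  have "(p - q - r) mod int N = 0 \<longleftrightarrow> p mod int N = (q + r) mod int N" for p q r
    by (simp add: mod_eq_dvd_iff mod_eq_0_iff_dvd diff_diff_eq)
  then have "quo a b \<in> corner_block N j \<mu> \<nu> \<longleftrightarrow> ?u a \<noteq> None \<and> ?u a = ?v b"
    by (simp add: corner_block_def fun_eq_iff)
  then show "f (quo a b) * indicator (corner_block N j \<mu> \<nu>) (quo a b)
      = (if ?u a \<noteq> None \<and> ?u a = ?v b then f (quo a b) else 0)"
    by (simp add: indicator_def)
qed

text \<open>On an arrow of \<open>Z \<mu>' \<nu>'\<close> both weakenings become exact. A degree gap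
  below \<open>N\<close> that is divisible by \<open>N\<close> vanishes; the tails agree after
  \<open>j\<close> further steps because the arrow lies in \<open>Z \<mu>' \<nu>'\<close>, and the
  block equates those \<open>j\<close> steps.\<close>

lemma corner_block_inter_cylinder:
  assumes s: "same_src \<mu> \<nu>" "same_src \<mu>' \<nu>'" and a: "a \<in> Z \<mu>' \<nu>'"
    and N: "\<And>i. \<bar>deg_diff (deg \<Lambda> \<mu>') (deg \<Lambda> \<nu>') $ i - deg_diff (deg \<Lambda> \<mu>) (deg \<Lambda> \<nu>) $ i\<bar> < int N"
    and j: "deg \<Lambda> \<mu>' \<le> deg \<Lambda> \<mu> + j"
  shows "a \<in> corner_block N j \<mu> \<nu> \<longleftrightarrow> a \<in> Z \<mu> \<nu>"
proof
  assume blk: "a \<in> corner_block N j \<mu> \<nu>"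
  note a' = a[unfolded in_cylinder_iff[OF s(2)]]
  let ?x = "g_rng a" and ?y = "g_src a"
  have "g_deg a $ i = deg_diff (deg \<Lambda> \<mu>) (deg \<Lambda> \<nu>) $ i" for i
  proof -
    have "int N dvd g_deg a $ i - deg_diff (deg \<Lambda> \<mu>) (deg \<Lambda> \<nu>) $ i"
      using blk by (simp add: corner_block_def mod_eq_0_iff_dvd)
    then show ?thesis
      using N[of i] a' zdvd_imp_le[of "int N" "\<bar>g_deg a $ i - deg_diff (deg \<Lambda> \<mu>) (deg \<Lambda> \<nu>) $ i\<bar>"] by fastforce
  qed
  then have m: "g_deg a = deg_diff (deg \<Lambda> \<mu>) (deg \<Lambda> \<nu>)"
    by (simp add: vec_eq_iff)
  have "deg_diff (deg \<Lambda> \<mu>') (deg \<Lambda> \<nu>') = deg_diff (deg \<Lambda> \<mu> + j) (deg \<Lambda> \<nu> + j)"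
    using m a' by simp
  then obtain k where "deg \<Lambda> \<mu> + j = deg \<Lambda> \<mu>' + k" "deg \<Lambda> \<nu> + j = deg \<Lambda> \<nu>' + k"
    using cylinder_degree_shift[OF _ j] by metis
  then have sh: "shift (deg \<Lambda> \<mu> + j) ?x = shift (deg \<Lambda> \<nu> + j) ?y"
    using a' shift_eq_add by metis
  have "shift (deg \<Lambda> \<mu>) ?x = shift (deg \<Lambda> \<nu>) ?y"
  proof (rule inf_path_eq_shiftI[where p = j])
    show "shift (deg \<Lambda> \<mu>) ?x (0, j) = shift (deg \<Lambda> \<nu>) ?y (0, j)"
      using blk by (simp add: corner_block_def add.commute)
    show "shift j (shift (deg \<Lambda> \<mu>) ?x) = shift j (shift (deg \<Lambda> \<nu>) ?y)"
      using sh by (simp add: add.commute)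
  qed (use a' in auto)
  then show "a \<in> Z \<mu> \<nu>"
    using a' m blk by (simp add: in_cylinder_iff[OF s(1)] corner_block_def)
next
  assume "a \<in> Z \<mu> \<nu>"
  note a' = this[unfolded in_cylinder_iff[OF s(1)]]
  have "g_rng a (deg \<Lambda> \<mu>, deg \<Lambda> \<mu> + j) = shift (deg \<Lambda> \<mu>) (g_rng a) (0, j)"
    by (simp add: add.commute)
  also have "\<dots> = shift (deg \<Lambda> \<nu>) (g_src a) (0, j)"
    using a' by metis
  also have "\<dots> = g_src a (deg \<Lambda> \<nu>, deg \<Lambda> \<nu> + j)"
    by (simp add: add.commute)
  finally show "a \<in> corner_block N j \<mu> \<nu>"
    using a' by (simp add: corner_block_def)
qed

text \<open>
  On an element of \<^const>\<open>cspan\<close> the truncation to a large corner block is already the truncation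
  to the cylinder itself, and both truncations are contractive.
\<close>

lemma bimodule_restrict_cylinder:
  assumes B: "bimodule \<Lambda> B" and inv: "gauge_invariant B" and f: "f \<in> B" and s: "same_src \<mu> \<nu>"
  shows "(\<lambda>a. f a * indicator (Z \<mu> \<nu>) a) \<in> B"
proof (rule closed_subspaceD(4)[OF bimodule_closed_subspace[OF B] norm_closureI])
  show "f a * indicator (Z \<mu> \<nu>) a = 0" if "a \<notin> G" for a
    using that cylinder_subset_groupoid[OF s] by (auto simp: indicator_def)
  fix \<epsilon> :: real assume "\<epsilon> > 0"
  then have e: "\<epsilon> / 2 > 0" by simp
  have "f \<in> Cstar \<Lambda>" using B f unfolding bimodule_def by blast
  from CstarE[OF this e] obtain g where g: "g \<in> cspan" "opbd (\<lambda>a. f a - g a) (\<epsilon> / 2)" .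
  obtain I where I: "finite I" "\<forall>(\<mu>', \<nu>')\<in>I. same_src \<mu>' \<nu>'"
    "\<forall>a. g a \<noteq> 0 \<longrightarrow> (\<exists>(\<mu>', \<nu>')\<in>I. a \<in> Z \<mu>' \<nu>')"
    using cspan_support[OF g(1)] by blast
  define d where "d p i = nat \<bar>deg_diff (deg \<Lambda> (fst p)) (deg \<Lambda> (snd p)) $ i - deg_diff (deg \<Lambda> \<mu>) (deg \<Lambda> \<nu>) $ i\<bar>"
    for p i
  \<comment> \<open>\<open>N\<close> exceeds all degree gaps and \<open>j\<close> dominates all
    range degrees of the finitely many cylinders supporting \<open>g\<close>; sums stand in for
    maxima.\<close>
  define N where "N = Suc (\<Sum>p\<in>I. \<Sum>i\<in>UNIV. d p i)"
  define j where "j = (\<Sum>p\<in>I. deg \<Lambda> (fst p))"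
  have "a \<in> corner_block N j \<mu> \<nu> \<longleftrightarrow> a \<in> Z \<mu> \<nu>" if ga: "g a \<noteq> 0" for a
  proof -
    obtain \<mu>' \<nu>' where p: "(\<mu>', \<nu>') \<in> I" "same_src \<mu>' \<nu>'" "a \<in> Z \<mu>' \<nu>'"
      using I(2,3) ga by blast
    have "d (\<mu>', \<nu>') i < N" for i
    proof -
      have "d (\<mu>', \<nu>') i \<le> (\<Sum>i\<in>UNIV. d (\<mu>', \<nu>') i)"
        by (rule member_le_sum) auto
      also have "\<dots> \<le> (\<Sum>p\<in>I. \<Sum>i\<in>UNIV. d p i)"
        by (rule member_le_sum[OF p(1)]) (use I(1) in auto)
      finally show ?thesis by (simp add: N_def)
    qed
    then have "\<bar>deg_diff (deg \<Lambda> \<mu>') (deg \<Lambda> \<nu>') $ i - deg_diff (deg \<Lambda> \<mu>) (deg \<Lambda> \<nu>) $ i\<bar> < int N" for i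
      unfolding d_def fst_conv snd_conv by (metis nat_less_iff abs_ge_zero)
    moreover have "deg \<Lambda> \<mu>' \<le> deg \<Lambda> \<mu> + j"
    proof -
      have "j = deg \<Lambda> \<mu>' + (\<Sum>p\<in>I - {(\<mu>', \<nu>')}. deg \<Lambda> (fst p))"
        using sum.remove[OF I(1) p(1), of "\<lambda>p. deg \<Lambda> (fst p)"] by (simp add: j_def)
      then show ?thesis
        by (simp add: add.left_commute[of "deg \<Lambda> \<mu>"])
    qed
    ultimately show ?thesis
      by (rule corner_block_inter_cylinder[OF s p(2,3)])
  qed
  then have gg: "g a * indicator (Z \<mu> \<nu>) a = g a * indicator (corner_block N j \<mu> \<nu>) a" for a
    by (cases "g a = 0") (simp_all add: indicator_def)
  \<comment> \<open>Both restrictions have the same effect on \<open>g\<close>, so their difference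
    on \<open>f\<close> is their difference on \<open>f - g\<close>, which costs
    \<open>\<epsilon> / 2\<close> for each.\<close>
  have "opbd (\<lambda>a. (f a - g a) * indicator (Z \<mu> \<nu>) a - (f a - g a) * indicator (corner_block N j \<mu> \<nu>) a)
      (\<epsilon> / 2 + \<epsilon> / 2)"
    by (intro opbd_diff opbd_restrict_bisection opbd_corner_block g(2) s)
  then have "opbd (\<lambda>a. f a * indicator (Z \<mu> \<nu>) a - f a * indicator (corner_block N j \<mu> \<nu>) a) \<epsilon>"
    using gg by (simp add: left_diff_distrib)
  then show "\<exists>h\<in>B. opbd (\<lambda>a. f a * indicator (Z \<mu> \<nu>) a - h a) \<epsilon>"
    by (rule bexI[OF _ bimodule_restrict_corner_block[OF B inv f _ s]]) (simp add: N_def)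
qed

section \<open>Indicators of cylinders inside the spectrum\<close>

lemma indicator_of_nonvanishing:
  assumes V: "closed_subspace V" and f: "asymp_locally_constant f" and s: "same_src \<mu> \<nu>"
    and cut: "\<And>\<mu>' \<nu>'. same_src \<mu>' \<nu>' \<Longrightarrow> (\<lambda>a. f a * indicator (Z \<mu>' \<nu>') a) \<in> V"
    and \<delta>: "\<delta> > 0" "\<And>a. a \<in> Z \<mu> \<nu> \<Longrightarrow> \<delta> \<le> cmod (f a)"
  shows "indicator (Z \<mu> \<nu>) \<in> V"
proof (rule closed_subspaceD(4)[OF V norm_closureI])
  show "indicator (Z \<mu> \<nu>) a = (0 :: complex)" if "a \<notin> G" for a
    using that cylinder_subset_groupoid[OF s] by (auto simp: indicator_def)
  fix \<epsilon> :: real assume "\<epsilon> > 0"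
  then have e: "\<epsilon> * \<delta> > 0" using \<delta>(1) by simp
  \<comment> \<open>Accuracy \<open>\<epsilon> * \<delta>\<close> is required because dividing by
    sample values of modulus at least \<open>\<delta>\<close> can enlarge errors by the factor
    \<open>1 / \<delta>\<close>.\<close>
  obtain j where j: "\<And>a b. a \<in> Z \<mu> \<nu> \<Longrightarrow> b \<in> cyl_at a (deg \<Lambda> \<mu> + j) (deg \<Lambda> \<nu> + j) \<Longrightarrow> cmod (f b - f a) < \<epsilon> * \<delta>"
    using f s e unfolding asymp_locally_constant_def by blast
  \<comment> \<open>A subspace admits scalars only, so the function \<open>1 / f\<close> is replaced
    by its value at one sample arrow of each small part.\<close>
  let ?c = "\<lambda>C. inverse (f (rep C))"
  have "(\<lambda>a. \<Sum>C\<in>parts \<mu> \<nu> j. ?c C * (f a * indicator C a)) \<in> V"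
  proof (intro closed_subspace_sum[OF V finite_parts[OF s]] closed_subspaceD(3)[OF V])
    fix C assume "C \<in> parts \<mu> \<nu> j"
    then obtain \<mu>' \<nu>' where "C = Z \<mu>' \<nu>'" "same_src \<mu>' \<nu>'"
      using partsE[OF _ s] by metis
    then show "(\<lambda>a. f a * indicator C a) \<in> V"
      using cut by simp
  qed
  moreover have "opbd (\<lambda>a. indicator (Z \<mu> \<nu>) a - (\<Sum>C\<in>parts \<mu> \<nu> j. ?c C * (f a * indicator C a))) \<epsilon>"
  proof (rule opbd_bisection[OF bisection_cylinder[OF s]])
    have sum: "(\<Sum>C\<in>parts \<mu> \<nu> j. ?c C * (f a * indicator C a))
        = f a * (if a \<in> Z \<mu> \<nu> then ?c (cyl_at a (deg \<Lambda> \<mu> + j) (deg \<Lambda> \<nu> + j)) else 0)" for a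
    proof -
      have "(\<Sum>C\<in>parts \<mu> \<nu> j. ?c C * (f a * indicator C a)) = f a * (\<Sum>C\<in>parts \<mu> \<nu> j. ?c C * indicator C a)"
        by (simp only: sum_distrib_left mult.left_commute)
      then show ?thesis
        by (simp only: sum_over_parts[OF s])
    qed
    show "a \<in> Z \<mu> \<nu>"
      if "indicator (Z \<mu> \<nu>) a - (\<Sum>C\<in>parts \<mu> \<nu> j. ?c C * (f a * indicator C a)) \<noteq> 0" for a
      using that unfolding sum by (auto split: if_splits)
    fix a assume a: "a \<in> Z \<mu> \<nu>"
    let ?C = "cyl_at a (deg \<Lambda> \<mu> + j) (deg \<Lambda> \<nu> + j)"
    have r: "rep ?C \<in> ?C"
      unfolding rep_def using in_own_cyl_at[OF s a] by (rule someI)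
    then have fr: "\<delta> \<le> cmod (f (rep ?C))"
      using \<delta>(2) cyl_at_subset[OF s a] by blast
    then have nz: "f (rep ?C) \<noteq> 0" using \<delta>(1) by auto
    have "cmod (1 - f a * ?c ?C) = cmod (f (rep ?C) - f a) / cmod (f (rep ?C))"
      using nz by (simp add: divide_simps flip: norm_divide)
    also have "\<dots> \<le> (\<epsilon> * \<delta>) / \<delta>"
      using j[OF a r] fr \<delta>(1) e by (intro frac_le) auto
    finally show "cmod (indicator (Z \<mu> \<nu>) a - (\<Sum>C\<in>parts \<mu> \<nu> j. ?c C * (f a * indicator C a))) \<le> \<epsilon>"
      unfolding sum using a \<delta>(1) by simp
  qed (use \<open>\<epsilon> > 0\<close> in simp)
  ultimately show "\<exists>h\<in>V. opbd (\<lambda>a. indicator (Z \<mu> \<nu>) a - h a) \<epsilon>"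
    by (intro bexI)
qed

text \<open>Near each arrow some member of \<open>B\<close> is bounded away from 0, which puts the
  indicator of a small cylinder into \<open>B\<close>. Compactness yields one level for all parts,
  and finitely many parts add up to the cylinder.\<close>

lemma cylinder_in_spectrum:
  assumes B: "bimodule \<Lambda> B" and inv: "gauge_invariant B" and s: "same_src \<mu> \<nu>"
    and sub: "Z \<mu> \<nu> \<subseteq> spectrum \<Lambda> B"
  shows "indicator (Z \<mu> \<nu>) \<in> B"
proof -
  note V = bimodule_closed_subspace[OF B]
  let ?cyl = "\<lambda>a j. cyl_at a (deg \<Lambda> \<mu> + j) (deg \<Lambda> \<nu> + j)"
  have cyl: "\<exists>\<mu>' \<nu>'. ?cyl a j = Z \<mu>' \<nu>' \<and> same_src \<mu>' \<nu>'" if "a \<in> Z \<mu> \<nu>" for a j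
    using cyl_at_in_cylinders[OF s that, of j] unfolding cylinders_def by blast
  have "\<exists>J. \<forall>a\<in>Z \<mu> \<nu>. indicator (?cyl a J) \<in> B"
  proof (rule cylinder_compactness[OF s])
    fix a assume a: "a \<in> Z \<mu> \<nu>"
    then obtain f where f: "f \<in> B" "f a \<noteq> 0"
      using sub unfolding spectrum_def by blast
    then have alc: "asymp_locally_constant f"
      using B Cstar_asymp_locally_constant unfolding bimodule_def by blast
    \<comment> \<open>Deviating from \<open>f a\<close> by less than half its modulus,
      \<open>f\<close> keeps at least the other half.\<close>
    have "cmod (f a) / 2 > 0" using f(2) by simp
    then obtain j where j: "\<And>b. b \<in> ?cyl a j \<Longrightarrow> cmod (f b - f a) < cmod (f a) / 2"
      using alc s a unfolding asymp_locally_constant_def by blast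
    obtain \<mu>' \<nu>' where C: "?cyl a j = Z \<mu>' \<nu>'" "same_src \<mu>' \<nu>'"
      using cyl[OF a] by blast
    have "indicator (Z \<mu>' \<nu>') \<in> B"
    proof (rule indicator_of_nonvanishing[OF V alc C(2) bimodule_restrict_cylinder[OF B inv f(1)]])
      show "cmod (f a) / 2 \<le> cmod (f b)" if "b \<in> Z \<mu>' \<nu>'" for b
        using j[of b] that C(1) norm_triangle_ineq3[of "f a" "f b"] norm_minus_commute[of "f a" "f b"] by auto
    qed (use f(2) in auto)
    then show "\<exists>j. indicator (?cyl a j) \<in> B"
      using C(1) by metis
  next
    fix a j j' assume a: "a \<in> Z \<mu> \<nu>" and i: "indicator (?cyl a j) \<in> B" and le: "j \<le> j'"
    obtain \<mu>' \<nu>' where C: "?cyl a j' = Z \<mu>' \<nu>'" "same_src \<mu>' \<nu>'"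
      using cyl[OF a] by blast
    \<comment> \<open>A finer level is reached by restricting the indicator already found to the
      smaller cylinder.\<close>
    have "(\<lambda>b. indicator (?cyl a j) b * indicator (?cyl a j') b :: complex) \<in> B"
      unfolding C(1) by (rule bimodule_restrict_cylinder[OF B inv i C(2)])
    moreover have "(\<lambda>b. indicator (?cyl a j) b * indicator (?cyl a j') b :: complex) = indicator (?cyl a j')"
      using cyl_at_antimono[OF s a le] by (auto simp: indicator_def fun_eq_iff)
    ultimately show "indicator (?cyl a j') \<in> B" by simp
  next
    show "indicator (?cyl b j) \<in> B" if "a \<in> Z \<mu> \<nu>" "b \<in> ?cyl a j" "indicator (?cyl a j) \<in> B" for a b j
      using cyl_at_eq[OF s that(1,2)] that(3) by simp
  qed
  then obtain J where "\<And>C. C \<in> parts \<mu> \<nu> J \<Longrightarrow> indicator C \<in> B"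
    unfolding parts_def by blast
  then have "(\<lambda>a. \<Sum>C\<in>parts \<mu> \<nu> J. indicator C a :: complex) \<in> B"
    by (intro closed_subspace_sum[OF V finite_parts[OF s]])
  then show ?thesis
    by (simp add: indicator_eq_sum_parts[OF s, of J])
qed

section \<open>Fejer means\<close>

definition fejer_mult :: "nat \<Rightarrow> 'k set \<Rightarrow> int ^ 'k \<Rightarrow> complex" where
  "fejer_mult N I n = (\<Prod>i\<in>I. of_real (fejer N (n $ i)))"

lemma opbd_fejer_mult:
  assumes f: "opbd f C" and N: "N > 0"
  shows "opbd (\<lambda>a. fejer_mult N I (g_deg a) * f a) C"
proof -
  have "finite I" by simp
  then show ?thesis
  proof (induction I rule: finite_induct)
    case empty
    then show ?case using f by (simp add: fejer_mult_def)
  next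
    case (insert i I)
    have "(\<lambda>a. fejer_mult N (insert i I) (g_deg a) * f a)
        = (\<lambda>a. of_real (fejer N (g_deg a $ i)) * (fejer_mult N I (g_deg a) * f a))"
      using insert.hyps by (simp add: fejer_mult_def mult.assoc)
    then show ?case
      using opbd_fejer[OF insert.IH N] by simp
  qed
qed

lemma fejer_mult_tendsto_1: "(\<lambda>N. fejer_mult N I n) \<longlonglongrightarrow> 1"
proof -
  have "(\<lambda>N. \<Prod>i\<in>I. complex_of_real (fejer N (n $ i))) \<longlonglongrightarrow> (\<Prod>i\<in>I. of_real 1)"
    by (intro tendsto_prod tendsto_of_real fejer_tendsto_1)
  then show ?thesis by (simp add: fejer_mult_def)
qed

text \<open>Each cylinder indicator has a single degree, at which the Fejer factor is a number
  tending to 1. Quantifying over all large \<open>N\<close> lets the induction combine the terms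
  with one common \<open>N\<close>.\<close>

lemma cspan_fejer:
  "g \<in> cspan \<Longrightarrow> \<epsilon> > 0 \<Longrightarrow> \<forall>\<^sub>F N in sequentially. opbd (\<lambda>a. g a - fejer_mult N UNIV (g_deg a) * g a) \<epsilon>"
proof (induction g arbitrary: \<epsilon> rule: cspan.induct)
  case zero
  then show ?case by (simp add: opbd_zero)
next
  case (step g C c)
  obtain \<mu> \<nu> where C: "C = Z \<mu> \<nu>" "same_src \<mu> \<nu>"
    using step(2) by (auto simp: cylinders_def)
  let ?m = "deg_diff (deg \<Lambda> \<mu>) (deg \<Lambda> \<nu>)"
  have e: "\<epsilon> / 2 > 0" using step.prems by simp
  have "(\<lambda>N. cmod (c - fejer_mult N UNIV ?m * c)) \<longlonglongrightarrow> cmod (c - 1 * c)"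
    by (intro tendsto_intros fejer_mult_tendsto_1)
  then have "\<forall>\<^sub>F N in sequentially. cmod (c - fejer_mult N UNIV ?m * c) < \<epsilon> / 2"
    using e by (intro order_tendstoD) auto
  with step.IH[OF e] show ?case
  proof eventually_elim
    case (elim N)
    have "opbd (\<lambda>a. c * indicator C a - fejer_mult N UNIV (g_deg a) * (c * indicator C a)) (\<epsilon> / 2)"
    proof (rule opbd_bisection[OF bisection_cylinders[OF step(2)]])
      show "cmod (c * indicator C a - fejer_mult N UNIV (g_deg a) * (c * indicator C a)) \<le> \<epsilon> / 2"
        if "a \<in> C" for a
        using elim(2) that g_deg_cylinder[OF C(2), of a] C(1) by simp
    qed (use e in \<open>auto simp: indicator_def split: if_splits\<close>)
    from opbd_add[OF elim(1) this] show ?case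
      by (simp add: algebra_simps)
  qed
qed

section \<open>Truncation to finite blocks and to single degrees\<close>

definition finite_block :: "'m set \<Rightarrow> 'm set \<Rightarrow> nat ^ 'k \<Rightarrow> nat ^ 'k \<Rightarrow> ('m, 'k) garrow set" where
  "finite_block F F' p q = {a. g_deg a = deg_diff p q \<and> shift p (g_rng a) = shift q (g_src a)
     \<and> g_rng a (0, p) \<in> F \<and> g_src a (0, q) \<in> F'}"

text \<open>The block is in general no bisection, since one range may go with several sources.
  Labelling rows by degree and tail after \<open>p\<close>, and columns by shifted degree and tail
  after \<open>q\<close>, still makes it a block restriction; the heads only decide which rows and
  columns are deleted.\<close>

lemma opbd_finite_block:
  assumes f: "opbd f C"
  shows "opbd (\<lambda>a. f a * indicator (finite_block F F' p q) a) C"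
proof (rule opbd_block[OF f])
  fix x a b assume ab: "a \<in> fib x" "b \<in> fib x"
  let ?u = "\<lambda>a. if g_rng a (0, p) \<in> F then Some (g_deg a, shift p (g_rng a)) else None"
  let ?v = "\<lambda>b. if g_rng b (0, q) \<in> F' then Some (g_deg b + deg_diff p q, shift q (g_rng b)) else None"
  have "d - e = m \<longleftrightarrow> d = e + m" for d e m :: "int ^ 'k"
    by (auto simp: algebra_simps)
  then have "quo a b \<in> finite_block F F' p q \<longleftrightarrow> ?u a \<noteq> None \<and> ?u a = ?v b"
    by (simp add: finite_block_def)
  then show "f (quo a b) * indicator (finite_block F F' p q) (quo a b)
      = (if ?u a \<noteq> None \<and> ?u a = ?v b then f (quo a b) else 0)"
    by (simp add: indicator_def)
qed

text \<open>This is the homogeneous component that integration of the gauge action would give; as a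
  block restriction by degree it is seen to be contractive without an integral.\<close>

lemma opbd_degree:
  assumes f: "opbd f C"
  shows "opbd (\<lambda>a. f a * of_bool (g_deg a = m)) C"
proof (rule opbd_block[OF f])
  fix x a b assume ab: "a \<in> fib x" "b \<in> fib x"
  have "g_deg a - g_deg b = m \<longleftrightarrow> g_deg a = g_deg b + m"
    by (auto simp: algebra_simps)
  then show "f (quo a b) * of_bool (g_deg (quo a b) = m)
      = (if Some (g_deg a) \<noteq> None \<and> Some (g_deg a) = Some (g_deg b + m) then f (quo a b) else 0)"
    by simp
qed

section \<open>Reconstruction of a function from its truncations\<close>

lemma restrict_finite_block:
  assumes V: "closed_subspace V" and cut: "\<And>\<mu> \<nu>. same_src \<mu> \<nu> \<Longrightarrow> (\<lambda>a. f a * indicator (Z \<mu> \<nu>) a) \<in> V"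
    and out: "\<And>a. a \<notin> G \<Longrightarrow> f a = 0"
    and F: "finite F" "finite F'" "\<And>\<alpha>. \<alpha> \<in> F \<Longrightarrow> deg \<Lambda> \<alpha> = p" "\<And>\<beta>. \<beta> \<in> F' \<Longrightarrow> deg \<Lambda> \<beta> = q"
  shows "(\<lambda>a. f a * indicator (finite_block F F' p q) a) \<in> V"
proof -
  let ?J = "{c \<in> F \<times> F'. same_src (fst c) (snd c)}"
  have J: "finite ?J" using F by simp
  have "(\<lambda>a. \<Sum>c\<in>?J. f a * indicator (Z (fst c) (snd c)) a) \<in> V"
    using cut by (intro closed_subspace_sum[OF V J]) simp
  moreover have "(\<Sum>c\<in>?J. f a * indicator (Z (fst c) (snd c)) a) = f a * indicator (finite_block F F' p q) a" for a
  proof (cases "a \<in> G")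
    case True
    note IP = groupoid_ends[OF True]
    let ?c0 = "(g_rng a (0, p), g_src a (0, q))"
    have mem: "a \<in> Z (fst c) (snd c) \<longleftrightarrow> a \<in> finite_block F F' p q \<and> c = ?c0" if c: "c \<in> ?J" for c
    proof -
      obtain \<alpha> \<beta> where [simp]: "c = (\<alpha>, \<beta>)" by (cases c)
      have s: "same_src \<alpha> \<beta>" "\<alpha> \<in> F" "\<beta> \<in> F'" using c by auto
      show ?thesis
        using s F(3)[OF s(2)] F(4)[OF s(3)] IP
        by (auto simp: in_cylinder_iff[OF s(1)] finite_block_def)
    qed
    show ?thesis
    proof (cases "a \<in> finite_block F F' p q")
      case blk: True
      then have "?c0 \<in> ?J"
        using same_src_segments[OF IP, of p q] by (simp add: finite_block_def)
      moreover have "(\<Sum>c\<in>?J. f a * indicator (Z (fst c) (snd c)) a) = (\<Sum>c\<in>?J. if c = ?c0 then f a else 0)"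
        using mem blk by (intro sum.cong refl) (simp add: indicator_def)
      ultimately show ?thesis using J blk by simp
    next
      case blk: False
      then have "(\<Sum>c\<in>?J. f a * indicator (Z (fst c) (snd c)) a) = 0"
        using mem by (intro sum.neutral ballI) (simp add: indicator_def)
      then show ?thesis using blk by simp
    qed
  qed (use out in simp)
  ultimately show ?thesis by simp
qed

text \<open>In one degree the support of an approximant \<open>g\<close> fits into a finite block,
  on which \<open>f\<close> is a finite sum of its restrictions to cylinders. The block and degree
  restrictions agree on \<open>g\<close> and are contractive, so they nearly agree on
  \<open>f\<close>.\<close>

lemma homogeneous_synthesis:
  assumes V: "closed_subspace V" and f: "f \<in> Cstar \<Lambda>"
    and cut: "\<And>\<mu> \<nu>. same_src \<mu> \<nu> \<Longrightarrow> (\<lambda>a. f a * indicator (Z \<mu> \<nu>) a) \<in> V"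
  shows "(\<lambda>a. f a * of_bool (g_deg a = m)) \<in> V"
proof (rule closed_subspaceD(4)[OF V norm_closureI])
  show "f a * of_bool (g_deg a = m) = 0" if "a \<notin> G" for a
    using Cstar_outside[OF f that] by simp
  fix \<epsilon> :: real assume "\<epsilon> > 0"
  then have e: "\<epsilon> / 2 > 0" by simp
  obtain g where g: "g \<in> cspan" "opbd (\<lambda>a. f a - g a) (\<epsilon> / 2)"
    using CstarE[OF f e] .
  obtain I where I: "finite I" "\<forall>(\<mu>', \<nu>')\<in>I. same_src \<mu>' \<nu>'"
    "\<forall>a. g a \<noteq> 0 \<longrightarrow> (\<exists>(\<mu>', \<nu>')\<in>I. a \<in> Z \<mu>' \<nu>')"
    using cspan_support[OF g(1)] by blast
  define j where "j = (\<Sum>c\<in>I. deg \<Lambda> (fst c))"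
  \<comment> \<open>Positive and negative part of \<open>m\<close>, both raised by \<open>j\<close>:
    the difference of \<open>p\<close> and \<open>q\<close> is \<open>m\<close>, and
    \<open>p\<close> dominates the range degrees of all cylinders supporting
    \<open>g\<close>.\<close>
  define p where "p = (\<chi> i. nat (m $ i)) + j"
  define q where "q = (\<chi> i. nat (- (m $ i))) + j"
  have pq: "deg_diff p q = m"
    by (auto simp: p_def q_def deg_diff_def vec_eq_iff)
  \<comment> \<open>\<open>F\<close> and \<open>F'\<close> contain every head at the levels
    \<open>p\<close> and \<open>q\<close> of an arrow in these cylinders: extending a head keeps its
    range, and row finiteness keeps the sets finite.\<close>
  define F where "F = (\<Union>c\<in>I. paths_to \<Lambda> p (rng \<Lambda> (fst c)))"
  define F' where "F' = (\<Union>c\<in>I. paths_to \<Lambda> q (rng \<Lambda> (snd c)))"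
  have mor: "fst c \<in> mor \<Lambda>" "snd c \<in> mor \<Lambda>" if "c \<in> I" for c
    using I(2) that by (auto simp: same_src_def)
  have F: "finite F" "finite F'"
    unfolding F_def F'_def using I(1) mor finite_paths_to by (auto intro!: finite_UN_I)
  have F_deg: "\<And>\<alpha>. \<alpha> \<in> F \<Longrightarrow> deg \<Lambda> \<alpha> = p" "\<And>\<beta>. \<beta> \<in> F' \<Longrightarrow> deg \<Lambda> \<beta> = q"
    by (auto simp: F_def F'_def paths_to_def)
  have "g_deg a = m \<longleftrightarrow> a \<in> finite_block F F' p q" if ga: "g a \<noteq> 0" for a
  proof
    assume m: "g_deg a = m"
    obtain \<mu>' \<nu>' where c: "(\<mu>', \<nu>') \<in> I" "same_src \<mu>' \<nu>'" "a \<in> Z \<mu>' \<nu>'"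
      using I(2,3) ga by blast
    note a' = c(3)[unfolded in_cylinder_iff[OF c(2)]]
    have "j = deg \<Lambda> \<mu>' + (\<Sum>c\<in>I - {(\<mu>', \<nu>')}. deg \<Lambda> (fst c))"
      using sum.remove[OF I(1) c(1), of "\<lambda>c. deg \<Lambda> (fst c)"] by (simp add: j_def)
    then have "deg \<Lambda> \<mu>' \<le> p"
      by (simp add: p_def add.left_commute[of _ "deg \<Lambda> \<mu>'"])
    moreover have "deg_diff (deg \<Lambda> \<mu>') (deg \<Lambda> \<nu>') = deg_diff p q"
      using a' m pq by simp
    ultimately obtain k where k: "p = deg \<Lambda> \<mu>' + k" "q = deg \<Lambda> \<nu>' + k"
      using cylinder_degree_shift by metis
    have IP: "g_rng a \<in> IP" "g_src a \<in> IP" using a' by auto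
    have "rng \<Lambda> (g_rng a (0, p)) = rng \<Lambda> (g_rng a (0, deg \<Lambda> \<mu>'))"
      "rng \<Lambda> (g_src a (0, q)) = rng \<Lambda> (g_src a (0, deg \<Lambda> \<nu>'))"
      using IP by simp_all
    then have "g_rng a (0, p) \<in> paths_to \<Lambda> p (rng \<Lambda> \<mu>')" "g_src a (0, q) \<in> paths_to \<Lambda> q (rng \<Lambda> \<nu>')"
      using a' IP by (simp_all add: paths_to_def)
    then have "g_rng a (0, p) \<in> F" "g_src a (0, q) \<in> F'"
      using c(1) unfolding F_def F'_def by force+
    moreover have "shift p (g_rng a) = shift q (g_src a)"
      unfolding k by (rule shift_eq_add) (use a' in blast)
    ultimately show "a \<in> finite_block F F' p q"
      using m pq by (simp add: finite_block_def)
  qed (use pq in \<open>simp add: finite_block_def\<close>)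
  then have gg: "g a * of_bool (g_deg a = m) = g a * indicator (finite_block F F' p q) a" for a
    by (cases "g a = 0") (simp_all add: indicator_def)
  have "opbd (\<lambda>a. (f a - g a) * of_bool (g_deg a = m) - (f a - g a) * indicator (finite_block F F' p q) a)
      (\<epsilon> / 2 + \<epsilon> / 2)"
    by (intro opbd_diff opbd_degree opbd_finite_block g(2))
  then have "opbd (\<lambda>a. f a * of_bool (g_deg a = m) - f a * indicator (finite_block F F' p q) a) \<epsilon>"
    using gg by (simp add: left_diff_distrib)
  then show "\<exists>h\<in>V. opbd (\<lambda>a. f a * of_bool (g_deg a = m) - h a) \<epsilon>"
    by (rule bexI[OF _ restrict_finite_block[OF V cut Cstar_outside[OF f] F F_deg]])
qed

text \<open>The three errors are \<open>f - g\<close>, the Fejer error of \<open>g\<close>, and the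
  Fejer mean of \<open>g - f\<close>, the last being small by contractivity. The Fejer mean of
  \<open>f\<close> is a finite combination of homogeneous components and so lies in
  \<open>V\<close>.\<close>

lemma synthesis:
  assumes V: "closed_subspace V" and f: "f \<in> Cstar \<Lambda>"
    and cut: "\<And>\<mu> \<nu>. same_src \<mu> \<nu> \<Longrightarrow> (\<lambda>a. f a * indicator (Z \<mu> \<nu>) a) \<in> V"
  shows "f \<in> V"
proof (rule closed_subspaceD(4)[OF V norm_closureI])
  show "f a = 0" if "a \<notin> G" for a
    by (rule Cstar_outside[OF f that])
  fix \<epsilon> :: real assume "\<epsilon> > 0"
  then have e: "\<epsilon> / 3 > 0" by simp
  obtain g where g: "g \<in> cspan" "opbd (\<lambda>a. f a - g a) (\<epsilon> / 3)"
    using CstarE[OF f e] .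
  have "\<forall>\<^sub>F N in sequentially. opbd (\<lambda>a. g a - fejer_mult N UNIV (g_deg a) * g a) (\<epsilon> / 3) \<and> N > 0"
    using cspan_fejer[OF g(1) e] eventually_gt_at_top[of 0] by (rule eventually_conj)
  then obtain N where N: "opbd (\<lambda>a. g a - fejer_mult N UNIV (g_deg a) * g a) (\<epsilon> / 3)" "N > 0"
    using eventually_happens'[OF sequentially_bot] by blast
  \<comment> \<open>The kernel vanishes as soon as one coordinate exceeds \<open>N\<close> in
    modulus, so this box carries the whole sum.\<close>
  let ?M = "{m :: int ^ 'k. \<forall>i. m $ i \<in> {- int N..int N}}"
  have M: "finite ?M" by (rule finite_int_box)
  have "(\<lambda>a. \<Sum>m\<in>?M. fejer_mult N UNIV m * (f a * of_bool (g_deg a = m))) \<in> V"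
    by (intro closed_subspace_sum[OF V M] closed_subspaceD(3)[OF V] homogeneous_synthesis[OF V f cut])
  moreover have "(\<Sum>m\<in>?M. fejer_mult N UNIV m * (f a * of_bool (g_deg a = m)))
      = fejer_mult N UNIV (g_deg a) * f a" for a
  proof -
    have "(\<Sum>m\<in>?M. fejer_mult N UNIV m * (f a * of_bool (g_deg a = m)))
        = (\<Sum>m\<in>?M. if m = g_deg a then fejer_mult N UNIV (g_deg a) * f a else 0)"
      by (intro sum.cong refl) auto
    also have "\<dots> = (if g_deg a \<in> ?M then fejer_mult N UNIV (g_deg a) * f a else 0)"
      using M by simp
    also have "\<dots> = fejer_mult N UNIV (g_deg a) * f a"
    proof (cases "g_deg a \<in> ?M")
      case False
      then obtain i where "g_deg a $ i \<notin> {- int N..int N}" by blast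
      then have "\<bar>g_deg a $ i\<bar> > int N" by auto
      then have "\<bar>real_of_int (g_deg a $ i)\<bar> / real N > 1"
        using N(2) by simp
      then have "fejer N (g_deg a $ i) = 0"
        by (simp add: fejer_def)
      then have "fejer_mult N UNIV (g_deg a) = 0"
        unfolding fejer_mult_def by (intro prod_zero) auto
      then show ?thesis by simp
    qed simp
    finally show ?thesis .
  qed
  ultimately have inV: "(\<lambda>a. fejer_mult N UNIV (g_deg a) * f a) \<in> V" by simp
  have "opbd (\<lambda>a. fejer_mult N UNIV (g_deg a) * (g a - f a)) (\<epsilon> / 3)"
    using g(2) opbd_diff_commute[of f g] by (intro opbd_fejer_mult[OF _ N(2)]) simp
  from opbd_add[OF opbd_add[OF g(2) N(1)] this]
  have "opbd (\<lambda>a. f a - fejer_mult N UNIV (g_deg a) * f a) \<epsilon>"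
    by (simp add: algebra_simps)
  then show "\<exists>h\<in>V. opbd (\<lambda>a. f a - h a) \<epsilon>"
    using inV by (rule bexI)
qed

text \<open>On each cylinder \<open>f\<close> is close to a step function whose non-zero
  coefficients sit only on parts contained in \<open>P\<close>; \<open>synthesis\<close> then
  assembles the cylinders.\<close>

lemma supported_functions_in_closed_subspace:
  assumes V: "closed_subspace V"
    and ind: "\<And>\<mu> \<nu>. same_src \<mu> \<nu> \<Longrightarrow> Z \<mu> \<nu> \<subseteq> P \<Longrightarrow> indicator (Z \<mu> \<nu>) \<in> V"
    and f: "f \<in> Cstar \<Lambda>" "\<And>a. f a \<noteq> 0 \<Longrightarrow> a \<in> P"
  shows "f \<in> V"
proof (rule synthesis[OF V f(1)])
  fix \<mu> \<nu> assume s: "same_src \<mu> \<nu>"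
  show "(\<lambda>a. f a * indicator (Z \<mu> \<nu>) a) \<in> V"
  proof (rule closed_subspaceD(4)[OF V norm_closureI])
    show "f a * indicator (Z \<mu> \<nu>) a = 0" if "a \<notin> G" for a
      using Cstar_outside[OF f(1) that] by simp
    fix \<epsilon> :: real assume e: "\<epsilon> > 0"
    obtain j where j: "\<And>a b. a \<in> Z \<mu> \<nu> \<Longrightarrow> b \<in> cyl_at a (deg \<Lambda> \<mu> + j) (deg \<Lambda> \<nu> + j) \<Longrightarrow> cmod (f b - f a) < \<epsilon>"
      using Cstar_asymp_locally_constant[OF f(1)] s e unfolding asymp_locally_constant_def by blast
    \<comment> \<open>A part on which \<open>f\<close> has a zero may leave \<open>P\<close>, but
      there \<open>f\<close> is smaller than \<open>\<epsilon>\<close> throughout, so the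
      coefficient 0 is accurate enough.\<close>
    define c where "c C = (if \<forall>a\<in>C. f a \<noteq> 0 then f (rep C) else 0)" for C
    have "(\<lambda>a. c C * indicator C a) \<in> V" if C: "C \<in> parts \<mu> \<nu> j" for C
    proof (cases "\<forall>a\<in>C. f a \<noteq> 0")
      case True
      obtain \<mu>' \<nu>' where "C = Z \<mu>' \<nu>'" "same_src \<mu>' \<nu>'"
        using partsE[OF C s] by metis
      then have "indicator C \<in> V"
        using ind True f(2) by blast
      then show ?thesis by (rule closed_subspaceD(3)[OF V])
    next
      case False
      then have "c C = 0" unfolding c_def by (rule if_not_P)
      then show ?thesis using closed_subspaceD(1)[OF V] by simp
    qed
    then have "(\<lambda>a. \<Sum>C\<in>parts \<mu> \<nu> j. c C * indicator C a) \<in> V"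
      by (rule closed_subspace_sum[OF V finite_parts[OF s]])
    moreover have "opbd (\<lambda>a. f a * indicator (Z \<mu> \<nu>) a - (\<Sum>C\<in>parts \<mu> \<nu> j. c C * indicator C a)) \<epsilon>"
    proof (rule opbd_parts[OF s])
      fix a assume a: "a \<in> Z \<mu> \<nu>"
      let ?C = "cyl_at a (deg \<Lambda> \<mu> + j) (deg \<Lambda> \<nu> + j)"
      show "cmod (f a - c ?C) \<le> \<epsilon>"
      proof (cases "\<forall>a\<in>?C. f a \<noteq> 0")
        case True
        have "rep ?C \<in> ?C"
          unfolding rep_def using in_own_cyl_at[OF s a] by (rule someI)
        from j[OF a this] show ?thesis
          using True norm_minus_commute[of "f a"] by (simp add: c_def)
      next
        case False
        then obtain b where "b \<in> ?C" "f b = 0" by blast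
        moreover have "c ?C = 0"
          using False unfolding c_def by (rule if_not_P)
        ultimately show ?thesis
          using j[OF a, of b] by simp
      qed
    qed (use e in simp)
    ultimately show "\<exists>h\<in>V. opbd (\<lambda>a. f a * indicator (Z \<mu> \<nu>) a - h a) \<epsilon>"
      by (intro bexI)
  qed
qed

section \<open>Gauge invariance and generated bimodules\<close>

lemma gauge_fun_conv_diagonal:
  assumes t: "t \<in> torus" and h: "h \<in> diagonal \<Lambda>"
  shows "gauge_fun t (conv \<Lambda> h f) = conv \<Lambda> h (gauge_fun t f)"
    "gauge_fun t (conv \<Lambda> f h) = conv \<Lambda> (gauge_fun t f) h"
proof -
  have "gauge_fun t h a = h a" for a
    using h by (cases "h a = 0") (auto simp: gauge_fun_def diagonal_def units_def)
  then have "gauge_fun t h = h" by blast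
  then show "gauge_fun t (conv \<Lambda> h f) = conv \<Lambda> h (gauge_fun t f)"
    "gauge_fun t (conv \<Lambda> f h) = conv \<Lambda> (gauge_fun t f) h"
    using gauge_conv[OF t] by metis+
qed

text \<open>For use with the minimality of a generated bimodule. The gauge map is linear,
  contractive and multiplicative and fixes the diagonal, so it pulls bimodules back to
  bimodules.\<close>

lemma bimodule_gauge_preimage:
  assumes B: "bimodule \<Lambda> B" and t: "t \<in> torus"
  shows "bimodule \<Lambda> {f \<in> Cstar \<Lambda>. gauge_fun t f \<in> B}"
proof -
  note V = bimodule_closed_subspace[OF B] and A = closed_subspace_Cstar
  let ?B = "{f \<in> Cstar \<Lambda>. gauge_fun t f \<in> B}"
  have "(\<lambda>a. 0) \<in> ?B"
    using closed_subspaceD(1)[OF V] closed_subspaceD(1)[OF A] by (simp add: gauge_fun_def)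
  moreover have "(\<lambda>a. f a + g a) \<in> ?B" if "f \<in> ?B" "g \<in> ?B" for f g
  proof -
    have "gauge_fun t (\<lambda>a. f a + g a) = (\<lambda>a. gauge_fun t f a + gauge_fun t g a)"
      by (simp add: gauge_fun_def algebra_simps)
    then show ?thesis
      using that closed_subspaceD(2)[OF V] closed_subspaceD(2)[OF A] by simp
  qed
  moreover have "(\<lambda>a. c * f a) \<in> ?B" if "f \<in> ?B" for c f
  proof -
    have "gauge_fun t (\<lambda>a. c * f a) = (\<lambda>a. c * gauge_fun t f a)"
      by (simp add: gauge_fun_def algebra_simps)
    then show ?thesis
      using that closed_subspaceD(3)[OF V] closed_subspaceD(3)[OF A] by simp
  qed
  moreover have "norm_closure \<Lambda> ?B \<subseteq> ?B"
  proof
    fix f assume f: "f \<in> norm_closure \<Lambda> ?B"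
    then have "f \<in> norm_closure \<Lambda> (Cstar \<Lambda>)"
      using norm_closure_mono[of ?B "Cstar \<Lambda>"] by blast
    then have fC: "f \<in> Cstar \<Lambda>"
      by (rule closed_subspaceD(4)[OF A])
    have "gauge_fun t f \<in> norm_closure \<Lambda> B"
    proof (rule norm_closureI)
      fix \<epsilon> :: real assume "\<epsilon> > 0"
      from norm_closureE[OF f this] obtain g where g: "g \<in> ?B" "opbd (\<lambda>a. f a - g a) \<epsilon>" .
      then show "\<exists>h\<in>B. opbd (\<lambda>a. gauge_fun t f a - h a) \<epsilon>"
        using opbd_gauge[OF t g(2)] by (intro bexI[of _ "gauge_fun t g"]) (simp_all add: gauge_diff)
    qed (use Cstar_outside[OF fC] in \<open>simp add: gauge_fun_def\<close>)
    then show "f \<in> ?B"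
      using fC closed_subspaceD(4)[OF V] by simp
  qed
  moreover have "conv \<Lambda> h f \<in> ?B \<and> conv \<Lambda> f h \<in> ?B" if "h \<in> diagonal \<Lambda>" "f \<in> ?B" for h f
  proof -
    have "h \<in> Cstar \<Lambda>" "f \<in> Cstar \<Lambda>" "gauge_fun t f \<in> B"
      using that by (auto simp: diagonal_def)
    then show ?thesis
      using conv_Cstar B that(1) gauge_fun_conv_diagonal[OF t that(1)] unfolding bimodule_def by auto
  qed
  ultimately show ?thesis
    unfolding bimodule_def by blast
qed

lemma gauge_invariant_iff:
  assumes "bimodule \<Lambda> B"
  shows "(\<forall>t\<in>torus. gauge_aut \<Lambda> t ` B \<subseteq> B) \<longleftrightarrow> gauge_invariant B"
proof -
  have "gauge_aut \<Lambda> t f = gauge_fun t f" if "t \<in> torus" "f \<in> B" for t f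
    using that assms gauge_aut_eq unfolding bimodule_def by auto
  then show ?thesis
    unfolding gauge_invariant_def image_subset_iff by simp
qed

lemma gauge_invariant_supported_in: "gauge_invariant (supported_in \<Lambda> P)"
  using gauge_Cstar by (auto simp: gauge_invariant_def supported_in_def gauge_fun_def)

lemma CK_gauge:
  assumes B: "bimodule \<Lambda> B" and f: "f \<in> CK_partial_isometries \<Lambda> \<inter> B"
  shows "gauge_fun t f \<in> B"
proof -
  obtain \<mu> \<nu> where C: "f = indicator (Z \<mu> \<nu>)" "same_src \<mu> \<nu>"
    using f by (auto simp: CK_partial_isometries_eq cylinders_def)
  show ?thesis
    unfolding C(1) gauge_indicator[OF C(2)] using f C(1)
    by (intro closed_subspaceD(3)[OF bimodule_closed_subspace[OF B]]) blast
qed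

lemma gauge_invariant_generated:
  assumes B: "bimodule \<Lambda> B" and gen: "B = generated_bimodule \<Lambda> (CK_partial_isometries \<Lambda> \<inter> B)"
  shows "gauge_invariant B"
  unfolding gauge_invariant_def
proof (intro ballI)
  fix t :: "complex ^ 'k" and f assume t: "t \<in> torus" and f: "f \<in> B"
  let ?B = "{f \<in> Cstar \<Lambda>. gauge_fun t f \<in> B}"
  \<comment> \<open>The gauge map multiplies Cuntz-Krieger elements by scalars, so the preimage
    contains those lying in \<open>B\<close>, and by minimality the bimodule they generate.\<close>
  have "CK_partial_isometries \<Lambda> \<inter> B \<subseteq> ?B"
    using CK_gauge[OF B] B unfolding bimodule_def by blast
  then have "generated_bimodule \<Lambda> (CK_partial_isometries \<Lambda> \<inter> B) \<subseteq> ?B"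
    unfolding generated_bimodule_def using bimodule_gauge_preimage[OF B t] by blast
  then show "gauge_fun t f \<in> B"
    using gen f by blast
qed

lemma bimodule_subset_supported_in: "bimodule \<Lambda> B \<Longrightarrow> B \<subseteq> supported_in \<Lambda> (spectrum \<Lambda> B)"
  unfolding bimodule_def supported_in_def spectrum_def by blast

text \<open>\<open>V\<close> is kept general: \<open>V = B\<close> yields determination by the
  spectrum, and letting \<open>V\<close> run over the bimodules in the defining intersection yields
  generation.\<close>

lemma supported_in_spectrum_subset:
  assumes B: "bimodule \<Lambda> B" and inv: "gauge_invariant B"
    and V: "bimodule \<Lambda> V" "CK_partial_isometries \<Lambda> \<inter> B \<subseteq> V"
  shows "supported_in \<Lambda> (spectrum \<Lambda> B) \<subseteq> V"
proof
  fix f assume f: "f \<in> supported_in \<Lambda> (spectrum \<Lambda> B)"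
  show "f \<in> V"
  proof (rule supported_functions_in_closed_subspace[OF bimodule_closed_subspace[OF V(1)]])
    show "f \<in> Cstar \<Lambda>"
      using f by (simp add: supported_in_def)
    show "a \<in> spectrum \<Lambda> B" if "f a \<noteq> 0" for a
      using f that Cstar_outside[of f a] unfolding supported_in_def by blast
    fix \<mu> \<nu> assume s: "same_src \<mu> \<nu>" and sub: "Z \<mu> \<nu> \<subseteq> spectrum \<Lambda> B"
    have "indicator (Z \<mu> \<nu>) \<in> CK_partial_isometries \<Lambda>"
      using s unfolding CK_partial_isometries_eq cylinders_def by blast
    then show "indicator (Z \<mu> \<nu>) \<in> V"
      using cylinder_in_spectrum[OF B inv s sub] V(2) by blast
  qed
qed

end

theorem mainTheorem1:
  fixes \<Lambda> :: "('m, 'k::finite) kgraph"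
    and B :: "(('m, 'k) garrow \<Rightarrow> complex) set"
  assumes "is_kgraph \<Lambda>"
    and "row_finite_no_sources \<Lambda>"
    and "bimodule \<Lambda> B"
  shows "(B = supported_in \<Lambda> (spectrum \<Lambda> B)
            \<longleftrightarrow> B = generated_bimodule \<Lambda> (CK_partial_isometries \<Lambda> \<inter> B))
       \<and> (B = generated_bimodule \<Lambda> (CK_partial_isometries \<Lambda> \<inter> B)
            \<longleftrightarrow> (\<forall>t\<in>torus. gauge_aut \<Lambda> t ` B \<subseteq> B))"
proof -
  interpret higher_rank_graph \<Lambda>
    using assms(1,2) by unfold_locales
  note B = assms(3)
  have "B = supported_in \<Lambda> (spectrum \<Lambda> B) \<longleftrightarrow> gauge_invariant B"
  proof
    show "gauge_invariant B" if "B = supported_in \<Lambda> (spectrum \<Lambda> B)"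
      using gauge_invariant_supported_in[of "spectrum \<Lambda> B"] that by metis
    show "B = supported_in \<Lambda> (spectrum \<Lambda> B)" if "gauge_invariant B"
      using supported_in_spectrum_subset[OF B that B] bimodule_subset_supported_in[OF B] by blast
  qed
  moreover have "B = generated_bimodule \<Lambda> (CK_partial_isometries \<Lambda> \<inter> B) \<longleftrightarrow> gauge_invariant B"
  proof
    show "B = generated_bimodule \<Lambda> (CK_partial_isometries \<Lambda> \<inter> B)" if inv: "gauge_invariant B"
    proof
      show "generated_bimodule \<Lambda> (CK_partial_isometries \<Lambda> \<inter> B) \<subseteq> B"
        unfolding generated_bimodule_def using B by blast
      show "B \<subseteq> generated_bimodule \<Lambda> (CK_partial_isometries \<Lambda> \<inter> B)"
        unfolding generated_bimodule_def
        using supported_in_spectrum_subset[OF B inv] bimodule_subset_supported_in[OF B] by blast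
    qed
  qed (rule gauge_invariant_generated[OF B])
  ultimately show ?thesis
    using gauge_invariant_iff[OF B] by blast
qed

end
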